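(* Let $\Bbbk$ be an algebraically closed field of characteristic zero, $N > 1$ an odd integer, and $q \in \Bbbk$ a primitive $N$-th root of unity. The non-trivial normal right coideal subalgebras of $\overline{\mathcal{O}}_q(SL_2)$ are $$\langle a^{-1}b \rangle, \quad \langle cd^{-1} \rangle \quad\text{and}\quad \langle a^{N/r}, a^{-1}b, ac \rangle = \langle d^{N/r}, bd, cd^{-1} \rangle,$$ where $r$ varies among all positive divisors of $N$ with $r < N$.
   Context: $\overline{\mathcal{O}}_q(SL_2)$ is the algebra generated by $a,b,c,d$ subject to $ba = qab$, $ca = qac$, $bc = cb$, $db = qbd$, $dc = qcd$, $ad - q^{-1}bc = da - qbc = a^N = d^N = 1$, $b^N = c^N = 0$; it is a Hopf algebra with $\Delta(a) = a\otimes a + b \otimes c$, $\Delta(b) = a \otimes b + b \otimes d$, $\Delta(c) = c \otimes a + d \otimes c$, $\Delta(d) = c \otimes b + d \otimes d$. Note $a^{-1}=a^{N-1}$, $d^{-1}=d^{N-1}$. A right coideal subalgebra of a Hopf algebra $H$ (with antipode $S$) is a (unital) subalgebra $A$ with $\Delta(A) \subset A \otimes H$. It is normal if $S(h_{(1)})\, x\, h_{(2)} \in A$ for all $x \in A$, $h \in H$. The trivial normal right coideal subalgebras are $\Bbbk$ and $H$. $\langle\cdots\rangle$ denotes the unital subalgebra generated by the indicated elements. *)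

theory Defs
  imports
    "HOL-Computational_Algebra.Polynomial"
    "HOL-Library.Poly_Mapping"
begin

definition primitive_root_of_unity :: "nat \<Rightarrow> 'a::field \<Rightarrow> bool" where
  "primitive_root_of_unity N q \<longleftrightarrow> N > 0 \<and> q ^ N = 1 \<and> (\<forall>m. 0 < m \<and> m < N \<longrightarrow> q ^ m \<noteq> 1)"


section \<open>Formal linear combinations and free algebras\<close>

definition fscale :: "'k::field \<Rightarrow> ('x \<Rightarrow>\<^sub>0 'k) \<Rightarrow> ('x \<Rightarrow>\<^sub>0 'k)" where
  "fscale r p = Poly_Mapping.map ((*) r) p"

lemma lookup_fscale: "Poly_Mapping.lookup (fscale r p) x = r * Poly_Mapping.lookup p x"
  by (simp add: fscale_def Poly_Mapping.map.rep_eq when_def)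

lemma vector_space_fscale: "vector_space (fscale :: 'k::field \<Rightarrow> ('x \<Rightarrow>\<^sub>0 'k) \<Rightarrow> _)"
  by unfold_locales
    (auto intro!: poly_mapping_eqI simp: lookup_fscale lookup_add algebra_simps)

text \<open>
  Words over an alphabet, written additively (concatenation is \<open>+\<close>, the empty word is \<open>0\<close>).
  With this convention the convolution product of \<^theory>\<open>HOL-Library.Poly_Mapping\<close> turns
  \<open>'g word \<Rightarrow>\<^sub>0 'k\<close> into the free unital associative \<open>'k\<close>-algebra on the alphabet.
\<close>

datatype 'g word = Word (letters: "'g list")

instantiation word :: (type) monoid_add
begin

definition zero_word :: "'a word" where
  "zero_word = Word []"

definition plus_word :: "'a word \<Rightarrow> 'a word \<Rightarrow> 'a word" where
  "plus_word v w = Word (letters v @ letters w)"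

instance
  by standard (simp_all add: zero_word_def plus_word_def)

end

type_synonym ('g, 'k) free_algebra = "'g word \<Rightarrow>\<^sub>0 'k"

definition free_gen :: "'g \<Rightarrow> ('g, 'k::field) free_algebra" where
  "free_gen g = Poly_Mapping.single (Word [g]) 1"

definition free_const :: "'k::field \<Rightarrow> ('g, 'k) free_algebra" where
  "free_const r = Poly_Mapping.single 0 r"

definition two_sided_ideal :: "'r::ring_1 set \<Rightarrow> bool" where
  "two_sided_ideal I \<longleftrightarrow>
     0 \<in> I \<and> (\<forall>x\<in>I. \<forall>y\<in>I. x + y \<in> I) \<and> (\<forall>x\<in>I. \<forall>r. r * x \<in> I \<and> x * r \<in> I)"


section \<open>Algebras over a field\<close>

locale k_algebra = vector_space scale
  for scale :: "'k::field \<Rightarrow> 'h::ring_1 \<Rightarrow> 'h" +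
  assumes scale_mult_left: "scale r x * y = scale r (x * y)"
    and scale_mult_right: "x * scale r y = scale r (x * y)"
begin

definition subalgebra :: "'h set \<Rightarrow> bool" where
  "subalgebra A \<longleftrightarrow> subspace A \<and> 1 \<in> A \<and> (\<forall>x\<in>A. \<forall>y\<in>A. x * y \<in> A)"

definition generated :: "'h set \<Rightarrow> 'h set" where
  "generated X = subalgebra hull X"

definition scalars :: "'h set" where
  "scalars = (\<lambda>r. scale r 1) ` UNIV"

definition eval_free :: "('g \<Rightarrow> 'h) \<Rightarrow> ('g, 'k) free_algebra \<Rightarrow> 'h" where
  "eval_free x p =
     (\<Sum>w\<in>Poly_Mapping.keys p. scale (Poly_Mapping.lookup p w) (prod_list (map x (letters w))))"

text \<open>
  The algebra is generated by the family \<open>x\<close> subject (exactly) to the relations \<open>p = 0\<close>, \<open>p \<in> R\<close>: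
  evaluation identifies it with the quotient of the free algebra by the two-sided ideal
  generated by \<open>R\<close>.
\<close>
definition presented_by :: "('g \<Rightarrow> 'h) \<Rightarrow> ('g, 'k) free_algebra set \<Rightarrow> bool" where
  "presented_by x R \<longleftrightarrow>
     (\<forall>h. \<exists>p. eval_free x p = h) \<and> {p. eval_free x p = 0} = two_sided_ideal hull R"

end


section \<open>Tensor products\<close>

text \<open>
  The subspace by which one divides the vector space with basis \<open>V \<times> W\<close> in order to obtain
  \<open>V \<otimes> W\<close>.
\<close>
definition bilinear_relators ::
  "('k::field \<Rightarrow> 'v::ab_group_add \<Rightarrow> 'v) \<Rightarrow> ('k \<Rightarrow> 'w::ab_group_add \<Rightarrow> 'w)
     \<Rightarrow> ('v \<times> 'w \<Rightarrow>\<^sub>0 'k) set" where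
  "bilinear_relators sV sW =
     {Poly_Mapping.single (x + x', y) 1 - Poly_Mapping.single (x, y) 1
        - Poly_Mapping.single (x', y) 1 | x x' y. True}
   \<union> {Poly_Mapping.single (x, y + y') 1 - Poly_Mapping.single (x, y) 1
        - Poly_Mapping.single (x, y') 1 | x y y'. True}
   \<union> {Poly_Mapping.single (sV r x, y) 1 - Poly_Mapping.single (x, y) r | r x y. True}
   \<union> {Poly_Mapping.single (x, sW r y) 1 - Poly_Mapping.single (x, y) r | r x y. True}"

definition tensor_null ::
  "('k::field \<Rightarrow> 'v::ab_group_add \<Rightarrow> 'v) \<Rightarrow> ('k \<Rightarrow> 'w::ab_group_add \<Rightarrow> 'w)
     \<Rightarrow> ('v \<times> 'w \<Rightarrow>\<^sub>0 'k) set" where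
  "tensor_null sV sW = module.span fscale (bilinear_relators sV sW)"

text \<open>
  The algebra \<open>'t\<close> together with \<open>tensor\<close> is the tensor square \<open>H \<otimes> H\<close> of the algebra \<open>H = 'h\<close>.
\<close>
locale tensor_square = H: k_algebra scale + T: k_algebra tscale
  for scale :: "'k::field \<Rightarrow> 'h::ring_1 \<Rightarrow> 'h"
    and tscale :: "'k \<Rightarrow> 't::ring_1 \<Rightarrow> 't" +
  fixes tensor :: "'h \<Rightarrow> 'h \<Rightarrow> 't" (infixl \<open>\<otimes>\<close> 72)
  assumes tensor_surj:
      "\<exists>p :: 'h \<times> 'h \<Rightarrow>\<^sub>0 'k.
         (\<Sum>(x, y)\<in>Poly_Mapping.keys p. tscale (Poly_Mapping.lookup p (x, y)) (x \<otimes> y)) = t"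
    and tensor_kernel:
      "{p :: 'h \<times> 'h \<Rightarrow>\<^sub>0 'k.
         (\<Sum>(x, y)\<in>Poly_Mapping.keys p. tscale (Poly_Mapping.lookup p (x, y)) (x \<otimes> y)) = 0}
       = tensor_null scale scale"
    and tensor_mult: "(x \<otimes> y) * (x' \<otimes> y') = (x * x') \<otimes> (y * y')"
    and tensor_one: "1 \<otimes> 1 = 1"


section \<open>Hopf algebras and normal right coideal subalgebras\<close>

locale comult_algebra = tensor_square scale tscale tensor
  for scale :: "'k::field \<Rightarrow> 'h::ring_1 \<Rightarrow> 'h"
    and tscale :: "'k \<Rightarrow> 't::ring_1 \<Rightarrow> 't"
    and tensor :: "'h \<Rightarrow> 'h \<Rightarrow> 't" (infixl \<open>\<otimes>\<close> 72) +
  fixes comult :: "'h \<Rightarrow> 't"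
begin

text \<open>
  The list \<open>us\<close> of pairs is a Sweedler decomposition \<open>h\<^sub>(\<^sub>1\<^sub>) \<otimes> h\<^sub>(\<^sub>2\<^sub>)\<close> of the coproduct of \<open>h\<close>. Expressions
  that are bilinear in \<open>h\<^sub>(\<^sub>1\<^sub>)\<close> and \<open>h\<^sub>(\<^sub>2\<^sub>)\<close> do not depend on the chosen decomposition, and every \<open>h\<close>
  has one; below we quantify over all of them.
\<close>
definition sweedler :: "'h \<Rightarrow> ('h \<times> 'h) list \<Rightarrow> bool" where
  "sweedler h us \<longleftrightarrow> comult h = (\<Sum>(u, v)\<leftarrow>us. u \<otimes> v)"

end

text \<open>
  In \<open>coassoc\<close>, \<open>r\<close> chooses a Sweedler decomposition of every element, and the equation
  \<open>\<Sum> \<Delta>(h\<^sub>(\<^sub>1\<^sub>)) \<otimes> h\<^sub>(\<^sub>2\<^sub>) = \<Sum> (h\<^sub>(\<^sub>1\<^sub>) \<otimes> h\<^sub>(\<^sub>2\<^sub>)\<^sub>(\<^sub>1\<^sub>)) \<otimes> h\<^sub>(\<^sub>2\<^sub>)\<^sub>(\<^sub>2\<^sub>)\<close> is the one in \<open>(H \<otimes> H) \<otimes> H\<close>.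
\<close>
locale hopf_algebra = comult_algebra scale tscale tensor comult
  for scale :: "'k::field \<Rightarrow> 'h::ring_1 \<Rightarrow> 'h"
    and tscale :: "'k \<Rightarrow> 't::ring_1 \<Rightarrow> 't"
    and tensor :: "'h \<Rightarrow> 'h \<Rightarrow> 't" (infixl \<open>\<otimes>\<close> 72)
    and comult :: "'h \<Rightarrow> 't" +
  fixes counit :: "'h \<Rightarrow> 'k"
    and antipode :: "'h \<Rightarrow> 'h"
  assumes comult_linear: "Vector_Spaces.linear scale tscale comult"
    and comult_mult: "comult (x * y) = comult x * comult y"
    and comult_one: "comult 1 = 1"
    and counit_linear: "Vector_Spaces.linear scale (*) counit"
    and counit_mult: "counit (x * y) = counit x * counit y"
    and counit_one: "counit 1 = 1"
    and coassoc:
      "(\<And>x. sweedler x (r x)) \<Longrightarrow>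
         (\<Sum>(u, v)\<leftarrow>r h. Poly_Mapping.single (comult u, v) 1)
         - (\<Sum>(u, v)\<leftarrow>r h. \<Sum>(v', v'')\<leftarrow>r v. Poly_Mapping.single (u \<otimes> v', v'') 1)
         \<in> tensor_null tscale scale"
    and counit_left: "sweedler h us \<Longrightarrow> (\<Sum>(u, v)\<leftarrow>us. scale (counit u) v) = h"
    and counit_right: "sweedler h us \<Longrightarrow> (\<Sum>(u, v)\<leftarrow>us. scale (counit v) u) = h"
    and antipode_linear: "Vector_Spaces.linear scale scale antipode"
    and antipode_left:
      "sweedler h us \<Longrightarrow> (\<Sum>(u, v)\<leftarrow>us. antipode u * v) = scale (counit h) 1"
    and antipode_right:
      "sweedler h us \<Longrightarrow> (\<Sum>(u, v)\<leftarrow>us. u * antipode v) = scale (counit h) 1"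
begin

text \<open>\<open>A \<otimes> H\<close> is regarded as a subspace of \<open>H \<otimes> H\<close>.\<close>
definition right_coideal_subalgebra :: "'h set \<Rightarrow> bool" where
  "right_coideal_subalgebra A \<longleftrightarrow>
     H.subalgebra A \<and> comult ` A \<subseteq> T.span {x \<otimes> h | x h. x \<in> A}"

definition normal_right_coideal_subalgebra :: "'h set \<Rightarrow> bool" where
  "normal_right_coideal_subalgebra A \<longleftrightarrow>
     right_coideal_subalgebra A \<and>
     (\<forall>x\<in>A. \<forall>h us. sweedler h us \<longrightarrow> (\<Sum>(u, v)\<leftarrow>us. antipode u * x * v) \<in> A)"

definition nontrivial_normal_right_coideal_subalgebra :: "'h set \<Rightarrow> bool" where
  "nontrivial_normal_right_coideal_subalgebra A \<longleftrightarrow>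
     normal_right_coideal_subalgebra A \<and> A \<noteq> H.scalars \<and> A \<noteq> UNIV"

end


section \<open>The restricted quantized coordinate algebra of \<open>SL\<^sub>2\<close>\<close>

datatype generator = GA | GB | GC | GD

definition Oq_SL2_relators :: "'k::field \<Rightarrow> nat \<Rightarrow> (generator, 'k) free_algebra set" where
  "Oq_SL2_relators q N =
     (let a = free_gen GA; b = free_gen GB; c = free_gen GC; d = free_gen GD in
      {b * a - free_const q * a * b,
       c * a - free_const q * a * c,
       b * c - c * b,
       d * b - free_const q * b * d,
       d * c - free_const q * c * d,
       a * d - free_const (inverse q) * b * c - 1,
       d * a - free_const q * b * c - 1,
       a ^ N - 1,
       d ^ N - 1,
       b ^ N,
       c ^ N})"

text \<open>
  The counit and the antipode are uniquely determined by the comultiplication, so their values on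
  the generators need not be prescribed.
\<close>
locale Oq_SL2 = hopf_algebra scale tscale tensor comult counit antipode
  for scale :: "'k::field \<Rightarrow> 'h::ring_1 \<Rightarrow> 'h"
    and tscale :: "'k \<Rightarrow> 't::ring_1 \<Rightarrow> 't"
    and tensor :: "'h \<Rightarrow> 'h \<Rightarrow> 't" (infixl \<open>\<otimes>\<close> 72)
    and comult :: "'h \<Rightarrow> 't"
    and counit :: "'h \<Rightarrow> 'k"
    and antipode :: "'h \<Rightarrow> 'h" +
  fixes q :: 'k
    and N :: nat
    and a b c d :: 'h
  assumes presentation: "H.presented_by (case_generator a b c d) (Oq_SL2_relators q N)"
    and comult_a: "comult a = a \<otimes> a + b \<otimes> c"
    and comult_b: "comult b = a \<otimes> b + b \<otimes> d"
    and comult_c: "comult c = c \<otimes> a + d \<otimes> c"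
    and comult_d: "comult d = c \<otimes> b + d \<otimes> d"

end

theory Submission
  imports Defs "HOL-Library.Product_Plus"
begin

text \<open>
  Put \<open>x = a\<^sup>-\<^sup>1 b\<close>, \<open>y = c d\<^sup>-\<^sup>1\<close> and \<open>z = a c\<close>. A right coideal is stable under the hit operators
  \<open>K, E, F\<close> of the small quantum group, and normality adds stability under the four operators
  \<open>u \<mapsto> \<Sum>\<^sub>k S(t\<^sub>i\<^sub>k) u t\<^sub>k\<^sub>j\<close> attached to the matrix \<open>t\<close> of generators. A subalgebra \<open>A\<close> with these
  stability properties is determined by its vectors killed by \<open>F\<close> and by \<open>E\<close>. If \<open>F\<close> kills only the
  scalars of \<open>A\<close>, then \<open>F\<close> is a single Jordan block on \<open>A\<close> and the adjoint operators force \<open>A\<close> to be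
  trivial or generated by \<open>x\<close>; symmetrically for \<open>E\<close> and \<open>y\<close>. If \<open>F\<close> kills a nonscalar vector of \<open>A\<close>,
  the adjoint operators move it to an element of the form \<open>d\<^sup>n a\<^sup>-\<^sup>n\<^sup>-\<^sup>k c\<^sup>k\<close>, from which one descends to \<open>y\<close>;
  symmetrically for \<open>E\<close> and \<open>x\<close>. Finally, if \<open>A\<close> contains \<open>x\<close> and \<open>y\<close>, it contains the left weight
  space of weight \<open>0\<close>, which is generated by \<open>x\<close> and \<open>z\<close>, and then it is the sum of the left weight
  spaces whose weights lie in a subgroup of \<open>\<int>/N\<close>.
\<close>

section \<open>Linear algebra in algebras\<close>

text \<open>The Hopf algebra is known only through its presentation: a basis, the counit and
  antipode on the generators, and the fact that the antipode reverses products all have to be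
  derived. Representations satisfying the relations supply the functionals behind \<open>K\<close>,
  \<open>E\<close>, \<open>F\<close>, and these operators in turn show that the monomials
  \<open>a^i b^j c^k\<close> with exponents below \<open>N\<close> form a basis.

  Division inside an arbitrary subalgebra \<open>A\<close> rests on nilpotency: \<open>b\<close>
  generates a nilpotent ideal, so an element congruent to a nonzero multiple of a power of
  \<open>a\<close> modulo this ideal is invertible, and its inverse is a polynomial in the element
  itself, hence stays in \<open>A\<close>.

  Oddness of \<open>N\<close> enters because weights get doubled: \<open>q^2\<close> must again have
  order \<open>N\<close>, and \<open>2\<close> must be invertible modulo \<open>N\<close>.

  The mirror symmetry exchanges \<open>E\<close> with \<open>F\<close>, and \<open>x\<close> with
  \<open>y\<close> up to a nonzero scalar, so each one-sided statement is proved once. A subgroup of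
  Z/N corresponds to a divisor \<open>m = N/r\<close>; the bound \<open>r < N\<close> excludes the
  whole algebra.\<close>

context vector_space
begin

text \<open>\<open>T - ev u\<close> annihilates the summand \<open>v u\<close> and multiplies every
  other summand by a nonzero scalar, since \<open>ev\<close> is injective. The rescaled summands are
  again eigenvectors, so the induction applies to them; \<open>v u\<close> is recovered as a
  difference.\<close>

lemma eigen_components:
  assumes "finite W" and A: "subspace A" and T_add: "\<And>x y. T (x + y) = T x + T y"
    and T_scale: "\<And>r x. T (scale r x) = scale r (T x)"
    and T_A: "\<And>x. x \<in> A \<Longrightarrow> T x \<in> A"
    and eigen: "\<And>w. w \<in> W \<Longrightarrow> T (v w) = scale (ev w) (v w)"
    and inj: "inj_on ev W" and sum: "(\<Sum>w\<in>W. v w) \<in> A" and "w \<in> W"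
  shows "v w \<in> A"
  using \<open>finite W\<close> eigen inj sum \<open>w \<in> W\<close>
proof (induction W arbitrary: v w rule: finite_induct)
  case empty
  then show ?case by simp
next
  case (insert u W)
  interpret T: additive T
    by unfold_locales (rule T_add)
  define v' where "v' z = scale (ev z - ev u) (v z)" for z
  have "T (\<Sum>z\<in>insert u W. v z) - scale (ev u) (\<Sum>z\<in>insert u W. v z) \<in> A"
    using insert.prems A by (intro subspace_diff T_A subspace_scale) auto
  also have "T (\<Sum>z\<in>insert u W. v z) = (\<Sum>z\<in>insert u W. scale (ev z) (v z))"
    unfolding T.sum by (intro sum.cong refl insert.prems)
  also have "\<dots> - scale (ev u) (\<Sum>z\<in>insert u W. v z) = (\<Sum>z\<in>insert u W. v' z)"
    unfolding v'_def scale_sum_right sum_subtractf[symmetric] scale_left_diff_distrib ..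
  also have "\<dots> = (\<Sum>z\<in>W. v' z)"
    using insert.hyps by (simp add: v'_def)
  finally have sum': "(\<Sum>z\<in>W. v' z) \<in> A" .
  have v_A: "v z \<in> A" if "z \<in> W" for z
  proof -
    have "v' z \<in> A"
      by (rule insert.IH[OF _ _ sum' that])
        (use insert.prems in \<open>auto simp: v'_def T_scale mult.commute inj_on_def\<close>)
    moreover have "ev z - ev u \<noteq> 0"
      using insert.prems(2) insert.hyps that by (auto simp: inj_on_def)
    ultimately show ?thesis
      using subspace_scale[OF A, of "v' z" "inverse (ev z - ev u)"] by (simp add: v'_def)
  qed
  have "v u = (\<Sum>z\<in>insert u W. v z) - (\<Sum>z\<in>W. v z)"
    using insert.hyps by simp
  also have "\<dots> \<in> A"
    by (intro subspace_diff[OF A insert.prems(3)] subspace_sum[OF A] v_A)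
  finally have "v u \<in> A" .
  then show ?case
    using insert.prems(4) v_A by auto
qed

end

context k_algebra
begin

lemma span_mult:
  assumes "u \<in> span X" "v \<in> span Y" "\<And>x y. x \<in> X \<Longrightarrow> y \<in> Y \<Longrightarrow> x * y \<in> span Z"
  shows "u * v \<in> span Z"
  using assms(1)
proof (induction rule: span_induct_alt)
  case (step r x u)
  from assms(2) have "x * v \<in> span Z"
  proof (induction rule: span_induct_alt)
    case (step s y v)
    thus ?case using assms(3)[OF \<open>x \<in> X\<close>]
      by (simp add: distrib_left scale_mult_right span_add span_scale)
  qed (simp add: span_zero)
  thus ?case using step by (simp add: distrib_right scale_mult_left span_add span_scale)
qed (simp add: span_zero)

lemma subalgebraD:
  assumes "subalgebra A"
  shows subalgebra_subspace: "subspace A" and subalgebra_one: "1 \<in> A"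
    and subalgebra_mult: "u \<in> A \<Longrightarrow> v \<in> A \<Longrightarrow> u * v \<in> A"
  using assms by (auto simp: subalgebra_def)

lemma subalgebra_add: "subalgebra A \<Longrightarrow> u \<in> A \<Longrightarrow> v \<in> A \<Longrightarrow> u + v \<in> A"
  and subalgebra_diff: "subalgebra A \<Longrightarrow> u \<in> A \<Longrightarrow> v \<in> A \<Longrightarrow> u - v \<in> A"
  and subalgebra_scale: "subalgebra A \<Longrightarrow> u \<in> A \<Longrightarrow> scale r u \<in> A"
  by (auto simp: subalgebra_def subspace_add subspace_diff subspace_scale)

lemma subalgebra_power: "subalgebra A \<Longrightarrow> u \<in> A \<Longrightarrow> u ^ n \<in> A"
  by (induction n) (auto simp: subalgebra_def)

lemma scale_mem_iff: "subspace A \<Longrightarrow> r \<noteq> 0 \<Longrightarrow> scale r u \<in> A \<longleftrightarrow> u \<in> A"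
  using subspace_scale[of A u r] subspace_scale[of A "scale r u" "inverse r"] by auto

lemma subalgebra_generated: "subalgebra (generated X)"
  unfolding generated_def
proof (rule hull_in)
  fix T :: "'h set set" assume "Ball T subalgebra"
  thus "subalgebra (\<Inter> T)"
    by (auto simp: subalgebra_def intro!: subspace_Inter)
qed

lemma generated_superset: "X \<subseteq> generated X"
  unfolding generated_def by (rule hull_subset)

lemma generated_minimal: "X \<subseteq> A \<Longrightarrow> subalgebra A \<Longrightarrow> generated X \<subseteq> A"
  unfolding generated_def by (rule hull_minimal)

lemma generated_scale: "r \<noteq> 0 \<Longrightarrow> generated (insert (scale r u) X) = generated (insert u X)"
proof -
  have *: "generated (insert (scale r u) X) \<subseteq> generated (insert u X)" for r u
    using generated_superset[of "insert u X"]
    by (intro generated_minimal subalgebra_generated) (auto intro: subalgebra_scale subalgebra_generated)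
  assume "r \<noteq> 0"
  thus ?thesis using *[of r u] *[of "inverse r" "scale r u"] by auto
qed

lemma scalars_subset: "subalgebra A \<Longrightarrow> scalars \<subseteq> A"
  by (auto simp: scalars_def subalgebra_scale subalgebra_one)

lemma subspace_scalars: "subspace scalars"
proof -
  have "scalars = span {1}" by (auto simp: scalars_def span_singleton)
  thus ?thesis by simp
qed

end

lemma sum_shift_mod:
  fixes f :: "nat \<Rightarrow> 'b::comm_monoid_add" and k :: int and N :: nat
  assumes "N > 0"
  shows "(\<Sum>i<N. f i) = (\<Sum>i<N. f (nat ((int i + k) mod int N)))"
proof (rule sum.reindex_bij_betw[symmetric])
  show "bij_betw (\<lambda>i. nat ((int i + k) mod int N)) {..<N} {..<N}"
  by (rule bij_betw_byWitness[where f' = "\<lambda>i. nat ((int i - k) mod int N)"])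
      (use assms in \<open>auto simp: mod_simps nat_less_iff\<close>)
qed

section \<open>The algebra with its hit operators\<close>

text \<open>
  The operators \<open>K\<close>, \<open>E\<close>, \<open>F\<close> are the left hit actions \<open>h \<mapsto> h\<^sub>(\<^sub>1\<^sub>) f(h\<^sub>(\<^sub>2\<^sub>))\<close> of the generators of the
  small quantum group. The locale is symmetric under
  \<open>(a, b, c, d, q, E, F) \<mapsto> (d, c, b, a, q\<^sup>-\<^sup>1, F, E)\<close>.
\<close>
locale restricted_SL2 = k_algebra scale
  for scale :: "'k::field \<Rightarrow> 'h::ring_1 \<Rightarrow> 'h" (infixr \<open>\<cdot>\<close> 75) +
  fixes q :: 'k and N :: nat and a b c d :: 'h and K E F :: "'h \<Rightarrow> 'h"
  assumes N_gt_1: "N > 1" and odd_N: "odd N" and prim: "primitive_root_of_unity N q"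
    and ba: "b * a = q \<cdot> (a * b)" and ca: "c * a = q \<cdot> (a * c)" and bc: "b * c = c * b"
    and db: "d * b = q \<cdot> (b * d)" and dc: "d * c = q \<cdot> (c * d)"
    and ad: "a * d = 1 + inverse q \<cdot> (b * c)" and da: "d * a = 1 + q \<cdot> (b * c)"
    and aN: "a ^ N = 1" and dN: "d ^ N = 1" and bN: "b ^ N = 0" and cN: "c ^ N = 0"
    and gen: "subalgebra S \<Longrightarrow> {a, b, c, d} \<subseteq> S \<Longrightarrow> S = UNIV"
    and K_add: "K (u + v) = K u + K v" and K_scale: "K (r \<cdot> u) = r \<cdot> K u"
    and K_one: "K 1 = 1" and K_mult: "K (u * v) = K u * K v"
    and K_a: "K a = q \<cdot> a" and K_b: "K b = inverse q \<cdot> b"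
    and K_c: "K c = q \<cdot> c" and K_d: "K d = inverse q \<cdot> d"
    and E_add: "E (u + v) = E u + E v" and E_scale: "E (r \<cdot> u) = r \<cdot> E u"
    and E_mult: "E (u * v) = u * E v + E u * K v"
    and E_a: "E a = b" and E_b: "E b = 0" and E_c: "E c = d" and E_d: "E d = 0"
    and F_add: "F (u + v) = F u + F v" and F_scale: "F (r \<cdot> u) = r \<cdot> F u"
    and F_mult: "F (u * v) = u * F v + F u * K v"
    and F_a: "F a = 0" and F_b: "F b = a" and F_c: "F c = 0" and F_d: "F d = c"
begin

lemma q_nz: "q \<noteq> 0"
  using prim N_gt_1 by (auto simp: primitive_root_of_unity_def power_0_left)

lemma q_pow_N: "q ^ N = 1"
  using prim by (simp add: primitive_root_of_unity_def)

lemma mirror: "restricted_SL2 scale (inverse q) N d c b a K F E"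
proof unfold_locales
  show "primitive_root_of_unity N (inverse q)"
    using prim by (auto simp: primitive_root_of_unity_def power_inverse)
  show "c * d = inverse q \<cdot> (d * c)" "b * d = inverse q \<cdot> (d * b)"
    "a * c = inverse q \<cdot> (c * a)" "a * b = inverse q \<cdot> (b * a)"
    by (simp_all add: ba ca db dc q_nz)
qed (simp_all add: N_gt_1[simplified] odd_N bc ad da aN dN bN cN gen insert_commute
    K_add K_scale K_one K_mult K_a K_b K_c K_d E_add E_scale E_mult E_a E_b E_c E_d
    F_add F_scale F_mult F_a F_b F_c F_d)

sublocale K: additive K by unfold_locales (rule K_add)
sublocale E: additive E by unfold_locales (rule E_add)
sublocale F: additive F by unfold_locales (rule F_add)

text \<open>The four operators are the entries of \<open>S(t) u t\<close> for the matrix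
  \<open>t\<close> with rows \<open>(a, b)\<close> and \<open>(c, d)\<close>. The antipode values
  \<open>S(a) = d\<close>, \<open>S(b) = - q b\<close>, \<open>S(c) = - q^-1 c\<close>,
  \<open>S(d) = a\<close> are already substituted, because this locale has no antipode.\<close>

definition ad_a :: "'h \<Rightarrow> 'h" where "ad_a u = d * u * a - q \<cdot> (b * u * c)"
definition ad_b :: "'h \<Rightarrow> 'h" where "ad_b u = d * u * b - q \<cdot> (b * u * d)"
definition ad_c :: "'h \<Rightarrow> 'h" where "ad_c u = a * u * c - inverse q \<cdot> (c * u * a)"
definition ad_d :: "'h \<Rightarrow> 'h" where "ad_d u = a * u * d - inverse q \<cdot> (c * u * b)"

definition stable :: "'h set \<Rightarrow> bool" where
  "stable A \<longleftrightarrow> subalgebra A \<and>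
     (\<forall>u\<in>A. K u \<in> A \<and> E u \<in> A \<and> F u \<in> A \<and> ad_a u \<in> A \<and> ad_b u \<in> A \<and> ad_c u \<in> A \<and> ad_d u \<in> A)"

lemma stable_mirror:
  "restricted_SL2.stable scale (inverse q) d c b a K F E A \<longleftrightarrow> stable A"
proof -
  interpret m: restricted_SL2 scale "inverse q" N d c b a K F E by (rule mirror)
  show ?thesis
    unfolding stable_def m.stable_def ad_a_def ad_b_def ad_c_def ad_d_def
      m.ad_a_def m.ad_b_def m.ad_c_def m.ad_d_def by auto
qed

section \<open>Powers of q and quantum integers\<close>

definition qi :: "int \<Rightarrow> 'k" where "qi n = q powi n"

lemma qi_0 [simp]: "qi 0 = 1" and qi_1: "qi 1 = q" and qi_neg_1: "qi (- 1) = inverse q"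
  and qi_nz [simp]: "qi n \<noteq> 0"
  using q_nz by (auto simp: qi_def power_int_minus)

lemma qi_add: "qi (m + n) = qi m * qi n" and qi_diff: "qi (m - n) = qi m / qi n"
  and qi_minus: "qi (- n) = inverse (qi n)"
  using q_nz by (auto simp: qi_def power_int_add power_int_diff power_int_minus)

lemma qi_mult: "qi m * qi n = qi (m + n)"
  by (simp add: qi_add)

lemma qi_nat: "qi (int n) = q ^ n"
  by (simp add: qi_def)

lemma qi_mod: "qi (n mod int N) = qi n"
proof -
  have "qi n = qi (int N * (n div int N) + n mod int N)" by simp
  also have "\<dots> = qi (int N * (n div int N)) * qi (n mod int N)" by (rule qi_add)
  also have "qi (int N * (n div int N)) = 1"
    by (simp add: qi_def power_int_mult q_pow_N)
  finally show ?thesis by simp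
qed

lemma qi_eq_1_iff: "qi n = 1 \<longleftrightarrow> int N dvd n"
proof
  assume "qi n = 1"
  hence "q ^ nat (n mod int N) = 1"
    using qi_mod[of n] N_gt_1 by (simp add: qi_def power_int_def)
  moreover have "nat (n mod int N) < N" using N_gt_1 by (simp add: nat_less_iff)
  ultimately have "nat (n mod int N) = 0"
    using prim unfolding primitive_root_of_unity_def by (metis neq0_conv)
  hence "n mod int N = 0" using N_gt_1 pos_mod_sign[of "int N" n] by linarith
  thus "int N dvd n" by auto
next
  assume "int N dvd n"
  thus "qi n = 1" using qi_mod[of n] by (simp add: dvd_eq_mod_eq_0)
qed

lemma qi_eq_iff: "qi m = qi n \<longleftrightarrow> int N dvd m - n"
  using qi_eq_1_iff[of "m - n"] by (simp add: qi_diff)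

text \<open>Since \<open>N\<close> is odd, \<open>2\<close> is invertible modulo \<open>N\<close>.
  Hence \<open>q^2\<close> has order \<open>N\<close> as well, and both \<open>br n\<close> and
  \<open>1 - qi (2 * n)\<close> vanish only for \<open>n\<close> divisible by
  \<open>N\<close>.\<close>

lemma N_dvd_double: "int N dvd 2 * n \<longleftrightarrow> int N dvd n"
proof -
  have "coprime (int N) 2" using odd_N by (simp add: coprime_commute)
  thus ?thesis by (simp add: coprime_dvd_mult_right_iff)
qed

lemma not_N_dvd: "0 < n \<Longrightarrow> n < int N \<Longrightarrow> \<not> int N dvd n"
  by (auto dest: zdvd_imp_le)

text \<open>The quantum integer \<open>[n]\<close>, the coefficient that \<open>E\<close> and
  \<open>F\<close> produce on \<open>n\<close>-th powers.\<close>

definition br :: "int \<Rightarrow> 'k" where "br n = (qi n - qi (- n)) / (q - inverse q)"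

lemma q_diff_nz: "q - inverse q \<noteq> 0"
proof
  assume "q - inverse q = 0"
  hence "qi 1 = qi (- 1)" by (simp add: qi_1 qi_neg_1)
  hence "int N dvd 2 * 1" by (simp add: qi_eq_iff)
  thus False unfolding N_dvd_double using N_gt_1 by (simp add: zdvd1_eq)
qed

lemma br_0 [simp]: "br 0 = 0" and br_1 [simp]: "br 1 = 1"
  using q_diff_nz by (auto simp: br_def qi_1 qi_neg_1)

lemma br_eq_0_iff: "br n = 0 \<longleftrightarrow> int N dvd n"
  using q_diff_nz N_dvd_double[of n] by (simp add: br_def qi_eq_iff)

lemma br_nz: "0 < n \<Longrightarrow> n < int N \<Longrightarrow> br n \<noteq> 0"
  by (simp add: br_eq_0_iff not_N_dvd)

lemma br_mod: "br (n mod int N) = br n"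
proof -
  have "qi (- (n mod int N)) = qi (- n)" by (simp add: qi_minus qi_mod)
  thus ?thesis by (simp add: br_def qi_mod)
qed

lemma br_Suc: "br (n + 1) = q * br n + qi (- n)" "br (n + 1) = inverse q * br n + qi n"
proof -
  have 1: "br (n + 1) = (qi n * q - qi (- n) * inverse q) / (q - inverse q)"
    by (simp only: br_def qi_minus qi_add qi_1 inverse_mult_distrib)
  have 2: "r * br n + s = (r * (qi n - qi (- n)) + s * (q - inverse q)) / (q - inverse q)" for r s
    using q_diff_nz by (simp add: br_def add_divide_distrib)
  show "br (n + 1) = q * br n + qi (- n)" "br (n + 1) = inverse q * br n + qi n"
    unfolding 1 2 by (simp_all add: algebra_simps)
qed

section \<open>Ordered monomials in a, b, c\<close>

definition ap :: "int \<Rightarrow> 'h" where "ap i = a ^ nat (i mod int N)"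

lemma a_pow_mod: "a ^ (n mod N) = a ^ n"
proof -
  have "a ^ n = a ^ (N * (n div N) + n mod N)" by simp
  also have "\<dots> = a ^ (n mod N)" unfolding power_add power_mult aN by simp
  finally show ?thesis by simp
qed

lemma ap_cong: "i mod int N = j mod int N \<Longrightarrow> ap i = ap j"
  by (simp add: ap_def)

lemma ap_nat: "ap (int n) = a ^ n"
  by (simp add: ap_def a_pow_mod flip: zmod_int)

lemma ap_0 [simp]: "ap 0 = 1" and ap_1: "ap 1 = a"
  using ap_nat[of 0] ap_nat[of 1] by simp_all

lemma ap_add: "ap (i + j) = ap i * ap j"
proof -
  have "ap (i + j) = ap (int (nat (i mod int N)) + int (nat (j mod int N)))"
    using N_gt_1 by (intro ap_cong) (simp add: mod_simps)
  also have "\<dots> = ap i * ap j"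
    unfolding of_nat_add[symmetric] ap_nat by (simp add: ap_def power_add)
  finally show ?thesis .
qed

lemma b_pow_ap: "b ^ j * ap i = qi (int j * i) \<cdot> (ap i * b ^ j)"
  and c_pow_ap: "c ^ j * ap i = qi (int j * i) \<cdot> (ap i * c ^ j)"
proof -
  have *: "u ^ j * a ^ n = q ^ (j * n) \<cdot> (a ^ n * u ^ j)" if u: "u * a = q \<cdot> (a * u)" for u n
  proof -
    have 1: "u * a ^ n = q ^ n \<cdot> (a ^ n * u)" for n
    proof (induction n)
      case (Suc n)
      have "u * a ^ Suc n = (u * a) * a ^ n" by (simp add: mult.assoc)
      also have "\<dots> = q \<cdot> (a * (u * a ^ n))" by (simp add: u scale_mult_left mult.assoc)
      also have "\<dots> = q ^ Suc n \<cdot> (a ^ Suc n * u)"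
        by (simp add: Suc scale_mult_right mult.assoc)
      finally show ?case .
    qed simp
    show ?thesis
    proof (induction j)
      case (Suc j)
      have "u ^ Suc j * a ^ n = u * (u ^ j * a ^ n)" by (simp add: mult.assoc)
      also have "\<dots> = q ^ (j * n) \<cdot> ((u * a ^ n) * u ^ j)"
        by (simp add: Suc scale_mult_right mult.assoc)
      also have "\<dots> = q ^ (Suc j * n) \<cdot> (a ^ n * u ^ Suc j)"
        by (simp add: 1 scale_mult_left mult.assoc power_add mult.commute)
      finally show ?case .
    qed simp
  qed
  have "q ^ (j * nat (i mod int N)) = qi (int j * i)"
  proof -
    have "q ^ (j * nat (i mod int N)) = qi (int j * (i mod int N))"
      using N_gt_1 by (simp flip: qi_nat)
    also have "\<dots> = qi ((int j * (i mod int N)) mod int N)" by (simp only: qi_mod)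
    also have "\<dots> = qi (int j * i)" by (simp add: mod_simps qi_mod)
    finally show ?thesis .
  qed
  thus "b ^ j * ap i = qi (int j * i) \<cdot> (ap i * b ^ j)"
    "c ^ j * ap i = qi (int j * i) \<cdot> (ap i * c ^ j)"
    using *[OF ba] *[OF ca] by (simp_all add: ap_def)
qed

text \<open>Powers of \<open>d\<close> do not occur: \<open>a\<close> is invertible, so the relation
  for \<open>a * d\<close> expresses \<open>d\<close> by such monomials (\<open>d_M\<close>). The
  exponent of \<open>a\<close> is an integer read modulo \<open>N\<close>, which gives negative
  powers without case distinctions.\<close>

definition M :: "int \<Rightarrow> nat \<Rightarrow> nat \<Rightarrow> 'h" where "M i j k = ap i * b ^ j * c ^ k"

lemma bc_pow: "c ^ k * b ^ j = b ^ j * c ^ k"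
  by (metis bc power_commuting_commutes)

lemma M_mult: "M i j k * M i' j' k' = qi (int (j + k) * i') \<cdot> M (i + i') (j + j') (k + k')"
proof -
  have "M i j k * M i' j' k' = ap i * b ^ j * (c ^ k * ap i') * b ^ j' * c ^ k'"
    by (simp add: M_def mult.assoc)
  also have "\<dots> = qi (int k * i') \<cdot> (ap i * (b ^ j * ap i') * (c ^ k * b ^ j') * c ^ k')"
    by (simp add: c_pow_ap scale_mult_left scale_mult_right mult.assoc)
  also have "\<dots> = (qi (int k * i') * qi (int j * i')) \<cdot>
      ((ap i * ap i') * (b ^ j * b ^ j') * (c ^ k * c ^ k'))"
    by (simp add: b_pow_ap bc_pow scale_mult_left scale_mult_right mult.assoc)
  finally show ?thesis
    by (simp add: M_def ap_add power_add qi_mult algebra_simps)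
qed

lemma M_cong: "i mod int N = i' mod int N \<Longrightarrow> M i j k = M i' j k"
  by (simp add: M_def ap_cong[of i i'])

lemma M_mod [simp]: "M (i mod int N) j k = M i j k"
  by (rule M_cong) simp

lemma M_eq_0: "N \<le> j \<or> N \<le> k \<Longrightarrow> M i j k = 0"
proof -
  have *: "u ^ n = 0" if "u ^ N = 0" "N \<le> n" for u :: 'h and n
    using that by (metis le_add_diff_inverse mult_zero_left power_add)
  show "N \<le> j \<or> N \<le> k \<Longrightarrow> M i j k = 0"
    using *[OF bN, of j] *[OF cN, of k] by (auto simp: M_def)
qed

lemma M_000 [simp]: "M 0 0 0 = 1" by (simp add: M_def)

lemma ap_M: "ap i = M i 0 0" by (simp add: M_def)
lemma a_M: "a = M 1 0 0" by (simp add: M_def ap_1)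
lemma b_M: "b = M 0 1 0" by (simp add: M_def)
lemma c_M: "c = M 0 0 1" by (simp add: M_def)

lemma d_M: "d = M (-1) 0 0 + inverse q \<cdot> M (-1) 1 1"
proof -
  have "d = ap (-1) * (a * d)"
    using ap_add[of "-1" 1] by (simp add: mult.assoc[symmetric] ap_1)
  also have "\<dots> = M (-1) 0 0 + inverse q \<cdot> M (-1) 1 1"
    by (simp add: ad M_def distrib_left scale_mult_right mult.assoc)
  finally show ?thesis .
qed

lemma a_mult_M: "a * M i j k = M (i + 1) j k"
  and M_mult_a: "M i j k * a = qi (int j + int k) \<cdot> M (i + 1) j k"
  and b_mult_M: "b * M i j k = qi i \<cdot> M i (Suc j) k" and M_mult_b: "M i j k * b = M i (Suc j) k"
  and c_mult_M: "c * M i j k = qi i \<cdot> M i j (Suc k)" and M_mult_c: "M i j k * c = M i j (Suc k)"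
  using M_mult[of 1 0 0 i j k, folded a_M] M_mult[of i j k 1 0 0, folded a_M]
    M_mult[of 0 1 0 i j k, folded b_M] M_mult[of i j k 0 1 0, folded b_M]
    M_mult[of 0 0 1 i j k, folded c_M] M_mult[of i j k 0 0 1, folded c_M]
  by (simp_all add: add.commute)

lemma d_mult_M: "d * M i j k = M (i - 1) j k + qi (2 * i - 1) \<cdot> M (i - 1) (Suc j) (Suc k)"
proof -
  have "d * M i j k = M (i - 1) j k + qi (- 1 + 2 * i) \<cdot> M (i - 1) (Suc j) (Suc k)"
    unfolding d_M distrib_right scale_mult_left M_mult qi_add by (simp add: qi_neg_1)
  thus ?thesis by simp
qed

lemma M_mult_d: "M i j k * d =
    qi (- int j - int k) \<cdot> (M (i - 1) j k + inverse q \<cdot> M (i - 1) (Suc j) (Suc k))"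
  unfolding d_M distrib_left scale_mult_right M_mult by (simp add: scale_right_distrib mult.commute)

lemmas M_simps = a_mult_M M_mult_a b_mult_M M_mult_b c_mult_M M_mult_c d_mult_M M_mult_d
  scale_mult_left scale_mult_right distrib_left distrib_right
  right_diff_distrib left_diff_distrib scale_right_distrib scale_right_diff_distrib

subsection \<open>The monomial basis\<close>

lemma K_power: "K u = r \<cdot> u \<Longrightarrow> K (u ^ n) = r ^ n \<cdot> u ^ n"
  by (induction n) (simp_all add: K_one K_mult scale_mult_left scale_mult_right mult.commute)

lemma K_M: "K (M i j k) = qi (i - int j + int k) \<cdot> M i j k"
proof -
  have "K (ap i) = qi i \<cdot> ap i"
    using K_power[OF K_a, of "nat (i mod int N)"] N_gt_1
    by (simp add: ap_def qi_mod flip: qi_nat)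
  moreover have "K (b ^ j) = qi (- int j) \<cdot> b ^ j"
    using K_power[OF K_b, of j] by (simp add: qi_minus qi_nat power_inverse)
  moreover have "K (c ^ k) = qi (int k) \<cdot> c ^ k"
    using K_power[OF K_c, of k] by (simp add: qi_nat)
  ultimately show ?thesis
    by (simp add: M_def K_mult scale_mult_left scale_mult_right qi_mult add.commute)
qed

lemma skew_zero_power:
  assumes "\<And>u v. D (u * v) = u * D v + D u * K v" and "D u = 0"
  shows "D (u ^ n) = 0"
proof -
  have "D (1 * 1) = 1 * D 1 + D 1 * K 1" by (rule assms(1))
  hence "D 1 = 0" by (simp add: K_one)
  thus ?thesis by (induction n) (simp_all add: assms)
qed

lemma F_one: "F 1 = 0" and E_one: "E 1 = 0"
  using skew_zero_power[of F a 0] skew_zero_power[of E b 0]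
  by (simp_all add: F_mult F_a E_mult E_b)

lemma F_b_power: "F (b ^ Suc j) = br (int j + 1) \<cdot> (a * b ^ j)"
proof (induction j)
  case (Suc j)
  have "F (b ^ Suc (Suc j)) = b ^ Suc j * a + inverse q \<cdot> (F (b ^ Suc j) * b)"
    unfolding power_Suc2[of b "Suc j"] by (simp add: F_mult F_b K_b scale_mult_right)
  also have "b ^ Suc j * a = qi (int j + 1) \<cdot> (a * b ^ Suc j)"
    using b_pow_ap[of "Suc j" 1] by (simp add: ap_1 add.commute)
  also have "inverse q \<cdot> (F (b ^ Suc j) * b) = (inverse q * br (int j + 1)) \<cdot> (a * b ^ Suc j)"
    unfolding Suc by (simp only: scale_mult_left scale_scale mult.assoc power_Suc2)
  finally show ?case
    using br_Suc(2)[of "int j + 1"] by (simp add: scale_left_distrib add.commute add.left_commute)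
qed (simp add: F_b)

lemma F_M_Suc: "F (M i (Suc j) k) = (qi (int k) * br (int j + 1)) \<cdot> M (i + 1) j k"
  and F_M_0: "F (M i 0 k) = 0"
proof -
  have Fa: "F (ap i) = 0" and Fc: "F (c ^ k) = 0"
    using skew_zero_power[of F] by (simp_all add: F_mult F_a F_c ap_def)
  have Kc: "K (c ^ k) = qi (int k) \<cdot> c ^ k"
    using K_power[OF K_c, of k] by (simp add: qi_nat)
  show "F (M i 0 k) = 0"
    by (simp add: M_def F_mult Fa Fc)
  have "F (M i (Suc j) k) = ap i * F (b ^ Suc j) * K (c ^ k)"
    by (simp only: M_def F_mult Fa Fc) simp
  also have "\<dots> = (qi (int k) * br (int j + 1)) \<cdot> (ap i * a * b ^ j * c ^ k)"
    unfolding F_b_power Kc by (simp add: scale_mult_left scale_mult_right mult.assoc mult.commute)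
  finally show "F (M i (Suc j) k) = (qi (int k) * br (int j + 1)) \<cdot> M (i + 1) j k"
    by (simp add: M_def ap_add ap_1)
qed

lemma E_c_power: "E (c ^ Suc k) = br (int k + 1) \<cdot> (d * c ^ k)"
proof (induction k)
  case (Suc k)
  have cd: "c * d = inverse q \<cdot> (d * c)" by (simp add: dc q_nz)
  have cd': "c ^ n * d = qi (- int n) \<cdot> (d * c ^ n)" for n
  proof (induction n)
    case (Suc n)
    have "c ^ Suc n * d = c * (c ^ n * d)" by (simp add: mult.assoc)
    also have "\<dots> = qi (- int n) \<cdot> (c * d * c ^ n)"
      by (simp add: Suc scale_mult_right mult.assoc)
    also have "\<dots> = qi (- int (Suc n)) \<cdot> (d * c ^ Suc n)"
      using qi_add[of "- 1" "- int n"] by (simp add: cd scale_mult_left mult.assoc qi_neg_1 mult.commute)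
    finally show ?case .
  qed simp
  have "E (c ^ Suc (Suc k)) = c ^ Suc k * d + q \<cdot> (E (c ^ Suc k) * c)"
    unfolding power_Suc2[of c "Suc k"] by (simp add: E_mult E_c K_c scale_mult_right)
  also have "q \<cdot> (E (c ^ Suc k) * c) = (q * br (int k + 1)) \<cdot> (d * c ^ Suc k)"
    unfolding Suc by (simp only: scale_mult_left scale_scale mult.assoc power_Suc2)
  also have "c ^ Suc k * d = qi (- (int k + 1)) \<cdot> (d * c ^ Suc k)"
    using cd'[of "Suc k"] by (simp add: add.commute)
  finally show ?case
    using br_Suc(1)[of "int k + 1"] by (simp only: scale_left_distrib of_nat_Suc add.commute)
qed (simp add: E_c)

lemma E_ap: "E (ap i) = br i \<cdot> (b * ap (i - 1))"
proof -
  have "E (a ^ n) = br (int n) \<cdot> (b * ap (int n - 1))" for n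
  proof (induction n)
    case (Suc n)
    have "E (a ^ Suc n) = a ^ n * b + q \<cdot> (E (a ^ n) * a)"
      unfolding power_Suc2 by (simp add: E_mult E_a K_a scale_mult_right)
    also have "a ^ n * b = qi (- int n) \<cdot> (b * ap (int n))"
      using b_pow_ap[of 1 "int n"] by (simp add: ap_nat qi_mult)
    also have "E (a ^ n) * a = br (int n) \<cdot> (b * (ap (int n - 1) * a))"
      by (simp add: Suc scale_mult_left mult.assoc)
    also have "ap (int n - 1) * a = ap (int n)"
      using ap_add[of "int n - 1" 1] by (simp add: ap_1)
    finally show ?case
      using br_Suc(1)[of "int n"] by (simp add: scale_left_distrib add.commute)
  qed (simp add: E_one)
  from this[of "nat (i mod int N)"]
  have "E (ap i) = br (i mod int N) \<cdot> (b * ap (i mod int N - 1))"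
    using N_gt_1 by (simp add: ap_def)
  also have "ap (i mod int N - 1) = ap (i - 1)"
    by (rule ap_cong) (simp add: mod_simps)
  finally show ?thesis by (simp only: br_mod)
qed

text \<open>Only the first coefficient is made explicit. In the applications the second term is
  either subtracted as an element of the subalgebra or absorbed into an invertible factor.\<close>

lemma E_M_Suc: "\<exists>r. E (M i 0 (Suc k)) = br (int k + 1) \<cdot> M (i - 1) 0 k + r \<cdot> M (i - 1) 1 (Suc k)"
proof -
  have Kc: "K (c ^ Suc k) = qi (int k + 1) \<cdot> c ^ Suc k"
    using K_power[OF K_c, of "Suc k"] unfolding qi_nat[symmetric] by (simp add: add.commute)
  have "E (M i 0 (Suc k)) = ap i * E (c ^ Suc k) + E (ap i) * K (c ^ Suc k)"
    by (simp only: M_def power_0 mult_1_right E_mult)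
  also have "ap i * E (c ^ Suc k) = br (int k + 1) \<cdot> (M i 0 0 * d * M 0 0 k)"
    unfolding E_c_power by (simp add: M_def scale_mult_right mult.assoc)
  also have "\<dots> = br (int k + 1) \<cdot> M (i - 1) 0 k + (br (int k + 1) * inverse q) \<cdot> M (i - 1) 1 (Suc k)"
    by (simp add: M_simps M_mult)
  also have "E (ap i) * K (c ^ Suc k) = (br i * qi (int k + 1)) \<cdot> (b * M (i - 1) 0 (Suc k))"
    unfolding E_ap Kc
    by (simp add: M_def scale_mult_left scale_mult_right mult.assoc mult.commute)
  also have "\<dots> = (br i * qi (int k + 1) * qi (i - 1)) \<cdot> M (i - 1) 1 (Suc k)"
    by (simp add: M_simps mult.assoc)
  finally show ?thesis
    by (metis add.assoc scale_left_distrib)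
qed

lemma ap_inverse: "ap i * ap (- i) = 1" "ap (- i) * ap i = 1"
  using ap_add[of i "- i"] ap_add[of "- i" i] by simp_all

lemma d_pow_left_inverse: "d ^ n * u = 0 \<Longrightarrow> u = 0"
proof (induction n)
  case (Suc n)
  have "d ^ (N - 1) * d = 1"
    using power_minus_mult[of N d] N_gt_1 by (simp add: dN)
  moreover have "d * (d ^ n * u) = 0" using Suc.prems by (simp add: mult.assoc)
  ultimately have "d ^ n * u = 0"
    using mult.assoc[of "d ^ (N - 1)" d "d ^ n * u"] by simp
  thus ?case by (rule Suc.IH)
qed simp

text \<open>The relations alone do not show that a monomial survives; the operators do.
  \<open>F\<close> lowers the exponent of \<open>b\<close> with the nonzero coefficient
  \<open>br (j + 1)\<close>, which reduces to \<open>c ^ k\<close>. Each application of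
  \<open>E\<close> trades one \<open>c\<close> for a \<open>d\<close>, so \<open>c ^ k = 0\<close>
  would give \<open>d ^ k = 0\<close>, although \<open>d\<close> is invertible.\<close>

lemma M_nz:
  assumes "j < N" "k < N"
  shows "M i j k \<noteq> 0"
  using assms(1)
proof (induction j arbitrary: i)
  case 0
  have "c ^ k \<noteq> 0"
  proof
    assume "c ^ k = 0"
    have "d ^ n * c ^ (k - n) = 0" if "n \<le> k" for n
      using that
    proof (induction n)
      case (Suc n)
      then obtain m where m: "k - n = Suc m" "k - Suc n = m"
        by (metis Suc_diff_Suc Suc_le_lessD)
      have "0 = E (d ^ n * c ^ Suc m)"
        using Suc m by (simp add: E.zero)
      also have "\<dots> = br (int m + 1) \<cdot> (d ^ Suc n * c ^ m)"
        unfolding E_mult E_c_power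
        by (simp add: skew_zero_power[of E] E_mult E_d scale_mult_right power_commutes
            flip: mult.assoc)
      moreover have "br (int m + 1) \<noteq> 0"
        using m assms(2) by (intro br_nz) auto
      ultimately show ?case using m by simp
    qed (simp add: \<open>c ^ k = 0\<close>)
    from this[of k] d_pow_left_inverse[of k 1] show False by simp
  qed
  moreover have "ap (- i) * M i 0 k = c ^ k"
    by (simp add: M_def ap_inverse flip: mult.assoc)
  ultimately show ?case by (metis mult_zero_right)
next
  case (Suc j)
  have "br (int j + 1) \<noteq> 0"
    using Suc.prems by (intro br_nz) auto
  hence "F (M i (Suc j) k) \<noteq> 0"
    using Suc by (simp add: F_M_Suc)
  thus ?case by (metis F.zero)
qed

section \<open>Coordinates with respect to the monomials\<close>

definition comb :: "(nat \<Rightarrow> nat \<Rightarrow> nat \<Rightarrow> 'k) \<Rightarrow> 'h" where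
  "comb \<alpha> = (\<Sum>i<N. \<Sum>j<N. \<Sum>k<N. \<alpha> i j k \<cdot> M (int i) j k)"

lemma sum_single2:
  fixes f :: "nat \<Rightarrow> nat \<Rightarrow> 'h"
  assumes "j0 < N" "k0 < N" "\<And>j k. j < N \<Longrightarrow> k < N \<Longrightarrow> (j, k) \<noteq> (j0, k0) \<Longrightarrow> f j k = 0"
  shows "(\<Sum>j<N. \<Sum>k<N. f j k) = f j0 k0"
proof -
  have "(\<Sum>j<N. \<Sum>k<N. f j k) = (\<Sum>j<N. if j = j0 then f j0 k0 else 0)"
  proof (intro sum.cong refl)
    fix j assume j: "j \<in> {..<N}"
    have "(\<Sum>k<N. f j k) = (\<Sum>k<N. if k = k0 then f j k0 else 0)"
      using assms(3)[of j] j by (intro sum.cong refl) auto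
    also have "\<dots> = f j k0" using assms(2) by simp
    finally show "(\<Sum>k<N. f j k) = (if j = j0 then f j0 k0 else 0)"
      using assms j by auto
  qed
  thus ?thesis using assms(1) by simp
qed

lemma inj_on_qi: "inj_on (\<lambda>i. qi (int i + n)) {..<N}"
proof (rule inj_onI)
  fix i j assume ij: "i \<in> {..<N}" "j \<in> {..<N}" "qi (int i + n) = qi (int j + n)"
  hence "int N dvd int i - int j" by (simp add: qi_eq_iff)
  with ij(1,2) show "i = j"
    using dvd_imp_le_int[of "int i - int j" "int N"] by fastforce
qed

text \<open>
  Multiplying by \<open>b\<^sup>N\<^sup>-\<^sup>1\<^sup>-\<^sup>j c\<^sup>N\<^sup>-\<^sup>1\<^sup>-\<^sup>k\<close> kills all terms except those of bidegree \<open>(j, k)\<close>, provided that the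
  coefficients of smaller total degree vanish; the remaining terms are separated by \<open>K\<close>.
\<close>
lemma comb_eq_0:
  assumes "comb \<alpha> = 0" "i < N" "j < N" "k < N"
  shows "\<alpha> i j k = 0"
  using assms(2-)
proof (induction "j + k" arbitrary: i j k rule: less_induct)
  case less
  have "(\<Sum>i<N. \<alpha> i j k \<cdot> M (int i) (N - 1) (N - 1)) = comb \<alpha> * M 0 (N - 1 - j) (N - 1 - k)"
  proof -
    have "\<alpha> i' j k \<cdot> M (int i') (N - 1) (N - 1) =
        (\<Sum>j'<N. \<Sum>k'<N. \<alpha> i' j' k' \<cdot> M (int i') (j' + (N - 1 - j)) (k' + (N - 1 - k)))"
      if i': "i' < N" for i'
    proof (subst sum_single2[of j k])
      fix j' k' assume jk': "j' < N" "k' < N" "(j', k') \<noteq> (j, k)"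
      show "\<alpha> i' j' k' \<cdot> M (int i') (j' + (N - 1 - j)) (k' + (N - 1 - k)) = 0"
      proof (cases "j' + k' < j + k")
        case True
        thus ?thesis using less.hyps jk' i' by simp
      next
        case False
        hence "j' > j \<or> k' > k" using jk' by auto
        thus ?thesis by (subst M_eq_0) auto
      qed
    qed (use less.prems in auto)
    thus ?thesis
      by (simp add: comb_def sum_distrib_right scale_mult_left M_mult)
  qed
  hence "(\<Sum>i<N. \<alpha> i j k \<cdot> M (int i) (N - 1) (N - 1)) \<in> {0}"
    by (simp add: assms(1))
  hence "\<alpha> i j k \<cdot> M (int i) (N - 1) (N - 1) \<in> {0}"
    by (rule eigen_components[where T = K and ev = "\<lambda>i. qi (int i + 0)" and W = "{..<N}", rotated 7])
      (use inj_on_qi[of 0] less.prems in \<open>auto simp: K_add K_scale K.zero K_M mult.commute\<close>)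
  moreover have "M (int i) (N - 1) (N - 1) \<noteq> 0"
    using N_gt_1 by (intro M_nz) auto
  ultimately show ?case by simp
qed

lemma comb_add: "comb \<alpha> + comb \<beta> = comb (\<lambda>i j k. \<alpha> i j k + \<beta> i j k)"
  by (simp add: comb_def scale_left_distrib sum.distrib)

lemma comb_scale: "r \<cdot> comb \<alpha> = comb (\<lambda>i j k. r * \<alpha> i j k)"
  by (simp add: comb_def scale_sum_right)

lemma M_comb:
  "M i j k = comb (\<lambda>i' j' k'. if int i' = i mod int N \<and> j' = j \<and> k' = k then 1 else 0)"
proof (cases "j < N \<and> k < N")
  case True
  define i0 where "i0 = nat (i mod int N)"
  have i0: "i0 < N" "int i0 = i mod int N"
    using N_gt_1 by (auto simp: i0_def nat_less_iff)
  hence M0: "M (int i0) j k = M i j k" by simp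
  have "comb (\<lambda>i' j' k'. if int i' = i mod int N \<and> j' = j \<and> k' = k then 1 else 0) =
      (\<Sum>i'<N. if i' = i0 then M i j k else 0)"
    unfolding comb_def
  proof (intro sum.cong refl)
    fix i'
    show "(\<Sum>j'<N. \<Sum>k'<N. (if int i' = i mod int N \<and> j' = j \<and> k' = k then 1 else 0) \<cdot> M (int i') j' k')
        = (if i' = i0 then M i j k else 0)"
      using True M0 by (subst sum_single2[of j k]) (auto simp: i0(2)[symmetric])
  qed
  thus ?thesis using i0 by simp
next
  case False
  thus ?thesis
    unfolding comb_def by (subst M_eq_0) (auto intro!: sum.neutral[symmetric])
qed

lemma span_range_M: "span {M i j k | i j k. True} = UNIV" (is "span ?B = _")
proof (rule gen)
  have M: "M i j k \<in> span ?B" for i j k by (rule span_base) blast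
  have "1 \<in> span ?B"
    by (rule span_base) (use M_000 in \<open>metis (mono_tags, lifting) mem_Collect_eq\<close>)
  moreover have "x * y \<in> span ?B" if "x \<in> span ?B" "y \<in> span ?B" for x y
    using that
  proof (rule span_mult)
    fix x y assume "x \<in> ?B" "y \<in> ?B"
    thus "x * y \<in> span ?B" using M by (auto simp: M_mult intro!: span_scale)
  qed
  ultimately show "subalgebra (span ?B)"
    by (auto simp: subalgebra_def)
  show "{a, b, c, d} \<subseteq> span ?B"
    using M[of 1 0 0, folded a_M] M[of 0 1 0, folded b_M] M[of 0 0 1, folded c_M] M
    by (simp add: d_M span_add span_scale)
qed

lemma ex_comb: "\<exists>\<alpha>. u = comb \<alpha>"
proof -
  have "u \<in> span {M i j k | i j k. True}" by (simp only: span_range_M UNIV_I)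
  thus ?thesis
  proof (induction rule: span_induct_alt)
    case base
    show ?case by (rule exI[of _ "\<lambda>_ _ _. 0"]) (simp add: comb_def)
  next
    case (step r m u)
    then obtain \<alpha> \<beta> where "m = comb \<alpha>" "u = comb \<beta>" using M_comb by blast
    thus ?case by (simp add: comb_scale comb_add) blast
  qed
qed

text \<open>The coordinates are meaningful only for \<open>i, j, k < N\<close>.\<close>
definition cf :: "'h \<Rightarrow> nat \<Rightarrow> nat \<Rightarrow> nat \<Rightarrow> 'k" where
  "cf u = (SOME \<alpha>. u = comb \<alpha>)"

lemma comb_cf: "comb (cf u) = u"
  unfolding cf_def by (rule someI_ex[OF ex_comb, symmetric])

lemma cf_comb:
  assumes "i < N" "j < N" "k < N"
  shows "cf (comb \<alpha>) i j k = \<alpha> i j k"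
proof -
  have "comb (\<lambda>i j k. cf (comb \<alpha>) i j k + (- 1) * \<alpha> i j k) = 0"
    unfolding comb_add[symmetric] comb_scale[symmetric] comb_cf by simp
  from comb_eq_0[OF this assms] show ?thesis by simp
qed

lemma cf_add: "i < N \<Longrightarrow> j < N \<Longrightarrow> k < N \<Longrightarrow> cf (u + v) i j k = cf u i j k + cf v i j k"
  using cf_comb[of i j k "\<lambda>i j k. cf u i j k + cf v i j k"]
  by (simp add: comb_add[symmetric] comb_cf)

lemma cf_scale: "i < N \<Longrightarrow> j < N \<Longrightarrow> k < N \<Longrightarrow> cf (r \<cdot> u) i j k = r * cf u i j k"
  using cf_comb[of i j k "\<lambda>i j k. r * cf u i j k"]
  by (simp add: comb_scale[symmetric] comb_cf)

lemma cf_0: "i < N \<Longrightarrow> j < N \<Longrightarrow> k < N \<Longrightarrow> cf 0 i j k = 0"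
  using cf_scale[of i j k 0 0] by simp

lemma cf_sum: "i < N \<Longrightarrow> j < N \<Longrightarrow> k < N \<Longrightarrow> cf (\<Sum>x\<in>X. f x) i j k = (\<Sum>x\<in>X. cf (f x) i j k)"
  by (induction X rule: infinite_finite_induct) (auto simp: cf_0 cf_add)

lemma cf_M:
  assumes "i < N" "j < N" "k < N"
  shows "cf (M i' j' k') i j k = (if int i = i' mod int N \<and> j = j' \<and> k = k' then 1 else 0)"
  unfolding M_comb cf_comb[OF assms] ..

lemma cf_span:
  assumes "u \<in> span {M i j k | i j k. P i j k}" "cf u i j k \<noteq> 0" "i < N" "j < N" "k < N"
  obtains i' where "P i' j k" "int i = i' mod int N"
proof -
  from assms(1) have "cf u i j k = 0 \<or> (\<exists>i'. P i' j k \<and> int i = i' mod int N)"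
  proof (induction rule: span_induct_alt)
    case base
    show ?case using assms by (simp add: cf_0)
  next
    case (step r m u)
    thus ?case using assms(3-) by (auto simp: cf_add cf_scale cf_M)
  qed
  thus thesis using assms(2) that by blast
qed

subsection \<open>Vectors killed by \<open>F\<close>\<close>

lemma stableD:
  assumes "stable A"
  shows stable_subalgebra: "subalgebra A" and "u \<in> A \<Longrightarrow> K u \<in> A" and stable_E: "u \<in> A \<Longrightarrow> E u \<in> A"
    and stable_F: "u \<in> A \<Longrightarrow> F u \<in> A" and "u \<in> A \<Longrightarrow> ad_a u \<in> A"
    and "u \<in> A \<Longrightarrow> ad_b u \<in> A" and "u \<in> A \<Longrightarrow> ad_c u \<in> A" and "u \<in> A \<Longrightarrow> ad_d u \<in> A"
  using assms by (auto simp: stable_def)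

lemma ad_linear:
  "ad_a (u + v) = ad_a u + ad_a v" "ad_a (r \<cdot> u) = r \<cdot> ad_a u"
  "ad_c (u + v) = ad_c u + ad_c v" "ad_c (r \<cdot> u) = r \<cdot> ad_c u"
  by (simp_all add: ad_a_def ad_c_def distrib_left distrib_right scale_mult_left scale_mult_right
      scale_right_distrib scale_right_diff_distrib mult.commute)

sublocale ad_a: additive ad_a by unfold_locales (rule ad_linear)
sublocale ad_c: additive ad_c by unfold_locales (rule ad_linear)

text \<open>For \<open>i = - k\<close> the second coefficient vanishes, so \<open>a^-k c^k\<close>
  is an eigenvector of \<open>ad_a\<close> with eigenvalue \<open>q^k\<close>. For
  \<open>k = N - 1\<close> the second monomial itself vanishes.\<close>

lemma ad_a_M: "ad_a (M i 0 k) =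
    qi (int k) \<cdot> M i 0 k + (qi (int k + 1 + 2 * i) - qi (1 + i)) \<cdot> M i 1 (Suc k)"
proof -
  have "qi (2 * i - 1) * qi (1 + int k + 1) = qi (int k + 1 + 2 * i)"
    by (simp add: qi_mult algebra_simps)
  moreover have "q * qi i = qi (1 + i)" by (simp add: qi_add qi_1)
  ultimately show ?thesis
    by (simp add: ad_a_def M_simps scale_left_diff_distrib algebra_simps)
qed

text \<open>The factor depends only on the \<open>K\<close>-weight \<open>i + k\<close>, so
  \<open>ad_c\<close> acts on a whole weight vector as one scalar times a shift.\<close>

lemma ad_c_M: "ad_c (M i 0 k) = (1 - qi (i + int k)) \<cdot> M (i + 1) 0 (Suc k)"
proof -
  have "inverse q * (qi i * qi (1 + int k)) = qi (i + int k)"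
    by (simp add: qi_add qi_1 q_nz)
  thus ?thesis
    by (simp add: ad_c_def M_simps scale_left_diff_distrib algebra_simps)
qed

text \<open>The exponent \<open>w - k\<close> gives all terms the same \<open>K\<close>-weight
  \<open>w\<close>. By \<open>ker_F_decomp\<close>, sums of such vectors over \<open>w < N\<close>
  exhaust the kernel of \<open>F\<close>.\<close>

definition lo :: "int \<Rightarrow> (nat \<Rightarrow> 'k) \<Rightarrow> 'h" where
  "lo w \<gamma> = (\<Sum>k<N. \<gamma> k \<cdot> M (w - int k) 0 k)"

lemma F_lo: "F (lo w \<gamma>) = 0"
  by (simp add: lo_def F.sum F_scale F_M_0)

lemma K_lo: "K (lo w \<gamma>) = qi w \<cdot> lo w \<gamma>"
  by (simp add: lo_def K.sum K_scale K_M scale_sum_right mult.commute)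

lemma sum_N_first: "(\<Sum>j<N. f j) = f 0 + (\<Sum>j<N - 1. f (Suc j))"
  and sum_N_last: "(\<Sum>j<N. f j) = (\<Sum>j<N - 1. f j) + f (N - 1)"
  for f :: "nat \<Rightarrow> 'h"
proof -
  obtain n where n: "N = Suc n" using N_gt_1 by (cases N) auto
  show "(\<Sum>j<N. f j) = f 0 + (\<Sum>j<N - 1. f (Suc j))"
    "(\<Sum>j<N. f j) = (\<Sum>j<N - 1. f j) + f (N - 1)"
    unfolding n diff_Suc_1 by (rule sum.lessThan_Suc_shift, rule sum.lessThan_Suc)
qed

lemma ad_c_lo: "ad_c (lo w \<gamma>) = (1 - qi w) \<cdot> lo (w + 2) (\<lambda>k. if k = 0 then 0 else \<gamma> (k - 1))"
proof -
  have "ad_c (lo w \<gamma>) = (1 - qi w) \<cdot> (\<Sum>k<N. \<gamma> k \<cdot> M (w - int k + 1) 0 (Suc k))"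
    by (simp add: lo_def ad_c.sum ad_linear ad_c_M scale_sum_right mult.commute)
  also have "(\<Sum>k<N. \<gamma> k \<cdot> M (w - int k + 1) 0 (Suc k)) =
      lo (w + 2) (\<lambda>k. if k = 0 then 0 else \<gamma> (k - 1))"
  proof -
    \<comment> \<open>The shift drops the top coefficient \<open>\<gamma> (N - 1)\<close>, because
      it lands on \<open>c ^ N = 0\<close>.\<close>
    have "M (w - int (N - 1) + 1) 0 (Suc (N - 1)) = 0"
      by (rule M_eq_0) arith
    thus ?thesis
      unfolding lo_def sum_N_first[of "\<lambda>k. (if k = 0 then 0 else _ k) \<cdot> _ k"]
        sum_N_last[of "\<lambda>k. _ k \<cdot> M (_ k) 0 (Suc k)"]
      by (simp add: algebra_simps)
  qed
  finally show ?thesis .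
qed

lemma cf_lo:
  assumes "k < N"
  shows "cf (lo w \<gamma>) (nat ((w - int k) mod int N)) 0 k = \<gamma> k"
proof -
  let ?i = "nat ((w - int k) mod int N)"
  have i: "?i < N" "int ?i = (w - int k) mod int N"
    using N_gt_1 by (auto simp: nat_less_iff)
  have "cf (lo w \<gamma>) ?i 0 k = (\<Sum>k'<N. if k' = k then \<gamma> k else 0)"
    unfolding lo_def
  proof (subst cf_sum, goal_cases)
    case 4
    show ?case using i assms N_gt_1 by (intro sum.cong refl) (auto simp: cf_scale cf_M)
  qed (use i assms N_gt_1 in auto)
  also have "\<dots> = \<gamma> k" using assms by simp
  finally show ?thesis .
qed

lemma lo_scalar:
  assumes "lo w \<gamma> \<in> scalars" "0 < k" "k < N"
  shows "\<gamma> k = 0"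
proof -
  let ?i = "nat ((w - int k) mod int N)"
  have i: "?i < N" using N_gt_1 by (auto simp: nat_less_iff)
  obtain r where r: "lo w \<gamma> = r \<cdot> M 0 0 0"
    using assms(1) by (auto simp: scalars_def)
  have "\<gamma> k = cf (r \<cdot> M 0 0 0) ?i 0 k"
    using cf_lo[OF assms(3), of w \<gamma>] by (simp only: r)
  also have "\<dots> = 0"
    using i assms N_gt_1 by (simp add: cf_scale cf_M del: M_000)
  finally show ?thesis .
qed

text \<open>\<open>F\<close> raises the exponent of \<open>a\<close> by one. The factor
  \<open>ap (- 1)\<close> undoes this, so that coefficients can be compared without reindexing
  modulo \<open>N\<close>.\<close>

lemma ap_F_comb:
  "ap (- 1) * F (comb \<alpha>) =
     comb (\<lambda>i j k. if Suc j < N then \<alpha> i (Suc j) k * (qi (int k) * br (int j + 1)) else 0)"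
proof -
  have F_Suc: "ap (- 1) * F (M i (Suc j) k) = (qi (int k) * br (int j + 1)) \<cdot> M i j k" for i j k
    by (simp add: F_M_Suc ap_M M_mult scale_mult_right)
  have "ap (- 1) * F (comb \<alpha>) =
      (\<Sum>i<N. \<Sum>j<N. \<Sum>k<N. \<alpha> i j k \<cdot> (ap (- 1) * F (M (int i) j k)))"
    by (simp add: comb_def F.sum F_scale sum_distrib_left scale_mult_right)
  also have "\<dots> = (\<Sum>i<N. \<Sum>j<N - 1. \<Sum>k<N. \<alpha> i (Suc j) k \<cdot> (ap (- 1) * F (M (int i) (Suc j) k)))"
    by (subst sum_N_first) (simp add: F_M_0)
  also have "\<dots> = comb (\<lambda>i j k. if Suc j < N then \<alpha> i (Suc j) k * (qi (int k) * br (int j + 1)) else 0)"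
  proof -
    have "(\<Sum>j<N - 1. \<Sum>k<N. \<alpha> i (Suc j) k \<cdot> (ap (- 1) * F (M (int i) (Suc j) k))) =
      (\<Sum>j<N. \<Sum>k<N. (if Suc j < N then \<alpha> i (Suc j) k * (qi (int k) * br (int j + 1)) else 0) \<cdot> M (int i) j k)"
      for i
      unfolding F_Suc
      by (subst sum_N_last[of "\<lambda>j. \<Sum>k<N. _ j k"])
        (use N_gt_1 in \<open>auto simp: intro!: sum.cong\<close>)
    thus ?thesis by (simp add: comb_def)
  qed
  finally show ?thesis .
qed

lemma cf_F_top:
  assumes "i < N" "k < N"
  shows "cf (F u) i (N - 1) k = 0"
proof -
  let ?\<beta> = "\<lambda>i j k. if Suc j < N then cf u i (Suc j) k * (qi (int k) * br (int j + 1)) else 0"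
  have "F u = ap 1 * (ap (- 1) * F (comb (cf u)))"
    by (simp add: comb_cf ap_inverse flip: mult.assoc)
  also have "\<dots> = (\<Sum>i<N. \<Sum>j<N. \<Sum>k<N. ?\<beta> i j k \<cdot> M (int i + 1) j k)"
    unfolding ap_F_comb by (simp add: comb_def sum_distrib_left scale_mult_right ap_1 a_mult_M)
  finally show ?thesis
    using assms N_gt_1 by (auto simp: cf_sum cf_scale cf_M intro!: sum.neutral)
qed

lemma cf_ker_F:
  assumes "F u = 0" "i < N" "0 < j" "j < N" "k < N"
  shows "cf u i j k = 0"
proof -
  obtain j' where j': "j = Suc j'" using assms(3) by (cases j) auto
  have "comb (\<lambda>i j k. if Suc j < N then cf u i (Suc j) k * (qi (int k) * br (int j + 1)) else 0) = 0"
    using ap_F_comb[of "cf u"] by (simp add: comb_cf assms(1))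
  from comb_eq_0[OF this, of i j' k] show ?thesis
    using assms br_nz[of "int j' + 1"] by (auto simp: j')
qed

lemma ker_F_decomp:
  assumes Fu: "F u = 0"
  shows "u = (\<Sum>w<N. lo (int w) (\<lambda>k. cf u (nat ((int w - int k) mod int N)) 0 k))"
proof -
  have "u = comb (cf u)" by (simp add: comb_cf)
  also have "\<dots> = (\<Sum>i<N. \<Sum>k<N. cf u i 0 k \<cdot> M (int i) 0 k)"
    unfolding comb_def
  proof (rule sum.cong[OF refl])
    fix i assume i: "i \<in> {..<N}"
    have "(\<Sum>k<N. cf u i (Suc j) k \<cdot> M (int i) (Suc j) k) = 0" if "j < N - 1" for j
      using that i by (intro sum.neutral ballI) (simp add: cf_ker_F[OF Fu])
    thus "(\<Sum>j<N. \<Sum>k<N. cf u i j k \<cdot> M (int i) j k) = (\<Sum>k<N. cf u i 0 k \<cdot> M (int i) 0 k)"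
      by (subst sum_N_first) simp
  qed
  also have "\<dots> = (\<Sum>k<N. \<Sum>i<N. cf u i 0 k \<cdot> M (int i) 0 k)"
    by (rule sum.swap)
  \<comment> \<open>Terms are regrouped by the \<open>K\<close>-weight \<open>w = i + k\<close>: for
    fixed \<open>k\<close>, the substitution \<open>i = w - k\<close> permutes the residues modulo
    \<open>N\<close>.\<close>
  also have "\<dots> = (\<Sum>k<N. \<Sum>w<N. cf u (nat ((int w - int k) mod int N)) 0 k \<cdot> M (int w - int k) 0 k)"
  proof (rule sum.cong[OF refl])
    fix k
    show "(\<Sum>i<N. cf u i 0 k \<cdot> M (int i) 0 k) =
        (\<Sum>w<N. cf u (nat ((int w - int k) mod int N)) 0 k \<cdot> M (int w - int k) 0 k)"
      using N_gt_1
      by (subst sum_shift_mod[where k = "- int k"]) (auto intro!: sum.cong)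
  qed
  also have "\<dots> = (\<Sum>w<N. lo (int w) (\<lambda>k. cf u (nat ((int w - int k) mod int N)) 0 k))"
    unfolding lo_def by (rule sum.swap)
  finally show ?thesis .
qed

lemma lo_components:
  assumes "stable A" "(\<Sum>w<N. lo (int w) (\<gamma> w)) \<in> A" "w < N"
  shows "lo (int w) (\<gamma> w) \<in> A"
  by (rule eigen_components[where T = K and ev = "\<lambda>w. qi (int w + 0)" and W = "{..<N}", rotated 7])
    (use assms inj_on_qi[of 0] in \<open>auto simp: K_add K_scale K_lo stableD subalgebra_subspace\<close>)

subsection \<open>Units\<close>

text \<open>The ideal generated by \<open>b ^ n\<close>. The ideal \<open>J 1\<close> is nilpotent
  because \<open>J N = {0}\<close>, and it serves as the radical for inverting elements.\<close>

definition J :: "nat \<Rightarrow> 'h set" where "J n = span {M i j k | i j k. n \<le> j}"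

lemma J_mult: "u \<in> J m \<Longrightarrow> v \<in> J n \<Longrightarrow> u * v \<in> J (m + n)"
  unfolding J_def
proof (erule (1) span_mult)
  fix x y assume "x \<in> {M i j k | i j k. m \<le> j}" "y \<in> {M i j k | i j k. n \<le> j}"
  then obtain i j k i' j' k' where "x = M i j k" "m \<le> j" "y = M i' j' k'" "n \<le> j'" by blast
  moreover from this have "M (i + i') (j + j') (k + k') \<in> span {M i j k | i j k. m + n \<le> j}"
    by (intro span_base) (auto intro: add_mono)
  ultimately show "x * y \<in> span {M i j k | i j k. m + n \<le> j}"
    by (simp add: M_mult span_scale)
qed

lemma J_0: "J 0 = UNIV" using span_range_M by (simp add: J_def)

lemma J_N: "J N = {0}"
proof -
  have "J N \<subseteq> {0}" unfolding J_def by (rule span_minimal) (auto simp: M_eq_0)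
  moreover have "0 \<in> J N" unfolding J_def by (rule span_zero)
  ultimately show ?thesis by auto
qed

lemma subspace_J: "subspace (J n)" by (simp add: J_def)

lemma M_in_J: "n \<le> j \<Longrightarrow> M i j k \<in> J n"
  unfolding J_def by (rule span_base) blast

lemma J_ideal: "u \<in> J n \<Longrightarrow> u * v \<in> J n" "u \<in> J n \<Longrightarrow> v * u \<in> J n"
  using J_mult[of u n v 0] J_mult[of v 0 u n] by (simp_all add: J_0)

lemma J_power: "u \<in> J 1 \<Longrightarrow> u ^ n \<in> J n"
  by (induction n) (use J_mult[of u 1] in \<open>simp_all add: J_0\<close>)

text \<open>The geometric series in the nilpotent element \<open>1 - u / r\<close> is finite, so the
  inverse is a polynomial in \<open>u\<close>. This keeps it in \<open>A\<close> and makes it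
  commute with everything that commutes with \<open>u\<close>; the latter is what turns the inverse
  of a power of \<open>u\<close> into a two-sided inverse of \<open>u\<close>.\<close>

lemma subalgebra_unipotent_inverse:
  assumes A: "subalgebra A" and u: "u \<in> A" "u - r \<cdot> 1 \<in> J 1" "r \<noteq> 0"
  shows "\<exists>v\<in>A. u * v = 1 \<and> v * u = 1 \<and> (\<forall>w. w * u = u * w \<longrightarrow> w * v = v * w)"
proof -
  define n where "n = 1 - inverse r \<cdot> u"
  have "n = (- inverse r) \<cdot> (u - r \<cdot> 1)"
    using u(3) by (simp add: n_def scale_right_diff_distrib)
  hence "n \<in> J 1" using u(2) subspace_J by (simp only: subspace_scale)
  hence "n ^ N \<in> {0}" unfolding J_N[symmetric] by (rule J_power)
  hence nN: "n ^ N = 0" by simp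
  define s where "s = (\<Sum>i<N. n ^ i)"
  have "n \<in> A"
    unfolding n_def using A u by (intro subalgebra_diff subalgebra_scale subalgebra_one)
  hence "s \<in> A"
    unfolding s_def using A by (intro subspace_sum subalgebra_subspace subalgebra_power)
  have 1: "(1 - n) * s = 1"
  proof -
    have "(1 - n) * (\<Sum>i<m. n ^ i) = 1 - n ^ m" for m
      by (induction m) (simp_all add: distrib_left left_diff_distrib)
    thus ?thesis by (simp add: s_def nN)
  qed
  have com: "w * s = s * w" if "w * u = u * w" for w
  proof -
    have "w * n = n * w"
      using that by (simp add: n_def algebra_simps scale_mult_left scale_mult_right)
    hence "w * n ^ i = n ^ i * w" for i by (metis power_commuting_commutes)
    thus ?thesis by (simp add: s_def sum_distrib_left sum_distrib_right)
  qed
  have un: "u = r \<cdot> (1 - n)" using u(3) by (simp add: n_def)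
  have 2: "s * (1 - n) = 1"
    using 1 com[of u] u(3) by (simp add: un scale_mult_left scale_mult_right)
  show ?thesis
  proof (intro bexI[of _ "inverse r \<cdot> s"] conjI allI impI)
    show "u * (inverse r \<cdot> s) = 1" "inverse r \<cdot> s * u = 1"
      using 1 2 u(3) by (simp_all add: un scale_mult_left scale_mult_right)
    show "inverse r \<cdot> s \<in> A" using A \<open>s \<in> A\<close> by (rule subalgebra_scale)
    show "w * (inverse r \<cdot> s) = inverse r \<cdot> s * w" if "w * u = u * w" for w
      using com[OF that] by (simp add: scale_mult_left scale_mult_right)
  qed
qed

lemma mod_J_mult:
  assumes "u - r \<cdot> ap i \<in> J 1" "v - s \<cdot> ap j \<in> J 1"
  shows "u * v - (r * s) \<cdot> ap (i + j) \<in> J 1"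
proof -
  have "u * v - (r * s) \<cdot> ap (i + j) = (u - r \<cdot> ap i) * v + r \<cdot> (ap i * (v - s \<cdot> ap j))"
    by (simp add: ap_add algebra_simps scale_mult_left scale_mult_right scale_right_diff_distrib)
  thus ?thesis using assms subspace_J
    by (simp add: J_ideal subspace_add subspace_scale)
qed

lemma mod_J_power:
  assumes "u - r \<cdot> ap i \<in> J 1"
  shows "u ^ n - r ^ n \<cdot> ap (int n * i) \<in> J 1"
proof (induction n)
  case 0
  show ?case using subspace_J by (simp add: subspace_0)
next
  case (Suc n)
  show ?case using mod_J_mult[OF assms Suc] by (simp add: algebra_simps)
qed

text \<open>A subalgebra need not contain \<open>ap (- i)\<close>. However, \<open>u ^ N\<close> is
  congruent to \<open>r ^ N\<close> because \<open>a ^ N = 1\<close>, so it has an inverse in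
  \<open>A\<close>, and multiplying that by \<open>u ^ (N - 1)\<close> inverts
  \<open>u\<close>.\<close>

lemma subalgebra_inverse:
  assumes A: "subalgebra A" and u: "u \<in> A" "u - r \<cdot> ap i \<in> J 1" "r \<noteq> 0"
  shows "\<exists>v\<in>A. u * v = 1 \<and> v * u = 1"
proof -
  have "u ^ N - r ^ N \<cdot> ap (int N * i) \<in> J 1" by (rule mod_J_power[OF u(2)])
  moreover have "ap (int N * i) = 1" using ap_cong[of "int N * i" 0] by simp
  ultimately obtain v where v: "v \<in> A" "u ^ N * v = 1" "v * u ^ N = 1"
      "\<forall>w. w * u ^ N = u ^ N * w \<longrightarrow> w * v = v * w"
    using subalgebra_unipotent_inverse[of A "u ^ N" "r ^ N"] A u by (auto simp: subalgebra_power)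
  obtain n where n: "N = Suc n" using N_gt_1 by (cases N) auto
  show ?thesis
  proof (intro bexI[of _ "u ^ n * v"] conjI)
    show "u * (u ^ n * v) = 1" using v(2) by (simp add: n mult.assoc)
    have "u ^ n * v = v * u ^ n" using v(4) by (metis power_commutes power_commuting_commutes)
    thus "u ^ n * v * u = 1" using v(3) by (simp add: n mult.assoc power_commutes)
    show "u ^ n * v \<in> A" using A u v by (intro subalgebra_mult subalgebra_power)
  qed
qed

subsection \<open>Descent by \<open>E\<close> and the adjoint action of \<open>b\<close>\<close>

definition dp :: "int \<Rightarrow> 'h" where "dp i = d ^ nat (i mod int N)"

lemma mirror_ap: "restricted_SL2.ap N d = dp"
proof -
  interpret m: restricted_SL2 scale "inverse q" N d c b a K F E by (rule mirror)
  show ?thesis by (rule ext) (simp add: m.ap_def dp_def)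
qed

lemma mirror_qi: "restricted_SL2.qi (inverse q) n = qi (- n)"
proof -
  interpret m: restricted_SL2 scale "inverse q" N d c b a K F E by (rule mirror)
  show ?thesis by (simp add: m.qi_def qi_def power_int_inverse power_int_minus)
qed

lemma dp_add: "dp (i + j) = dp i * dp j"
  and dp_0 [simp]: "dp 0 = 1" and dp_1: "dp 1 = d"
  and dp_cong: "i mod int N = j mod int N \<Longrightarrow> dp i = dp j"
  and dp_nat: "dp (int m) = d ^ m"
  and b_dp: "b * dp n = qi (- n) \<cdot> (dp n * b)"
  and c_pow_dp: "c ^ k * dp n = qi (- (int k * n)) \<cdot> (dp n * c ^ k)"
  and K_dp: "K (dp n) = qi (- n) \<cdot> dp n"
proof -
  interpret m: restricted_SL2 scale "inverse q" N d c b a K F E by (rule mirror)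
  show "dp (i + j) = dp i * dp j" "dp 0 = 1" "dp 1 = d" "dp (int m) = d ^ m"
    using m.ap_add m.ap_0 m.ap_1 m.ap_nat by (simp_all only: mirror_ap)
  show "i mod int N = j mod int N \<Longrightarrow> dp i = dp j"
    by (rule m.ap_cong[unfolded mirror_ap])
  show "b * dp n = qi (- n) \<cdot> (dp n * b)" "c ^ k * dp n = qi (- (int k * n)) \<cdot> (dp n * c ^ k)"
    using m.c_pow_ap[of 1 n] m.b_pow_ap[of k n] by (simp_all add: mirror_ap mirror_qi)
  show "K (dp n) = qi (- n) \<cdot> dp n"
    using m.K_M[of n 0 0] by (simp add: m.M_def mirror_ap mirror_qi)
qed

lemma dp_inverse: "dp i * dp (- i) = 1" "dp (- i) * dp i = 1"
  using dp_add[of i "- i"] dp_add[of "- i" i] by simp_all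

lemma d_dp: "d * dp n = dp n * d" "dp n * d = dp (n + 1)"
  using dp_add[of 1 n] dp_add[of n 1] by (simp_all add: dp_1 add.commute)

lemma E_dp: "E (dp n) = 0"
  unfolding dp_def by (rule skew_zero_power) (simp_all add: E_mult E_d)

lemma dp_mod_J: "dp n - 1 \<cdot> ap (- n) \<in> J 1"
proof -
  have "d - 1 \<cdot> ap (- 1) = inverse q \<cdot> M (- 1) 1 1"
    by (simp add: d_M ap_M)
  also have "\<dots> \<in> J 1" by (simp add: subspace_scale[OF subspace_J] M_in_J)
  finally have "d ^ nat (n mod int N) - 1 ^ nat (n mod int N) \<cdot> ap (int (nat (n mod int N)) * - 1) \<in> J 1"
    by (rule mod_J_power)
  moreover have "ap (int (nat (n mod int N)) * - 1) = ap (- n)"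
    using N_gt_1 by (intro ap_cong) (simp add: mod_simps)
  ultimately show ?thesis by (simp add: dp_def)
qed

text \<open>
  If \<open>N\<close> divides \<open>n + k\<close>, then \<open>P n k\<close> is a multiple of \<open>y\<^sup>k\<close>. Otherwise \<open>E\<close> and \<open>ad_b\<close> trade a factor \<open>c\<close>
  for a factor \<open>d\<close>, until an invertible element remains.
\<close>
definition P :: "int \<Rightarrow> nat \<Rightarrow> 'h" where "P n k = dp n * M (- n - int k) 0 k"

lemma ad_b_P: "ad_b (P n k) = (1 - qi (- 2 * (n + int k))) \<cdot> (dp n * M (- n - int k - 1) 1 k)"
proof -
  define m e where "m = - n - int k" and "e = - 2 * (n + int k)"
  have 1: "d * P n k * b = dp n * (d * M m 0 k * b)"
    by (simp add: P_def m_def mult.assoc d_dp(1)[symmetric])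
      (simp add: d_dp(1) flip: mult.assoc)
  have 2: "b * P n k * d = qi (- n) \<cdot> (dp n * (b * M m 0 k * d))"
    by (simp add: P_def m_def b_dp scale_mult_left flip: mult.assoc)
  have 3: "d * M m 0 k * b = M (m - 1) 1 k + qi (2 * m - 1) \<cdot> M (m - 1) 2 (Suc k)"
    by (simp add: M_simps numeral_2_eq_2)
  have 4: "b * M m 0 k * d = qi (m - 1 - int k) \<cdot> (M (m - 1) 1 k + inverse q \<cdot> M (m - 1) 2 (Suc k))"
    by (simp add: M_simps qi_mult numeral_2_eq_2 algebra_simps)
  have "qi 1 * (qi (- n) * qi (m - 1 - int k)) = qi (e)"
    unfolding qi_mult by (rule arg_cong[of _ _ qi]) (simp add: m_def e_def)
  hence 5: "q * (qi (- n) * qi (m - 1 - int k)) = qi (e)"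
    by (simp only: qi_1)
  have "qi (e) * qi (- 1) = qi (2 * m - 1)"
    unfolding qi_mult by (rule arg_cong[of _ _ qi]) (simp add: m_def e_def)
  hence 6: "qi (e) * inverse q = qi (2 * m - 1)"
    by (simp only: qi_neg_1)
  have "q \<cdot> (b * P n k * d) = (q * (qi (- n) * qi (m - 1 - int k))) \<cdot>
      (dp n * (M (m - 1) 1 k + inverse q \<cdot> M (m - 1) 2 (Suc k)))"
    unfolding 2 4 by (simp add: scale_mult_right)
  hence "q \<cdot> (b * P n k * d) =
      dp n * (qi (e) \<cdot> M (m - 1) 1 k + qi (2 * m - 1) \<cdot> M (m - 1) 2 (Suc k))"
    unfolding 5 by (simp only: scale_mult_right scale_right_distrib distrib_left scale_scale 6)
  thus ?thesis
    unfolding ad_b_def 1 3 m_def[symmetric] e_def[symmetric]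
    by (simp add: distrib_left scale_mult_right scale_left_diff_distrib)
qed

lemma E_P_Suc: "\<exists>r. E (P n (Suc k)) =
    br (int k + 1) \<cdot> (dp n * M (- n - int k - 2) 0 k) + r \<cdot> (dp n * M (- n - int k - 2) 1 (Suc k))"
proof -
  obtain r where r: "E (M (- n - int (Suc k)) 0 (Suc k)) = br (int k + 1) \<cdot> M (- n - int (Suc k) - 1) 0 k
      + r \<cdot> M (- n - int (Suc k) - 1) 1 (Suc k)"
    using E_M_Suc[of "- n - int (Suc k)" k] by blast
  have "E (P n (Suc k)) = dp n * E (M (- n - int (Suc k)) 0 (Suc k))"
    by (simp only: P_def E_mult E_dp) simp
  moreover have "- n - int (Suc k) - 1 = - n - int k - 2" by simp
  ultimately show ?thesis
    unfolding r by (auto simp only: distrib_left scale_mult_right)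
qed

lemma P_shift: "P (n + 1) k =
    dp n * M (- n - int k - 2) 0 k + qi (- 2 * n - 2 * int k - 3) \<cdot> (dp n * M (- n - int k - 2) 1 (Suc k))"
proof -
  have "- (n + 1) - int k = - n - int k - 1" by simp
  hence "P (n + 1) k = dp n * (d * M (- n - int k - 1) 0 k)"
    by (simp only: P_def d_dp(2)[symmetric] mult.assoc)
  thus ?thesis by (simp add: d_mult_M distrib_left scale_mult_right algebra_simps)
qed

text \<open>\<open>E (P n (Suc k))\<close> and \<open>P (n + 1) k\<close> are both combinations of
  the same two elements \<open>u\<close> and \<open>v\<close>. Here \<open>ad_b\<close> yields
  \<open>v\<close> alone, with a coefficient that is nonzero by the divisibility hypothesis, and
  then \<open>E\<close> yields \<open>u\<close>.\<close>

lemma P_descent: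
  assumes A: "stable A" and P: "P n (Suc k) \<in> A" "Suc k < N" "\<not> int N dvd n + int (Suc k)"
  shows "P (n + 1) k \<in> A" and "dp n * M (- n - int k - 2) 0 k \<in> A"
proof -
  note sub = subalgebra_subspace[OF stable_subalgebra[OF A]]
  define u v where "u = dp n * M (- n - int k - 2) 0 k" and "v = dp n * M (- n - int k - 2) 1 (Suc k)"
  have "ad_b (P n (Suc k)) = (1 - qi (- 2 * (n + int (Suc k)))) \<cdot> v"
    unfolding ad_b_P v_def by (simp add: algebra_simps)
  moreover have "1 - qi (- 2 * (n + int (Suc k))) \<noteq> 0"
    using P(3) qi_eq_1_iff[of "- 2 * (n + int (Suc k))"] N_dvd_double[of "n + int (Suc k)"]
    by (simp only: minus_mult_left[symmetric] dvd_minus_iff) auto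
  ultimately have v: "v \<in> A"
    using stableD(6)[OF A P(1)] scale_mem_iff[OF sub] by simp
  obtain r where "E (P n (Suc k)) = br (int k + 1) \<cdot> u + r \<cdot> v"
    using E_P_Suc u_def v_def by blast
  hence "br (int k + 1) \<cdot> u + r \<cdot> v \<in> A" using stable_E[OF A P(1)] by simp
  from subspace_diff[OF sub this subspace_scale[OF sub v, of r]]
  have "br (int k + 1) \<cdot> u \<in> A" by simp
  moreover have "br (int k + 1) \<noteq> 0" using P(2) by (intro br_nz) auto
  ultimately show u: "u \<in> A" using scale_mem_iff[OF sub] by simp
  show "P (n + 1) k \<in> A"
    unfolding P_shift u_def[symmetric] v_def[symmetric]
    using sub u v by (intro subspace_add subspace_scale)
qed

text \<open>The descent preserves \<open>n + Suc k\<close>, hence also the divisibility hypothesis.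
  At the bottom, \<open>P (n + 1) 0\<close> is invertible in \<open>A\<close> and
  \<open>ad_b\<close> multiplies it by a multiple of \<open>x\<close>, while \<open>P n 1\<close> is
  the product of \<open>z\<close> with the invertible element \<open>dp n * ap (- n - 2)\<close>,
  which the second conclusion of \<open>P_descent\<close> provides.\<close>

lemma P_imp_xz:
  assumes A: "stable A" and P: "P n (Suc k) \<in> A" "Suc k < N" "\<not> int N dvd n + int (Suc k)"
  shows "M (- 1) 1 0 \<in> A \<and> M 1 0 1 \<in> A"
  using P
proof (induction k arbitrary: n)
  case (Suc k)
  show ?case
    by (rule Suc.IH[OF P_descent(1)[OF A Suc.prems]]) (use Suc.prems in \<open>simp_all add: algebra_simps\<close>)
next
  case 0
  note A' = stable_subalgebra[OF A]
  have u: "P (n + 1) 0 \<in> A" and r: "dp n * ap (- n - 2) \<in> A"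
    using P_descent[OF A 0] by (simp_all add: ap_M)
  have "P (n + 1) 0 - (1 * 1) \<cdot> ap (- (n + 1) + (- n - 1)) \<in> J 1"
    unfolding P_def using mod_J_mult[OF dp_mod_J, of "ap (- n - 1)" 1 "- n - 1" "n + 1"] subspace_J
    by (simp add: ap_M subspace_0)
  from subalgebra_inverse[OF A' u this] obtain v where v: "v \<in> A" "v * P (n + 1) 0 = 1" by auto
  have "dp n * ap (- n - 2) - (1 * 1) \<cdot> ap (- n + (- n - 2)) \<in> J 1"
    using mod_J_mult[OF dp_mod_J, of "ap (- n - 2)" 1 "- n - 2" n] subspace_J
    by (simp add: subspace_0)
  from subalgebra_inverse[OF A' r this] obtain w where w: "w \<in> A" "w * (dp n * ap (- n - 2)) = 1" by auto
  have "ad_b (P (n + 1) 0) = (1 - qi (- 2 * (n + 1))) \<cdot> (P (n + 1) 0 * M (- 1) 1 0)"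
    unfolding ad_b_P by (simp add: P_def mult.assoc M_mult)
  moreover have "1 - qi (- 2 * (n + 1)) \<noteq> 0"
    using 0(3) qi_eq_1_iff[of "- 2 * (n + 1)"] N_dvd_double[of "n + 1"]
    by (simp only: minus_mult_left[symmetric] dvd_minus_iff) auto
  ultimately have "P (n + 1) 0 * M (- 1) 1 0 \<in> A"
    using stableD(6)[OF A u] scale_mem_iff[OF subalgebra_subspace[OF A']] by simp
  from subalgebra_mult[OF A' v(1) this] have "M (- 1) 1 0 \<in> A"
    using v(2) by (simp add: mult.assoc[symmetric])
  moreover have "M (- n - 2) 0 0 * M 1 0 1 = M (- n - 1) 0 1"
    by (subst M_mult) (simp, rule arg_cong[of _ _ "\<lambda>i. M i 0 (Suc 0)"], simp)
  hence "P n (Suc 0) = dp n * ap (- n - 2) * M 1 0 1"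
    by (simp add: P_def ap_M mult.assoc)
  hence "dp n * ap (- n - 2) * M 1 0 1 \<in> A" using 0(1) by simp
  from subalgebra_mult[OF A' w(1) this] have "M 1 0 1 \<in> A"
    using w(2) by (simp only: mult.assoc[symmetric]) (simp add: mult.assoc)
  ultimately show ?case ..
qed

subsection \<open>The left grading\<close>

text \<open>The generators \<open>a, b\<close> have left weight \<open>1\<close>, and \<open>c, d\<close> have left weight \<open>-1\<close>.\<close>
definition L :: "int \<Rightarrow> 'h set" where
  "L l = span {M i j k | i j k. int N dvd i + int j - int k - l}"

lemma subspace_L: "subspace (L l)" by (simp add: L_def)

lemma M_in_L: "int N dvd i + int j - int k - l \<Longrightarrow> M i j k \<in> L l"
  unfolding L_def by (rule span_base) blast

lemma L_mult: "u \<in> L l \<Longrightarrow> v \<in> L l' \<Longrightarrow> u * v \<in> L (l + l')"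
  unfolding L_def
proof (erule (1) span_mult, fold L_def)
  fix x y assume "x \<in> {M i j k | i j k. int N dvd i + int j - int k - l}"
    "y \<in> {M i j k | i j k. int N dvd i + int j - int k - l'}"
  then obtain i j k i' j' k' where *: "x = M i j k" "int N dvd i + int j - int k - l"
      "y = M i' j' k'" "int N dvd i' + int j' - int k' - l'" by blast
  hence "M (i + i') (j + j') (k + k') \<in> L (l + l')"
    using dvd_add[OF *(2,4)] by (intro M_in_L) (simp add: algebra_simps)
  thus "x * y \<in> L (l + l')"
    by (simp add: * M_mult subspace_scale[OF subspace_L])
qed

lemma L_cong: "int N dvd l - l' \<Longrightarrow> L l = L l'"
proof -
  assume "int N dvd l - l'"
  hence "int N dvd x - l \<longleftrightarrow> int N dvd x - l'" for x
    using dvd_diff[of "int N" "x - l'" "l - l'"] dvd_add[of "int N" "x - l" "l - l'"] by auto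
  thus ?thesis by (simp add: L_def)
qed

lemma L_generators: "a \<in> L 1" "b \<in> L 1" "c \<in> L (- 1)" "d \<in> L (- 1)" "1 \<in> L 0"
  using M_in_L[of 1 0 0 1, folded a_M] M_in_L[of 0 1 0 1, folded b_M]
    M_in_L[of 0 0 1 "- 1", folded c_M] M_in_L[of 0 0 0 0]
    M_in_L[of "- 1" 0 0 "- 1"] M_in_L[of "- 1" 1 1 "- 1"] subspace_L
  by (auto simp: d_M subspace_add subspace_scale)

lemma L_power: "u \<in> L l \<Longrightarrow> u ^ n \<in> L (int n * l)"
proof (induction n)
  case (Suc n)
  have "u * u ^ n \<in> L (l + int n * l)" using Suc by (intro L_mult)
  thus ?case by (simp add: algebra_simps)
qed (simp add: L_generators)

lemma dp_in_L: "dp n \<in> L (- n)"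
proof -
  have "dp n \<in> L (int (nat (n mod int N)) * - 1)"
    unfolding dp_def by (rule L_power) (rule L_generators)
  also have "L (int (nat (n mod int N)) * - 1) = L (- n)"
    using N_gt_1 by (intro L_cong) (simp add: dvd_eq_mod_eq_0 mod_simps)
  finally show ?thesis .
qed

lemma x_power: "\<exists>r. r \<noteq> 0 \<and> M (- 1) 1 0 ^ j = r \<cdot> M (- int j) j 0"
proof (induction j)
  case 0
  show ?case by (intro exI[of _ 1]) simp
next
  case (Suc j)
  then obtain r where "r \<noteq> 0" "M (- 1) 1 0 ^ j = r \<cdot> M (- int j) j 0" by blast
  thus ?case
    by (intro exI[of _ "r * qi (- int j)"]) (simp add: M_mult scale_mult_right algebra_simps)
qed

lemma z_power: "\<exists>r. r \<noteq> 0 \<and> M 1 0 1 ^ k = r \<cdot> M (int k) 0 k"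
proof (induction k)
  case 0
  show ?case by (intro exI[of _ 1]) simp
next
  case (Suc k)
  then obtain r where "r \<noteq> 0" "M 1 0 1 ^ k = r \<cdot> M (int k) 0 k" by blast
  thus ?case
    by (intro exI[of _ "r * qi (int k)"]) (simp add: M_mult scale_mult_right algebra_simps)
qed

lemma x_power_mem:
  assumes A: "subalgebra A" and "M (- 1) 1 0 \<in> A"
  shows "M (- int j) j 0 \<in> A"
  using x_power[of j] subalgebra_power[OF assms, of j] scale_mem_iff[OF subalgebra_subspace[OF A]]
  by auto

text \<open>A monomial of left weight \<open>0\<close> has \<open>i = k - j\<close> modulo
  \<open>N\<close>, which makes it a nonzero multiple of \<open>x^j z^k\<close>.\<close>

lemma L_0_subset:
  assumes A: "subalgebra A" and x: "M (- 1) 1 0 \<in> A" and z: "M 1 0 1 \<in> A"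
  shows "L 0 \<subseteq> A"
  unfolding L_def
proof (rule span_minimal)
  show "{M i j k | i j k. int N dvd i + int j - int k - 0} \<subseteq> A"
  proof clarify
    fix i j k assume ijk: "int N dvd i + int j - int k - 0"
    have "M (int k) 0 k \<in> A"
      using z_power[of k] subalgebra_power[OF A z, of k] scale_mem_iff[OF subalgebra_subspace[OF A]]
      by auto
    with x_power_mem[OF A x] have "M (- int j) j 0 * M (int k) 0 k \<in> A"
      by (rule subalgebra_mult[OF A])
    hence "M (int k - int j) j k \<in> A"
      using scale_mem_iff[OF subalgebra_subspace[OF A]] by (simp add: M_mult)
    moreover have "M (int k - int j) j k = M i j k"
      using ijk by (intro M_cong) (simp add: mod_eq_dvd_iff dvd_diff_commute algebra_simps)
    ultimately show "M i j k \<in> A" by simp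
  qed
qed (rule subalgebra_subspace[OF A])

definition y :: 'h where "y = c * dp (- 1)"

lemma y_eq: "y = c * d ^ (N - 1)"
proof -
  have "dp (- 1) = dp (int (N - 1))"
    using N_gt_1 by (intro dp_cong) (simp add: of_nat_diff mod_simps)
  thus ?thesis by (simp only: y_def dp_nat)
qed

lemma x_eq: "a ^ (N - 1) * b = M (- 1) 1 0"
proof -
  have "ap (- 1) = ap (int (N - 1))"
    using N_gt_1 by (intro ap_cong) (simp add: of_nat_diff mod_simps)
  thus ?thesis by (simp add: M_def ap_nat)
qed

lemma z_eq: "a * c = M 1 0 1"
  by (simp add: M_def ap_1)

lemma y_in_L: "y \<in> L 0"
  using L_mult[OF L_generators(3) dp_in_L[of "- 1"]] by (simp add: y_def)

lemma E_y_power: "E (y ^ Suc k) = (qi (int k + 1) * br (int k + 1)) \<cdot> y ^ k"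
proof (induction k)
  have Ky: "K y = qi 2 \<cdot> y"
    using K_mult[of c "dp (- 1)"] qi_mult[of 1 1]
    by (simp add: y_def K_c K_dp scale_mult_left scale_mult_right qi_1)
  have Ey: "E y = qi 1 \<cdot> 1"
    using E_mult[of c "dp (- 1)"] dp_inverse(1)[of 1]
    by (simp add: y_def E_c E_dp K_dp scale_mult_right dp_1)
  {
    case 0
    show ?case using Ey by (simp add: E_one)
  next
    case (Suc k)
    have "qi 2 ^ Suc k = qi (2 * int (Suc k))"
      unfolding qi_def power_int_mult power_int_of_nat ..
    hence "qi 2 ^ Suc k = qi (2 * (int k + 1))" by (simp add: add.commute)
    hence Kyk: "K (y ^ Suc k) = qi (2 * (int k + 1)) \<cdot> y ^ Suc k"
      using K_power[OF Ky, of "Suc k"] by (simp only:)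
    have "E (y ^ Suc (Suc k)) = y * E (y ^ Suc k) + E y * K (y ^ Suc k)"
      unfolding power_Suc[of y "Suc k"] by (rule E_mult)
    also have "\<dots> = (qi (int k + 1) * br (int k + 1) + qi 1 * qi (2 * (int k + 1))) \<cdot> y ^ Suc k"
      unfolding Suc Ey Kyk by (simp only: scale_mult_left scale_mult_right scale_left_distrib scale_scale mult_1 power_Suc
          mult.commute[of "qi (2 * (int k + 1))"])
    also have "qi (int k + 1) * br (int k + 1) + qi 1 * qi (2 * (int k + 1)) =
        qi (int k + 1 + 1) * br (int k + 1 + 1)"
    proof -
      have "qi 1 * qi (2 * (int k + 1)) = qi (int k + 1 + 1) * qi (int k + 1)"
        by (simp add: qi_mult algebra_simps)
      moreover have "qi (int k + 1 + 1) * inverse q = qi (int k + 1)"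
        unfolding qi_add[of "int k + 1" 1] qi_1 using q_nz by simp
      ultimately show ?thesis
        unfolding br_Suc(2)[of "int k + 1"] distrib_left by (simp only: mult.assoc[symmetric])
    qed
    finally show ?case by (simp add: add.commute)
  }
qed

lemma y_mem_of_power:
  assumes A: "stable A" and "y ^ Suc k \<in> A" "Suc k < N"
  shows "y \<in> A"
  using assms(2,3)
proof (induction k)
  case (Suc k)
  have "E (y ^ Suc (Suc k)) \<in> A" by (rule stable_E[OF A Suc.prems(1)])
  moreover have "qi (int (Suc k) + 1) * br (int (Suc k) + 1) \<noteq> 0"
    using Suc.prems br_nz[of "int (Suc k) + 1"] by simp
  ultimately have "y ^ Suc k \<in> A"
    using scale_mem_iff[OF subalgebra_subspace[OF stable_subalgebra[OF A]]]
    unfolding E_y_power by blast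
  thus ?case using Suc by simp
qed simp

lemma y_power: "\<exists>r. r \<noteq> 0 \<and> y ^ k = r \<cdot> (dp (- int k) * c ^ k)"
proof (induction k)
  case 0
  show ?case by (intro exI[of _ 1]) simp
next
  case (Suc k)
  then obtain r where r: "r \<noteq> 0" "y ^ k = r \<cdot> (dp (- int k) * c ^ k)" by blast
  have "y ^ Suc k = r \<cdot> (c ^ 1 * dp (- 1 + - int k) * c ^ k)"
    unfolding dp_add power_Suc r(2) by (simp add: y_def scale_mult_right mult.assoc)
  also have "\<dots> = (r * qi (1 + int k)) \<cdot> (dp (- int (Suc k)) * c ^ Suc k)"
    unfolding c_pow_dp by (simp add: scale_mult_left mult.assoc) (simp add: add.commute)
  finally show ?case using r(1) by (intro exI[of _ "r * qi (1 + int k)"]) simp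
qed

text \<open>If \<open>N\<close> does not divide \<open>n + k + 1\<close>, the descent produces
  \<open>x\<close> and \<open>z\<close> but not \<open>y\<close>; then \<open>y\<close> follows
  because it has left weight \<open>0\<close>. In the other case repeated use of \<open>E\<close>
  lowers the power of \<open>y\<close> to \<open>y\<close> itself.\<close>

lemma P_imp_y:
  assumes A: "stable A" and P: "P n (Suc k) \<in> A" "Suc k < N"
  shows "y \<in> A"
proof (cases "int N dvd n + int (Suc k)")
  case True
  have "dp n = dp (- int (Suc k))"
    using True by (intro dp_cong) (simp add: mod_eq_dvd_iff algebra_simps)
  moreover have "M (- n - int (Suc k)) 0 (Suc k) = M 0 0 (Suc k)"
  proof (rule M_cong)
    have "int N dvd - (n + int (Suc k))" using True by (simp only: dvd_minus_iff)
    moreover have "- (n + int (Suc k)) = - n - int (Suc k)" by simp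
    ultimately show "(- n - int (Suc k)) mod int N = 0 mod int N"
      by (simp only: dvd_eq_mod_eq_0 mod_0)
  qed
  ultimately have "dp (- int (Suc k)) * c ^ Suc k \<in> A"
    using P(1) by (simp add: P_def M_def)
  hence "y ^ Suc k \<in> A"
    using y_power[of "Suc k"] subspace_scale[OF subalgebra_subspace[OF stable_subalgebra[OF A]]]
    by metis
  thus ?thesis by (rule y_mem_of_power[OF A _ P(2)])
next
  case False
  with P_imp_xz[OF A P] L_0_subset[OF stable_subalgebra[OF A]] y_in_L show ?thesis by blast
qed

subsection \<open>Stable subalgebras with a nonscalar vector killed by \<open>F\<close>\<close>

text \<open>Multiplying by \<open>c ^ (N - 1)\<close> kills the term of \<open>d\<close> that
  contains \<open>b c\<close>, so \<open>d\<close> acts like the inverse of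
  \<open>a\<close>.\<close>

lemma dp_M_top: "dp n * M i 0 (N - 1) = M (i - n) 0 (N - 1)"
proof -
  have d_M_top: "d * M i 0 (N - 1) = M (i - 1) 0 (N - 1)" for i
    using M_eq_0[of "Suc 0" "Suc (N - 1)"] N_gt_1 by (simp add: d_mult_M)
  have "d ^ m * M i 0 (N - 1) = M (i - int m) 0 (N - 1)" for m
  proof (induction m)
    case (Suc m)
    have "d ^ Suc m * M i 0 (N - 1) = M (i - int m - 1) 0 (N - 1)"
      unfolding power_Suc mult.assoc Suc d_M_top ..
    thus ?case by (simp add: algebra_simps)
  qed simp
  hence "dp n * M i 0 (N - 1) = M (i - int (nat (n mod int N))) 0 (N - 1)"
    by (simp add: dp_def)
  also have "\<dots> = M (i - n) 0 (N - 1)"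
    using N_gt_1 by (intro M_cong) (simp add: mod_simps)
  finally show ?thesis .
qed

text \<open>If \<open>N\<close> divides \<open>w\<close>, the terms are eigenvectors of
  \<open>ad_a\<close> with distinct eigenvalues, and a single one is some \<open>P 0 k\<close> up to
  a scalar. Otherwise \<open>ad_c\<close> shifts the coefficients by one and changes
  \<open>w\<close> by 2, until either the first case occurs or only the top monomial is left. The
  last hypothesis excludes exactly the scalar vectors and holds automatically after one shift, since
  then \<open>0 < k0\<close>.\<close>

lemma lo_imp_P:
  assumes A: "stable A" and "lo w \<gamma> \<in> A" "k0 < N" "\<gamma> k0 \<noteq> 0" "\<And>k. k < k0 \<Longrightarrow> \<gamma> k = 0"
    and "0 < k0 \<or> \<not> int N dvd w \<or> (\<exists>k. 0 < k \<and> k < N \<and> \<gamma> k \<noteq> 0)"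
  shows "\<exists>n k. Suc k < N \<and> P n (Suc k) \<in> A"
  using assms(2-)
proof (induction "N - k0" arbitrary: k0 w \<gamma> rule: less_induct)
  case less
  note sub = subalgebra_subspace[OF stable_subalgebra[OF A]]
  show ?case
  proof (cases "int N dvd w")
    case True
    obtain k where k: "0 < k" "k < N" "\<gamma> k \<noteq> 0"
      using less.prems True by blast
    have M: "M (w - int k) 0 k = M (- int k) 0 k" for k
      using True by (intro M_cong) (simp add: mod_eq_dvd_iff)
    have ad: "ad_a (M (- int k) 0 k) = qi (int k) \<cdot> M (- int k) 0 k" for k
      unfolding ad_a_M by simp
    have "\<gamma> k \<cdot> M (- int k) 0 k \<in> A"
    proof (rule eigen_components[where T = ad_a and ev = "\<lambda>k. qi (int k + 0)" and W = "{..<N}"])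
      show "inj_on (\<lambda>k. qi (int k + 0)) {..<N}" by (rule inj_on_qi)
      show "(\<Sum>k<N. \<gamma> k \<cdot> M (- int k) 0 k) \<in> A"
        using less.prems(1) by (simp add: lo_def M)
    qed (use sub k A in \<open>auto simp: ad_linear ad mult.commute stableD\<close>)
    hence "P 0 k \<in> A" using k scale_mem_iff[OF sub] by (simp add: P_def)
    thus ?thesis using k by (intro exI[of _ 0] exI[of _ "k - 1"]) auto
  next
    case False
    show ?thesis
    proof (cases "k0 = N - 1")
      case True
      have "lo w \<gamma> = (\<Sum>k<N. if k = k0 then \<gamma> k0 \<cdot> M (w - int k0) 0 k0 else 0)"
        unfolding lo_def using less.prems True by (intro sum.cong refl) auto
      hence 1: "M (w - int k0) 0 (N - 1) \<in> A"
        using less.prems True scale_mem_iff[OF sub] by simp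
      \<comment> \<open>\<open>P n (N - 1)\<close> has exponent \<open>- 2 n - (N - 1)\<close> of
        \<open>a\<close>, so \<open>2 n = - w\<close> modulo \<open>N\<close> is required; for odd
        \<open>N\<close>, \<open>(N - 1) div 2\<close> represents \<open>-1/2\<close>.\<close>
      define n where "n = w * int ((N - 1) div 2)"
      have h: "2 * int ((N - 1) div 2) + 1 = int N"
        using odd_N by (auto elim!: oddE)
      have "2 * n + w = w * (2 * int ((N - 1) div 2) + 1)" by (simp add: n_def algebra_simps)
      hence n: "2 * n + w = w * int N" by (simp only: h)
      have "P n (N - 1) = M (- n - int (N - 1) - n) 0 (N - 1)"
        unfolding P_def by (rule dp_M_top)
      also have "\<dots> = M (w - int k0) 0 (N - 1)"
      proof (rule M_cong)
        have "(- n - int (N - 1) - n) - (w - int k0) = int N * (- w)"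
          using n True by (simp add: algebra_simps)
        thus "(- n - int (N - 1) - n) mod int N = (w - int k0) mod int N"
          unfolding mod_eq_dvd_iff by (metis dvd_triv_left)
      qed
      finally have "P n (Suc (N - 2)) \<in> A"
        using 1 N_gt_1 by (simp add: Suc_diff_Suc numeral_2_eq_2)
      thus ?thesis using N_gt_1 by (intro exI[of _ n] exI[of _ "N - 2"]) auto
    next
      case neq: False
      define \<gamma>' where "\<gamma>' = (\<lambda>k. if k = 0 then 0 else \<gamma> (k - 1))"
      have "ad_c (lo w \<gamma>) \<in> A" using less.prems(1) A by (simp add: stableD)
      hence lo': "lo (w + 2) \<gamma>' \<in> A"
        using False scale_mem_iff[OF sub, of "1 - qi w"] by (simp add: ad_c_lo \<gamma>'_def qi_eq_1_iff)
      show ?thesis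
      proof (rule less.hyps[OF _ lo'])
        show "N - Suc k0 < N - k0" using less.prems by auto
        show "Suc k0 < N" using less.prems neq by auto
        show "\<gamma>' (Suc k0) \<noteq> 0" using less.prems by (simp add: \<gamma>'_def)
        show "\<gamma>' k = 0" if "k < Suc k0" for k
          using that less.prems(4)[of "k - 1"] by (auto simp: \<gamma>'_def)
      qed simp
    qed
  qed
qed

lemma lo_only_first:
  assumes "\<And>k. 0 < k \<Longrightarrow> k < N \<Longrightarrow> \<gamma> k = 0"
  shows "lo w \<gamma> = \<gamma> 0 \<cdot> ap w"
proof -
  have "lo w \<gamma> = (\<Sum>k<N. if k = 0 then \<gamma> 0 \<cdot> M w 0 0 else 0)"
    unfolding lo_def using assms by (intro sum.cong refl) auto
  thus ?thesis using N_gt_1 by (simp add: ap_M)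
qed

lemma ker_F_imp_y:
  assumes A: "stable A" and u: "u \<in> A" "F u = 0" "u \<notin> scalars"
  shows "y \<in> A"
proof -
  define \<gamma> where "\<gamma> w k = cf u (nat ((int w - int k) mod int N)) 0 k" for w k
  have u_eq: "u = (\<Sum>w<N. lo (int w) (\<gamma> w))"
    unfolding \<gamma>_def by (rule ker_F_decomp[OF u(2)])
  have "\<exists>w<N. lo (int w) (\<gamma> w) \<notin> scalars"
    using u(3) subspace_sum[OF subspace_scalars, of "{..<N}" "\<lambda>w. lo (int w) (\<gamma> w)"]
    by (auto simp: u_eq)
  then obtain w where w: "w < N" "lo (int w) (\<gamma> w) \<notin> scalars" by blast
  have lo: "lo (int w) (\<gamma> w) \<in> A"
    using lo_components[OF A _ w(1)] u(1) u_eq by metis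
  have "\<exists>k<N. \<gamma> w k \<noteq> 0"
  proof (rule ccontr)
    assume "\<not> ?thesis"
    hence "lo (int w) (\<gamma> w) = 0" by (simp add: lo_def)
    thus False using w(2) subspace_0[OF subspace_scalars] by simp
  qed
  define k0 where "k0 = (LEAST k. k < N \<and> \<gamma> w k \<noteq> 0)"
  have k0: "k0 < N" "\<gamma> w k0 \<noteq> 0"
    using LeastI_ex[OF \<open>\<exists>k<N. \<gamma> w k \<noteq> 0\<close>] by (auto simp: k0_def)
  have "\<gamma> w k = 0" if "k < k0" for k
    using not_less_Least[OF that[unfolded k0_def]] that k0(1) by auto
  moreover have "\<not> int N dvd int w \<or> (\<exists>k. 0 < k \<and> k < N \<and> \<gamma> w k \<noteq> 0)"
  proof (rule ccontr)
    assume "\<not> ?thesis"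
    moreover from this have "ap (int w) = ap 0" by (intro ap_cong) auto
    ultimately have "lo (int w) (\<gamma> w) \<in> scalars"
      by (subst lo_only_first) (auto simp: scalars_def)
    thus False using w(2) by contradiction
  qed
  ultimately obtain n k where "Suc k < N" "P n (Suc k) \<in> A"
    using lo_imp_P[OF A lo k0] by blast
  thus ?thesis using P_imp_y[OF A] by blast
qed

subsection \<open>The subalgebra generated by \<open>a\<^sup>-\<^sup>1 b\<close>\<close>

definition X :: "'h set" where "X = span {M (- int j) j 0 | j. True}"

lemma subalgebra_X: "subalgebra X"
  unfolding subalgebra_def
proof (intro conjI ballI)
  show "subspace X" by (simp add: X_def)
  have "M (- int 0) 0 0 \<in> X" unfolding X_def by (rule span_base) blast
  thus "1 \<in> X" by simp
  fix u v assume "u \<in> X" "v \<in> X"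
  thus "u * v \<in> X"
    unfolding X_def
  proof (rule span_mult)
    fix x y assume "x \<in> {M (- int j) j 0 | j. True}" "y \<in> {M (- int j) j 0 | j. True}"
    then obtain j j' where "x = M (- int j) j 0" "y = M (- int j') j' 0" by blast
    moreover have "M (- int (j + j')) (j + j') 0 \<in> span {M (- int j) j 0 | j. True}"
      by (rule span_base) blast
    ultimately show "x * y \<in> span {M (- int j) j 0 | j. True}"
      by (simp add: M_mult span_scale)
  qed
qed

lemma generated_x: "generated {M (- 1) 1 0} = X"
proof
  have "M (- int 1) 1 0 \<in> X" unfolding X_def by (rule span_base) blast
  thus "generated {M (- 1) 1 0} \<subseteq> X"
    by (intro generated_minimal subalgebra_X) simp
  show "X \<subseteq> generated {M (- 1) 1 0}"
    unfolding X_def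
    using x_power_mem[OF subalgebra_generated] generated_superset[of "{M (- 1) 1 0}"]
    by (intro span_minimal subalgebra_subspace subalgebra_generated) auto
qed

lemma X_sum:
  assumes "u \<in> X"
  shows "\<exists>\<beta>. u = (\<Sum>j<N. \<beta> j \<cdot> M (- int j) j 0)"
  using assms unfolding X_def
proof (induction rule: span_induct_alt)
  case base
  show ?case by (rule exI[of _ "\<lambda>_. 0"]) simp
next
  case (step r m u)
  then obtain j \<beta> where *: "m = M (- int j) j 0" "u = (\<Sum>j<N. \<beta> j \<cdot> M (- int j) j 0)" by blast
  have "m = (\<Sum>i<N. if i = j then M (- int j) j 0 else 0)"
    using M_eq_0[of j 0] by (auto simp: *(1) not_less)
  hence "r \<cdot> m + u = (\<Sum>i<N. (\<beta> i + (if i = j then r else 0)) \<cdot> M (- int i) i 0)"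
    by (simp only: scale_sum_right *(2) sum.distrib[symmetric])
      (auto intro!: sum.cong simp: scale_left_distrib)
  thus ?case by (intro exI[of _ "\<lambda>i. \<beta> i + (if i = j then r else 0)"])
qed

text \<open>Up to nonzero quantum integers, \<open>F\<close> lowers the exponent of \<open>b\<close>
  by one within \<open>X\<close>. Only the top monomial has no preimage in \<open>X\<close>, and it
  cannot occur in any image of \<open>F\<close> by \<open>cf_F_top\<close>.\<close>

lemma X_F_image:
  assumes "u \<in> X" "u = F v"
  shows "\<exists>r\<in>X. F r = u"
proof -
  obtain \<beta> where \<beta>: "u = (\<Sum>j<N. \<beta> j \<cdot> M (- int j) j 0)" using X_sum[OF assms(1)] by blast
  \<comment> \<open>The index \<open>1\<close> is the residue modulo \<open>N\<close> of
    \<open>- (N - 1)\<close>, the exponent of \<open>a\<close> in the top monomial.\<close>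
  have "cf u 1 (N - 1) 0 = (\<Sum>j<N. if j = N - 1 then \<beta> j else 0)"
    unfolding \<beta>
  proof (subst cf_sum, goal_cases)
    case 4
    have "- int (N - 1) mod int N = 1"
      using N_gt_1 by (simp add: of_nat_diff mod_simps)
    thus ?case using N_gt_1 by (intro sum.cong refl) (auto simp: cf_scale cf_M)
  qed (use N_gt_1 in auto)
  hence top: "\<beta> (N - 1) = 0"
    using cf_F_top[of 1 0 v] N_gt_1 by (simp add: assms(2))
  define r where "r = (\<Sum>j<N - 1. (\<beta> j / br (int j + 1)) \<cdot> M (- int (Suc j)) (Suc j) 0)"
  have "F r = (\<Sum>j<N - 1. \<beta> j \<cdot> M (- int j) j 0)"
    unfolding r_def F.sum
    by (intro sum.cong refl) (auto simp: F_scale F_M_Suc br_nz)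
  also have "\<dots> = u" unfolding \<beta> by (subst sum_N_last) (use top in simp)
  finally have "F r = u" .
  moreover have "r \<in> X"
    unfolding r_def X_def by (intro span_sum span_scale span_base) blast
  ultimately show ?thesis by blast
qed

lemma F_nilpotent: "(F ^^ N) u = 0"
proof -
  define G where "G n = span {M i j k | i j k. j < n}" for n
  have F_G: "F u \<in> G n" if "u \<in> G (Suc n)" for u n
    using that unfolding G_def
  proof (induction rule: span_induct_alt)
    case base
    show ?case by (simp add: F.zero span_zero)
  next
    case (step r m u)
    then obtain i j k where m: "m = M i j k" "j < Suc n" by blast
    have "F m \<in> span {M i j k | i j k. j < n}"
    proof (cases j)
      case 0
      thus ?thesis by (simp add: m F_M_0 span_zero)
    next
      case (Suc j')
      hence "M (i + 1) j' k \<in> span {M i j k | i j k. j < n}"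
        using m by (intro span_base) auto
      thus ?thesis unfolding m Suc F_M_Suc by (rule span_scale)
    qed
    thus ?case using step by (simp add: F_add F_scale span_add span_scale)
  qed
  have "(F ^^ n) u \<in> G m" if "u \<in> G (n + m)" for u n m
    using that
  proof (induction n arbitrary: u)
    case (Suc n)
    hence "F u \<in> G (n + m)" by (intro F_G) simp
    from Suc.IH[OF this] show ?case by (simp add: funpow_swap1)
  qed simp
  moreover have "u \<in> G N"
  proof -
    have "span {M i j k | i j k. True} \<subseteq> G N"
      unfolding G_def
    proof (rule span_minimal)
      show "{M i j k | i j k. True} \<subseteq> span {M i j k | i j k. j < N}"
      proof clarify
        fix i j k
        show "M i j k \<in> span {M i j k | i j k. j < N}"
        proof (cases "j < N")
          case True
          thus ?thesis by (intro span_base) blast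
        qed (simp add: M_eq_0 span_zero)
      qed
    qed simp
    thus ?thesis unfolding span_range_M by blast
  qed
  ultimately have "(F ^^ N) u \<in> G 0" by simp
  thus ?thesis by (simp add: G_def)
qed

lemma ad_c_x: "ad_c (M (- 1) 1 0) = 0"
proof -
  have "qi 2 = q * q" using qi_mult[of 1 1] by (simp add: qi_1)
  moreover have "inverse q * (inverse q * (q * q)) = 1" using q_nz by (simp add: field_simps)
  ultimately show ?thesis by (simp add: ad_c_def M_simps qi_neg_1)
qed

lemma ad_a_x: "ad_a (M (- 1) 1 0) = q \<cdot> M (- 1) 1 0"
proof -
  have "qi (- 3) * qi 3 = 1" "q * qi (- 1) = 1"
    using qi_mult[of "- 3" 3] q_nz by (simp_all add: qi_neg_1)
  thus ?thesis by (simp add: ad_a_def M_simps qi_1)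
qed

text \<open>One step before the chain of \<open>F\<close> reaches the scalars lies an element
  \<open>v1\<close> with \<open>F v1 = 1\<close>. It differs from \<open>x\<close> by a vector
  killed by \<open>F\<close>, and its component of the weight of \<open>x\<close> is
  \<open>x\<close> plus some \<open>lo\<close> vector. Since \<open>ad_c\<close> kills
  \<open>x\<close> and \<open>ad_a\<close> has \<open>x\<close> as an eigenvector, both can be used
  to remove that error term.\<close>

lemma trivial_ker_F_imp_x:
  assumes A: "stable A" and V: "\<And>u. u \<in> A \<Longrightarrow> F u = 0 \<Longrightarrow> u \<in> scalars" and neq: "A \<noteq> scalars"
  shows "M (- 1) 1 0 \<in> A"
proof -
  note A' = stable_subalgebra[OF A]
  note sub = subalgebra_subspace[OF A']
  define x where "x = M (- 1) 1 0"
  have FF: "(F ^^ m) u \<in> A" if "u \<in> A" for u m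
    using that by (induction m) (auto simp: stable_F[OF A])
  obtain u where u: "u \<in> A" "u \<notin> scalars"
    using neq scalars_subset[OF A'] by blast
  have ex: "\<exists>m. (F ^^ m) u = 0" using F_nilpotent by blast
  define m where "m = (LEAST m. (F ^^ m) u = 0)"
  have m0: "(F ^^ m) u = 0" unfolding m_def by (rule LeastI_ex[OF ex])
  have min: "(F ^^ k) u \<noteq> 0" if "k < m" for k
    using not_less_Least that unfolding m_def by blast
  have "m \<noteq> 0" using m0 u(2) subspace_0[OF subspace_scalars] by (cases m) auto
  moreover have "m \<noteq> 1" using m0 u V by auto
  ultimately obtain n where n: "m = Suc (Suc n)" by (metis One_nat_def not0_implies_Suc)
  define v where "v = (F ^^ n) u"
  have v: "v \<in> A" "F v \<noteq> 0" "F (F v) = 0"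
    using FF[OF u(1)] min[of "Suc n"] m0 by (auto simp: v_def n)
  then obtain r where r: "F v = r \<cdot> 1"
    using V[OF stable_F[OF A v(1)]] by (auto simp: scalars_def)
  hence r0: "r \<noteq> 0" using v by auto
  define v1 where "v1 = inverse r \<cdot> v"
  have v1: "v1 \<in> A" "F v1 = 1"
    using v(1) r r0 A' by (auto simp: v1_def subalgebra_scale F_scale)
  have ad_x: "ad_c x = 0" "ad_a x = q \<cdot> x"
    unfolding x_def by (rule ad_c_x ad_a_x)+
  have Fx: "F x = 1"
    unfolding x_def using F_M_Suc[of "- 1" 0 0] by simp
  have "F (v1 - x) = 0" by (simp add: F.diff v1 Fx)
  then obtain \<gamma> where \<gamma>: "v1 - x = (\<Sum>w<N. lo (int w) (\<gamma> w))"
    by (rule that[OF ker_F_decomp])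
  have N3: "N \<ge> 3" using N_gt_1 odd_N by (cases "N = 2") auto
  \<comment> \<open>The representative below \<open>N\<close> of the \<open>K\<close>-weight
    \<open>-2\<close> of \<open>x\<close>. It is nonzero modulo \<open>N\<close> because
    \<open>N\<close> is at least 3.\<close>
  define w where "w = N - 2"
  have w: "w < N" "int w = int N - 2" using N3 by (auto simp: w_def of_nat_diff)
  have qw: "qi (int w) = qi (- 2)" using w by (simp add: qi_eq_iff)
  have Kx: "K x = qi (int w) \<cdot> x" unfolding x_def K_M qw by simp
  have "v1 = (\<Sum>i<N. lo (int i) (\<gamma> i) + (if i = w then x else 0))"
    using w \<gamma> by (simp add: sum.distrib algebra_simps)
  hence "lo (int w) (\<gamma> w) + (if w = w then x else 0) \<in> A"
    using v1(1) w
    by (intro eigen_components[where T = K and ev = "\<lambda>w. qi (int w + 0)" and W = "{..<N}" and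
          v = "\<lambda>i. lo (int i) (\<gamma> i) + (if i = w then x else 0)"])
      (use inj_on_qi[of 0] in \<open>auto simp: K_add K_scale K_lo Kx K.zero stableD[OF A] sub scale_right_distrib\<close>)
  hence x': "lo (int w) (\<gamma> w) + x \<in> A" by simp
  have *: "lo i \<delta> \<in> scalars" if "lo i \<delta> \<in> A" for i \<delta>
    using V[OF that F_lo] .
  define \<gamma>' where "\<gamma>' = (\<lambda>k. if k = 0 then 0 else \<gamma> w (k - 1))"
  have "ad_c (lo (int w) (\<gamma> w) + x) \<in> A" using x' A by (simp add: stableD)
  moreover have "1 - qi (int w) \<noteq> 0"
    using not_N_dvd[of "int w"] w N3 qi_eq_1_iff[of "int w"] by auto
  ultimately have "lo (int w + 2) \<gamma>' \<in> A"
    using scale_mem_iff[OF sub] by (simp add: ad_linear ad_c_lo ad_x \<gamma>'_def)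
  \<comment> \<open>The shifted vector lies in \<open>A\<close> and is killed by \<open>F\<close>,
    hence is scalar. The shift has lost the coefficient at \<open>N - 1\<close>, which therefore
    survives as \<open>g\<close> and needs a separate argument.\<close>
  hence \<gamma>'0: "\<gamma>' k = 0" if "0 < k" "k < N" for k
    using lo_scalar[OF * that] by blast
  have \<gamma>0: "\<gamma> w k = 0" if "k < N - 1" for k
    using \<gamma>'0[of "Suc k"] that by (auto simp: \<gamma>'_def)
  define g where "g = \<gamma> w (N - 1)"
  define t where "t = M (- 1) 0 (N - 1)"
  have lo_t: "lo (int w) (\<lambda>k. if k = N - 1 then r else 0) = r \<cdot> t" for r
  proof -
    have "lo (int w) (\<lambda>k. if k = N - 1 then r else 0) = (\<Sum>k<N. if k = N - 1 then r \<cdot> M (int w - int (N - 1)) 0 (N - 1) else 0)"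
      unfolding lo_def by (intro sum.cong refl) auto
    also have "\<dots> = r \<cdot> t"
      using w N_gt_1 by (simp add: t_def of_nat_diff)
    finally show ?thesis .
  qed
  have "lo (int w) (\<gamma> w) = lo (int w) (\<lambda>k. if k = N - 1 then g else 0)"
    unfolding lo_def using \<gamma>0 by (intro sum.cong refl) (auto simp: g_def)
  hence x'': "g \<cdot> t + x \<in> A" using x' by (simp only: lo_t)
  have ad_t: "ad_a t = qi (- 1) \<cdot> t"
  proof -
    have "M (- 1) 1 (Suc (N - 1)) = 0" using N_gt_1 by (intro M_eq_0) auto
    moreover have "qi (int (N - 1)) = qi (- 1)" using N_gt_1 by (simp add: qi_eq_iff of_nat_diff)
    ultimately show ?thesis unfolding t_def ad_a_M by simp
  qed
  \<comment> \<open>\<open>x\<close> and \<open>t\<close> are eigenvectors of \<open>ad_a\<close>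
    with eigenvalues \<open>q\<close> and \<open>q^-1\<close>. The difference removes
    \<open>x\<close> and leaves a multiple of \<open>t\<close>, which is killed by \<open>F\<close>
    and thus can only be a scalar if it is zero.\<close>
  have "ad_a (g \<cdot> t + x) - q \<cdot> (g \<cdot> t + x) \<in> A"
    using x'' A A' by (intro subalgebra_diff subalgebra_scale) (auto simp: stableD)
  also have "ad_a (g \<cdot> t + x) - q \<cdot> (g \<cdot> t + x) = (g * (qi (- 1) - q)) \<cdot> t"
    by (simp add: ad_linear ad_t ad_x scale_right_distrib scale_left_diff_distrib algebra_simps)
  finally have "lo (int w) (\<lambda>k. if k = N - 1 then g * (qi (- 1) - q) else 0) \<in> A"
    by (simp only: lo_t)
  from lo_scalar[OF *[OF this], of "N - 1"] have "g * (qi (- 1) - q) = 0"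
    using N_gt_1 by auto
  hence "g = 0" using q_diff_nz by (auto simp: qi_neg_1)
  thus ?thesis using x'' by (simp add: x_def)
qed

text \<open>Induction along the chain of \<open>F\<close>: if \<open>F u\<close> lies in
  \<open>X\<close>, it has a preimage \<open>r\<close> in \<open>X\<close>, and \<open>u - r\<close>
  is killed by \<open>F\<close>, hence scalar.\<close>

lemma trivial_ker_F:
  assumes A: "stable A" and V: "\<And>u. u \<in> A \<Longrightarrow> F u = 0 \<Longrightarrow> u \<in> scalars" and neq: "A \<noteq> scalars"
  shows "A = X"
proof
  note A' = stable_subalgebra[OF A]
  note sub = subalgebra_subspace[OF A']
  have x: "M (- 1) 1 0 \<in> A" by (rule trivial_ker_F_imp_x[OF assms])
  show XA: "X \<subseteq> A"
    unfolding generated_x[symmetric] using x A' by (intro generated_minimal) auto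
  have "\<forall>u\<in>A. (F ^^ n) u = 0 \<longrightarrow> u \<in> X" for n
  proof (induction n)
    case 0
    show ?case using subspace_0[OF subalgebra_subspace[OF subalgebra_X]] by simp
  next
    case (Suc n)
    show ?case
    proof (intro ballI impI)
      fix u assume u: "u \<in> A" "(F ^^ Suc n) u = 0"
      hence "F u \<in> X" using Suc stable_F[OF A] by (auto simp: funpow_swap1)
      then obtain r where r: "r \<in> X" "F r = F u" using X_F_image by blast
      have "u - r \<in> scalars"
        using u r XA by (intro V subalgebra_diff[OF A']) (auto simp: F.diff)
      hence "u - r \<in> X" using scalars_subset[OF subalgebra_X] by blast
      thus "u \<in> X" using subalgebra_add[OF subalgebra_X _ r(1)] by fastforce
    qed
  qed
  thus "A \<subseteq> X" using F_nilpotent by blast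
qed

subsection \<open>Stable subalgebras containing \<open>x\<close> and \<open>y\<close>\<close>

text \<open>Cancelling inverse powers gives \<open>y x (a d) = c b\<close>, so
  \<open>1 - q^-1 y x\<close> is inverse to \<open>a d\<close>. Being unipotent in \<open>A\<close>,
  it has its inverse \<open>a d\<close> in \<open>A\<close>; hence \<open>b c\<close> and
  \<open>d a\<close> are in \<open>A\<close>, and so is \<open>y (d a) = c a\<close>, a nonzero
  multiple of \<open>z\<close>.\<close>

lemma z_mem_of_xy:
  assumes A: "subalgebra A" and x: "M (- 1) 1 0 \<in> A" and y: "y \<in> A"
  shows "M 1 0 1 \<in> A"
proof -
  define v where "v = 1 - inverse q \<cdot> (y * M (- 1) 1 0)"
  have "y * M (- 1) 1 0 \<in> J 1" by (intro J_ideal M_in_J) simp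
  hence "v - 1 \<cdot> 1 \<in> J 1"
    using subspace_J subspace_scale[OF subspace_J, of _ 1 "- inverse q"] by (simp add: v_def)
  moreover have "v \<in> A"
    unfolding v_def using A x y by (intro subalgebra_diff subalgebra_scale subalgebra_mult subalgebra_one)
  ultimately obtain w where w: "w \<in> A" "w * v = 1"
    using subalgebra_unipotent_inverse[OF A, of v 1] by auto
  have comm: "b * (a * d) = a * d * b"
  proof -
    have "b * (b * c) = b * c * b" by (metis bc mult.assoc)
    thus ?thesis by (simp add: ad distrib_left distrib_right scale_mult_left scale_mult_right)
  qed
  have "y * M (- 1) 1 0 * (a * d) = c * (dp (- 1) * ap (- 1)) * (b * (a * d))"
    by (simp add: y_def M_def mult.assoc)
  also have "\<dots> = c * (dp (- 1) * (ap (- 1) * ap 1) * dp 1) * b"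
    unfolding comm by (simp add: ap_1 dp_1 mult.assoc)
  also have "\<dots> = c * b" by (simp add: ap_inverse dp_inverse flip: mult.assoc)
  finally have "v * (a * d) = a * d - inverse q \<cdot> (c * b)"
    by (simp add: v_def left_diff_distrib scale_mult_left)
  hence "v * (a * d) = 1" by (simp add: ad bc)
  hence "w = a * d" using w(2) by (metis mult.assoc mult_1_left mult_1_right)
  hence "1 + inverse q \<cdot> (b * c) - 1 \<in> A"
    using w A subalgebra_one[OF A] ad by (intro subalgebra_diff) auto
  hence "b * c \<in> A"
    using scale_mem_iff[OF subalgebra_subspace[OF A], of "inverse q"] q_nz by simp
  hence "d * a \<in> A"
    unfolding da using A by (intro subalgebra_add subalgebra_scale subalgebra_one)
  hence "y * (d * a) \<in> A" by (rule subalgebra_mult[OF A y])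
  also have "y * (d * a) = c * (dp (- 1) * dp 1) * a" by (simp add: y_def dp_1 mult.assoc)
  also have "\<dots> = q \<cdot> M 1 0 1" using dp_inverse(2)[of 1] by (simp add: ca z_eq)
  finally show ?thesis
    using scale_mem_iff[OF subalgebra_subspace[OF A]] q_nz by simp
qed

text \<open>For \<open>m\<close> dividing \<open>N\<close> this is the sum of the left weight spaces
  whose weight is divisible by \<open>m\<close>; the third family of the theorem arises with
  \<open>m = N div r\<close>.\<close>

definition B :: "nat \<Rightarrow> 'h set" where
  "B m = span {M i j k | i j k. int m dvd i + int j - int k}"

lemma M_in_B: "int m dvd i + int j - int k \<Longrightarrow> M i j k \<in> B m"
  unfolding B_def by (rule span_base) blast

lemma subspace_B: "subspace (B m)" by (simp add: B_def)

lemma subalgebra_B: "subalgebra (B m)"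
  unfolding subalgebra_def
proof (intro conjI ballI)
  show "1 \<in> B m" using M_in_B[of m 0 0 0] by simp
  fix u v assume "u \<in> B m" "v \<in> B m"
  thus "u * v \<in> B m"
    unfolding B_def
  proof (rule span_mult, fold B_def)
    fix x y assume "x \<in> {M i j k | i j k. int m dvd i + int j - int k}"
      "y \<in> {M i j k | i j k. int m dvd i + int j - int k}"
    then obtain i j k i' j' k' where *: "x = M i j k" "int m dvd i + int j - int k"
        "y = M i' j' k'" "int m dvd i' + int j' - int k'" by blast
    hence "M (i + i') (j + j') (k + k') \<in> B m"
      using dvd_add[OF *(2,4)] by (intro M_in_B) (simp add: algebra_simps)
    thus "x * y \<in> B m" by (simp add: * M_mult subspace_scale[OF subspace_B])
  qed
qed (rule subspace_B)

lemma L_subset_B: "m dvd N \<Longrightarrow> int m dvd l \<Longrightarrow> L l \<subseteq> B m"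
  unfolding L_def
proof (rule span_minimal)
  assume m: "m dvd N" "int m dvd l"
  show "{M i j k | i j k. int N dvd i + int j - int k - l} \<subseteq> B m"
  proof clarify
    fix i j k assume "int N dvd i + int j - int k - l"
    hence "int m dvd i + int j - int k - l" using m(1) by (meson dvd_trans of_nat_dvd_iff)
    from dvd_add[OF this m(2)] show "M i j k \<in> B m" by (intro M_in_B) simp
  qed
qed (rule subspace_B)

lemma ap_power: "ap i ^ n = ap (int n * i)"
  by (induction n) (simp_all add: ap_add algebra_simps)

lemma ap_multiple_mem:
  assumes "subalgebra A" "ap i \<in> A"
  shows "ap (i * s) \<in> A"
proof -
  have "ap (i * s) = ap (int (nat (s mod int N)) * i)"
    using N_gt_1 by (intro ap_cong) (simp add: mod_simps mult.commute)
  also have "\<dots> = ap i ^ nat (s mod int N)" by (simp add: ap_power)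
  finally show ?thesis using subalgebra_power[OF assms] by simp
qed

text \<open>The second factor has left weight \<open>0\<close>. Thus, once \<open>A\<close> contains
  \<open>L 0\<close>, membership of a monomial is decided by a power of \<open>a\<close>.\<close>

lemma M_split: "M i j k = ap (i + int j - int k) * M (int k - int j) j k"
  by (simp add: ap_M M_mult)

lemma M_mem:
  assumes "subalgebra A" "L 0 \<subseteq> A" "ap (i + int j - int k) \<in> A"
  shows "M i j k \<in> A"
  unfolding M_split[of i] using assms by (intro subalgebra_mult) (auto intro!: M_in_L)

lemma generated_eq_B:
  assumes m: "m dvd N"
  shows "generated {a ^ m, a ^ (N - 1) * b, a * c} = B m" (is "?G = _")
proof
  have "M (int m) 0 0 \<in> B m" "M (- 1) 1 0 \<in> B m" "M 1 0 1 \<in> B m" by (intro M_in_B; simp)+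
  moreover from this have "a ^ m \<in> B m" using ap_nat[of m] by (simp add: ap_M)
  ultimately show "?G \<subseteq> B m"
    unfolding x_eq z_eq by (intro generated_minimal subalgebra_B) auto
  have G: "a ^ m \<in> ?G" "M (- 1) 1 0 \<in> ?G" "M 1 0 1 \<in> ?G"
    using generated_superset[of "{a ^ m, a ^ (N - 1) * b, a * c}"]
    unfolding x_eq z_eq by auto
  note sG = subalgebra_generated[of "{a ^ m, a ^ (N - 1) * b, a * c}"]
  show "B m \<subseteq> ?G"
    unfolding B_def
  proof (rule span_minimal[OF _ subalgebra_subspace[OF sG]], clarify)
    fix i j k assume "int m dvd i + int j - int k"
    then obtain s where "i + int j - int k = int m * s" by blast
    hence "ap (i + int j - int k) \<in> ?G"
      using ap_multiple_mem[OF sG, of "int m" s] G(1) by (simp add: ap_nat)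
    thus "M i j k \<in> ?G" using L_0_subset[OF sG G(2,3)] by (intro M_mem sG)
  qed
qed

text \<open>\<open>E\<close> maps the monomial to \<open>M (i - 1) 0 k * g\<close>, where
  \<open>g\<close> has left weight \<open>0\<close> and is a nonzero scalar modulo the nilpotent
  ideal. So \<open>g\<close> has an inverse in \<open>A\<close> and can be divided out.\<close>

lemma M_descent:
  assumes A: "stable A" and L: "L 0 \<subseteq> A" and "M i 0 k \<in> A" "k < N"
  shows "ap (i - int k) \<in> A"
  using assms(3,4)
proof (induction k arbitrary: i)
  case 0
  thus ?case by (simp add: ap_M)
next
  case (Suc k)
  note A' = stable_subalgebra[OF A]
  obtain r where r: "E (M i 0 (Suc k)) = br (int k + 1) \<cdot> M (i - 1) 0 k + r \<cdot> M (i - 1) 1 (Suc k)"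
    using E_M_Suc by blast
  define g where "g = br (int k + 1) \<cdot> 1 + r \<cdot> M 0 1 1"
  have "M 0 1 1 \<in> A" using L M_in_L[of 0 1 1 0] by auto
  hence "g \<in> A" unfolding g_def using A' by (intro subalgebra_add subalgebra_scale subalgebra_one)
  moreover have "g - br (int k + 1) \<cdot> ap 0 \<in> J 1"
    using subspace_scale[OF subspace_J M_in_J, of 1 1 r 0 1] by (simp add: g_def)
  moreover have "br (int k + 1) \<noteq> 0" using Suc.prems by (intro br_nz) auto
  ultimately obtain v where v: "v \<in> A" "g * v = 1" using subalgebra_inverse[OF A'] by blast
  have "M (i - 1) 0 k * g = E (M i 0 (Suc k))"
    by (simp add: g_def r distrib_left scale_mult_right M_mult)
  hence "M (i - 1) 0 k * g \<in> A" using stable_E[OF A Suc.prems(1)] by simp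
  from subalgebra_mult[OF A' this v(1)] have "M (i - 1) 0 k \<in> A"
    using v(2) by (simp add: mult.assoc)
  from Suc.IH[OF this] show ?case using Suc.prems by (simp add: algebra_simps)
qed

text \<open>
  A power of \<open>F\<close> followed by a power of \<open>z\<close> moves a nonzero \<open>p\<close> to some \<open>M i 0 (N - 1)\<close>, from which \<open>E\<close>
  descends to a power of \<open>a\<close> of the same left weight.
\<close>
lemma no_foreign_components:
  assumes A: "stable A" and L: "L 0 \<subseteq> A"
    and p: "p \<in> A" "p \<in> span {M i j k | i j k. ap (i + int j - int k) \<notin> A}" (is "p \<in> span ?D")
  shows "p = 0"
proof (rule ccontr)
  assume "p \<noteq> 0"
  note A' = stable_subalgebra[OF A]
  note sub = subalgebra_subspace[OF A']
  have F_D: "F u \<in> span ?D" if "u \<in> span ?D" for u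
    using that
  proof (induction rule: span_induct_alt)
    case base
    show ?case by (simp add: F.zero span_zero)
  next
    case (step r m u)
    then obtain i j k where m: "m = M i j k" "ap (i + int j - int k) \<notin> A" by blast
    have "F m \<in> span ?D"
    proof (cases j)
      case 0
      thus ?thesis by (simp add: m F_M_0 span_zero)
    next
      case (Suc j')
      hence "ap (i + 1 + int j' - int k) \<notin> A" using m(2) by (simp add: algebra_simps)
      hence "M (i + 1) j' k \<in> span ?D" by (intro span_base) blast
      thus ?thesis unfolding m Suc F_M_Suc by (rule span_scale)
    qed
    thus ?case using step by (simp add: F_add F_scale span_add span_scale)
  qed
  have F_pow: "(F ^^ n) p \<in> A \<and> (F ^^ n) p \<in> span ?D" for n
    using p by (induction n) (auto simp: stable_F[OF A] F_D)
  have ex: "\<exists>n. (F ^^ n) p = 0" using F_nilpotent by blast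
  define n where "n = (LEAST n. (F ^^ n) p = 0)"
  have n0: "(F ^^ n) p = 0" unfolding n_def by (rule LeastI_ex[OF ex])
  with \<open>p \<noteq> 0\<close> obtain m where m: "n = Suc m" by (cases n) auto
  have "(F ^^ m) p \<noteq> 0" using not_less_Least[of m "\<lambda>n. (F ^^ n) p = 0"] m n_def by auto
  then obtain v where v: "v \<in> A" "v \<in> span ?D" "v \<noteq> 0" "F v = 0"
    using F_pow[of m] n0 m by auto
  define \<gamma> where "\<gamma> w k = cf v (nat ((int w - int k) mod int N)) 0 k" for w k
  have v_eq: "v = (\<Sum>w<N. lo (int w) (\<gamma> w))"
    unfolding \<gamma>_def by (rule ker_F_decomp[OF v(4)])
  have "\<exists>w<N. \<exists>k<N. \<gamma> w k \<noteq> 0"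
  proof (rule ccontr)
    assume "\<not> ?thesis"
    hence "v = 0" unfolding v_eq lo_def by (auto intro!: sum.neutral)
    thus False using v by simp
  qed
  then obtain w where w: "w < N" "\<exists>k. k < N \<and> \<gamma> w k \<noteq> 0" by blast
  define k0 where "k0 = (LEAST k. k < N \<and> \<gamma> w k \<noteq> 0)"
  have k0: "k0 < N" "\<gamma> w k0 \<noteq> 0"
    using LeastI_ex[OF w(2)] by (auto simp: k0_def)
  have min: "\<gamma> w k = 0" if "k < k0" for k
    using not_less_Least[OF that[unfolded k0_def]] that k0(1) by auto
  have lo: "lo (int w) (\<gamma> w) \<in> A"
    using lo_components[OF A _ w(1)] v(1) v_eq by metis
  \<comment> \<open>Multiplication by \<open>M (int s) 0 s\<close> pushes all terms with
    \<open>k > k0\<close> to \<open>c ^ N = 0\<close>, and the terms with \<open>k < k0\<close> are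
    absent, so exactly one term survives.\<close>
  define s where "s = N - 1 - k0"
  have s: "k0 + s = N - 1" using k0 by (simp add: s_def)
  have "M (int s) 0 s \<in> A" using L M_in_L[of "int s" 0 s 0] by auto
  with lo have "lo (int w) (\<gamma> w) * M (int s) 0 s \<in> A" by (rule subalgebra_mult[OF A'])
  also have "lo (int w) (\<gamma> w) * M (int s) 0 s =
      (\<Sum>k<N. if k = k0 then (\<gamma> w k0 * qi (int k0 * int s)) \<cdot> M (int w - int k0 + int s) 0 (N - 1) else 0)"
    unfolding lo_def sum_distrib_right scale_mult_left
  proof (intro sum.cong refl)
    fix k
    show "\<gamma> w k \<cdot> (M (int w - int k) 0 k * M (int s) 0 s) =
        (if k = k0 then (\<gamma> w k0 * qi (int k0 * int s)) \<cdot> M (int w - int k0 + int s) 0 (N - 1) else 0)"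
      using min[of k] M_eq_0[of 0 "k + s"] s k0 by (cases k k0 rule: linorder_cases) (auto simp: M_mult)
  qed
  finally have "M (int w - int k0 + int s) 0 (N - 1) \<in> A"
    using k0 scale_mem_iff[OF sub] by simp
  from M_descent[OF A L this] have "ap (int w - int k0 + int s - int (N - 1)) \<in> A"
    using N_gt_1 by simp
  moreover have "int w - int k0 + int s - int (N - 1) = int w - int k0 - int k0"
    using s by linarith
  ultimately have in_A: "ap (int w - int k0 - int k0) \<in> A" by (simp only:)
  have "nat ((int w - int k0) mod int N) < N" using N_gt_1 by (simp add: nat_less_iff)
  with v(2) k0 obtain i' where i': "ap (i' + int 0 - int k0) \<notin> A"
      "int (nat ((int w - int k0) mod int N)) = i' mod int N"
    using N_gt_1 by - (rule cf_span[where P = "\<lambda>i j k. ap (i + int j - int k) \<notin> A" and u = v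
        and i = "nat ((int w - int k0) mod int N)" and j = 0 and k = k0], auto simp: \<gamma>_def)
  have "ap (i' + int 0 - int k0) = ap (int w - int k0 - int k0)"
  proof (rule ap_cong)
    have "i' mod int N = (int w - int k0) mod int N" using i'(2) N_gt_1 by simp
    thus "(i' + int 0 - int k0) mod int N = (int w - int k0 - int k0) mod int N"
      by (metis add.right_neutral mod_diff_cong of_nat_0)
  qed
  thus False using i'(1) in_A by simp
qed

text \<open>The exponents \<open>l\<close> with \<open>ap l\<close> in \<open>A\<close> form a
  subgroup of the integers containing \<open>N\<close>; its positive generator is \<open>m\<close>.
  Splitting an element of \<open>A\<close> into monomials inside and outside \<open>A\<close> leaves
  an outer part that is again in \<open>A\<close>, hence zero by
  \<open>no_foreign_components\<close>.\<close>

lemma stable_imp_B: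
  assumes A: "stable A" and L: "L 0 \<subseteq> A"
  shows "\<exists>m>0. m dvd N \<and> A = B m"
proof -
  note A' = stable_subalgebra[OF A]
  have apN: "ap (int N) \<in> A" using ap_cong[of "int N" 0] subalgebra_one[OF A'] by simp
  define m where "m = (LEAST m. 0 < m \<and> ap (int m) \<in> A)"
  have m: "0 < m" "ap (int m) \<in> A"
    using LeastI[of "\<lambda>m. 0 < m \<and> ap (int m) \<in> A" N] apN N_gt_1 by (auto simp: m_def)
  have iff: "ap l \<in> A \<longleftrightarrow> int m dvd l" for l
  proof
    assume "int m dvd l"
    thus "ap l \<in> A" using ap_multiple_mem[OF A' m(2)] by auto
  next
    assume l: "ap l \<in> A"
    have "l mod int m = l + int m * (- (l div int m))"
      by (simp add: minus_mult_div_eq_mod[symmetric])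
    hence "ap (l mod int m) \<in> A"
      using l ap_multiple_mem[OF A' m(2)] by (simp add: ap_add subalgebra_mult[OF A'] del: mult_minus_right)
    moreover have "\<not> (0 < nat (l mod int m) \<and> ap (int (nat (l mod int m))) \<in> A)"
      using m(1) by (intro not_less_Least) (simp add: nat_less_iff m_def[symmetric])
    moreover have "0 \<le> l mod int m" using m(1) by simp
    ultimately have "l mod int m = 0" by simp
    thus "int m dvd l" by auto
  qed
  have "m dvd N" using iff[of "int N"] apN by simp
  moreover have "B m \<subseteq> A"
    unfolding B_def using L iff by (intro span_minimal subalgebra_subspace A') (auto intro!: M_mem A')
  moreover have "A \<subseteq> B m"
  proof
    fix p assume p: "p \<in> A"
    let ?S = "{M i j k | i j k. int m dvd i + int j - int k}"
      and ?D = "{M i j k | i j k. ap (i + int j - int k) \<notin> A}"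
    have "?S \<union> ?D = {M i j k | i j k. True}" unfolding iff by blast
    hence "p \<in> span (?S \<union> ?D)" by (simp only: span_range_M UNIV_I)
    then obtain x z where xz: "p = x + z" "x \<in> span ?S" "z \<in> span ?D"
      unfolding span_Un by blast
    have "x \<in> A" using xz(2) \<open>B m \<subseteq> A\<close> unfolding B_def by blast
    hence "z \<in> A" using xz(1) subalgebra_diff[OF A' p, of x] by simp
    hence "z = 0" using xz(3) by (rule no_foreign_components[OF A L])
    thus "p \<in> B m" using xz by (simp add: B_def)
  qed
  ultimately show ?thesis using m(1) by blast
qed

lemma generated_y: "generated {c * d ^ (N - 1)} = generated {d ^ (N - 1) * c}"
proof -
  have "dp (- 1) = d ^ (N - 1)"
    using N_gt_1 dp_cong[of "- 1" "int (N - 1)"] by (simp add: of_nat_diff mod_simps flip: dp_nat)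
  hence "\<exists>r. r \<noteq> 0 \<and> c * d ^ (N - 1) = r \<cdot> (d ^ (N - 1) * c)"
    using y_power[of 1] by (simp add: y_eq)
  thus ?thesis using generated_scale[of _ _ "{}"] by auto
qed

subsection \<open>Classification of the stable subalgebras\<close>

theorem stable_classification:
  assumes A: "stable A"
  shows "A = scalars \<or> A = generated {a ^ (N - 1) * b} \<or> A = generated {c * d ^ (N - 1)} \<or>
    (\<exists>m>0. m dvd N \<and> A = B m)"
proof -
  interpret m: restricted_SL2 scale "inverse q" N d c b a K F E by (rule mirror)
  note A' = stable_subalgebra[OF A]
  have mA: "m.stable A" using A by (simp add: stable_mirror)
  show ?thesis
  proof (cases "A = scalars")
    case neq: False
    show ?thesis
    proof (cases "(\<forall>u\<in>A. F u = 0 \<longrightarrow> u \<in> scalars) \<or> (\<forall>u\<in>A. E u = 0 \<longrightarrow> u \<in> scalars)")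
      case True
      thus ?thesis
      proof
        assume "\<forall>u\<in>A. F u = 0 \<longrightarrow> u \<in> scalars"
        hence "A = X" using trivial_ker_F[OF A _ neq] by blast
        thus ?thesis by (simp only: x_eq generated_x) simp
      next
        assume "\<forall>u\<in>A. E u = 0 \<longrightarrow> u \<in> scalars"
        hence "A = m.X" using m.trivial_ker_F[OF mA _ neq] by blast
        thus ?thesis unfolding generated_y by (simp only: m.x_eq m.generated_x) simp
      qed
    next
      case False
      then obtain u v where u: "u \<in> A" "F u = 0" "u \<notin> scalars" and v: "v \<in> A" "E v = 0" "v \<notin> scalars"
        by blast
      have y: "y \<in> A" by (rule ker_F_imp_y[OF A u])
      have "b * a ^ (N - 1) \<in> A" using m.ker_F_imp_y[OF mA v] by (simp only: m.y_eq)
      also have "b * a ^ (N - 1) = qi (- 1) \<cdot> M (- 1) 1 0"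
      proof -
        have "ap (- 1) = ap (int (N - 1))"
          using N_gt_1 by (intro ap_cong) (simp add: of_nat_diff mod_simps)
        hence "b * a ^ (N - 1) = b ^ 1 * ap (- 1)" by (simp add: ap_nat)
        thus ?thesis unfolding b_pow_ap by (simp add: M_def)
      qed
      finally have x: "M (- 1) 1 0 \<in> A"
        using scale_mem_iff[OF subalgebra_subspace[OF A']] by simp
      have "M 1 0 1 \<in> A" by (rule z_mem_of_xy[OF A' x y])
      hence "L 0 \<subseteq> A" using A' x by (intro L_0_subset)
      thus ?thesis using stable_imp_B[OF A] by blast
    qed
  qed simp
qed

text \<open>The mirror reverses the sign of left weights, which divisibility by \<open>m\<close>
  does not see.\<close>

lemma mirror_B_subset: "m dvd N \<Longrightarrow> restricted_SL2.B scale N d c b m \<subseteq> B m"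
proof -
  assume m: "m dvd N"
  interpret m: restricted_SL2 scale "inverse q" N d c b a K F E by (rule mirror)
  show ?thesis
    unfolding m.B_def
  proof (rule span_minimal[OF _ subspace_B], clarify)
    fix i j k assume "int m dvd i + int j - int k"
    hence "int m dvd - (i + int j - int k)" by (simp only: dvd_minus_iff)
    hence dvd: "int m dvd - i + - int j + int k" by (simp add: algebra_simps)
    have "m.M i j k = dp i * c ^ j * b ^ k" by (simp add: m.M_def mirror_ap)
    also have "\<dots> \<in> L (- i + - int j + int k)"
      using L_power[OF L_generators(3), of j] L_power[OF L_generators(2), of k] dp_in_L[of i]
      by (intro L_mult) simp_all
    also have "\<dots> \<subseteq> B m" using m dvd by (rule L_subset_B)
    finally show "m.M i j k \<in> B m" .
  qed
qed

lemma mirror_B: "m dvd N \<Longrightarrow> restricted_SL2.B scale N d c b m = B m"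
proof -
  assume m: "m dvd N"
  interpret m: restricted_SL2 scale "inverse q" N d c b a K F E by (rule mirror)
  show ?thesis using mirror_B_subset[OF m] m.mirror_B_subset[OF m] by blast
qed

text \<open>This is \<open>generated_eq_B\<close> for the mirrored generators, with
  \<open>d b\<close> and \<open>d^-1 c\<close> replaced by the nonzero multiples \<open>b d\<close>
  and \<open>c d^-1\<close>.\<close>

lemma generated_eq_B':
  assumes "m dvd N"
  shows "generated {d ^ m, b * d, c * d ^ (N - 1)} = B m"
proof -
  interpret m: restricted_SL2 scale "inverse q" N d c b a K F E by (rule mirror)
  have "dp (- 1) = d ^ (N - 1)"
    using N_gt_1 dp_cong[of "- 1" "int (N - 1)"] by (simp add: of_nat_diff mod_simps flip: dp_nat)
  then obtain r where r: "r \<noteq> 0" "c * d ^ (N - 1) = r \<cdot> (d ^ (N - 1) * c)"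
    using y_power[of 1] by (auto simp: y_eq)
  have "B m = generated {d ^ m, d ^ (N - 1) * c, d * b}"
    using m.generated_eq_B[OF assms] mirror_B[OF assms] by simp
  also have "\<dots> = generated (insert (q \<cdot> (b * d)) {d ^ m, d ^ (N - 1) * c})"
    by (simp add: db insert_commute)
  also have "\<dots> = generated (insert (b * d) {d ^ m, d ^ (N - 1) * c})"
    by (rule generated_scale[OF q_nz])
  also have "\<dots> = generated (insert (d ^ (N - 1) * c) {d ^ m, b * d})"
    by (simp add: insert_commute)
  also have "\<dots> = generated (insert (r \<cdot> (d ^ (N - 1) * c)) {d ^ m, b * d})"
    by (rule generated_scale[OF r(1), symmetric])
  also have "\<dots> = generated {d ^ m, b * d, c * d ^ (N - 1)}"
    unfolding r(2) by (simp add: insert_commute)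
  finally show ?thesis ..
qed

lemma B_1: "B 1 = UNIV"
  using span_range_M by (simp add: B_def)

lemma B_eq_UNIV: "m dvd N \<Longrightarrow> B m = UNIV \<Longrightarrow> m = 1"
proof -
  assume m: "m dvd N" "B m = UNIV"
  hence a: "a \<in> span {M i j k | i j k. int m dvd i + int j - int k}" by (simp add: B_def)
  have "cf a 1 0 0 \<noteq> 0"
    using cf_M[of 1 0 0 1 0 0, folded a_M] N_gt_1 by simp
  with a obtain i where i: "int m dvd i + int 0 - int 0" "int 1 = i mod int N"
    using N_gt_1 by - (rule cf_span[where P = "\<lambda>i j k. int m dvd i + int j - int k"
        and u = a and i = 1 and j = 0 and k = 0], auto)
  have "int m dvd i mod int N" using i(1) m(1) by (simp add: dvd_mod_iff)
  thus "m = 1" using i(2) by simp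
qed

section \<open>Nontriviality of the listed subalgebras\<close>

lemma F_scalar: "u \<in> scalars \<Longrightarrow> F u = 0"
  by (auto simp: scalars_def F_scale F_one)

lemma x_not_scalar: "M (- 1) 1 0 \<notin> scalars"
  using F_scalar[of "M (- 1) 1 0"] F_M_Suc[of "- 1" 0 0] by auto

lemma B_not_scalars: "B m \<noteq> scalars"
  using x_not_scalar M_in_B[of m "- 1" 1 0] by auto

lemma X_not_scalars: "X \<noteq> scalars"
  using x_not_scalar generated_superset[of "{M (- 1) 1 0}"] unfolding generated_x by blast

lemma X_not_UNIV: "X \<noteq> UNIV"
proof
  assume "X = UNIV"
  hence "c \<in> X" by simp
  hence "c \<in> span {M i j k | i j k. k = 0}"
    unfolding X_def by (rule subsetD[OF span_mono, rotated]) blast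
  moreover have "cf c 0 0 1 \<noteq> 0"
    using cf_M[of 0 0 1 0 0 1, folded c_M] N_gt_1 by simp
  ultimately show False
    using N_gt_1
    by - (rule cf_span[where P = "\<lambda>i j k. k = 0" and u = c and i = 0 and j = 0 and k = 1], auto)
qed

subsection \<open>Stability under the adjoint action\<close>

text \<open>The matrix of the four operators is multiplicative, because the identity
  \<open>t S(t) = 1\<close> can be inserted between \<open>u\<close> and \<open>v\<close>.\<close>

lemma ad_a_mult: "ad_a (u * v) = ad_a u * ad_a v + ad_b u * ad_c v"
  and ad_b_mult: "ad_b (u * v) = ad_a u * ad_b v + ad_b u * ad_d v"
proof -
  have r: "a * (d * w) = w + inverse q \<cdot> (b * (c * w))" "d * (a * w) = w + q \<cdot> (b * (c * w))"
    "b * (a * w) = q \<cdot> (a * (b * w))" "c * (b * w) = b * (c * w)" "d * (c * w) = q \<cdot> (c * (d * w))" for w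
    by (simp_all add: ad da ba bc dc distrib_right scale_mult_left flip: mult.assoc)
  have q: "inverse q * (q * q) = q" using q_nz by simp
  show "ad_a (u * v) = ad_a u * ad_a v + ad_b u * ad_c v"
    "ad_b (u * v) = ad_a u * ad_b v + ad_b u * ad_d v"
    by (simp_all add: ad_a_def ad_b_def ad_c_def ad_d_def left_diff_distrib right_diff_distrib
        scale_mult_left scale_mult_right mult.assoc r distrib_left scale_right_distrib
        scale_right_diff_distrib q)
qed

lemma ad_one: "ad_a 1 = 1" "ad_b 1 = 0" "ad_c 1 = 0" "ad_d 1 = 1"
  using q_nz by (simp_all add: ad_a_def ad_b_def ad_c_def ad_d_def da ad db ba ca dc bc)

lemma mirror_ad:
  "restricted_SL2.ad_a scale (inverse q) d c b a = ad_d"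
  "restricted_SL2.ad_b scale (inverse q) c a = ad_c"
  "restricted_SL2.ad_c scale (inverse q) d b = ad_b"
  "restricted_SL2.ad_d scale (inverse q) d c b a = ad_a"
proof -
  interpret m: restricted_SL2 scale "inverse q" N d c b a K F E by (rule mirror)
  show "m.ad_a = ad_d" "m.ad_b = ad_c" "m.ad_c = ad_b" "m.ad_d = ad_a"
    by (simp_all add: fun_eq_iff ad_a_def ad_b_def ad_c_def ad_d_def m.ad_a_def m.ad_b_def m.ad_c_def m.ad_d_def)
qed

lemma ad_d_mult: "ad_d (u * v) = ad_d u * ad_d v + ad_c u * ad_b v"
  and ad_c_mult: "ad_c (u * v) = ad_d u * ad_c v + ad_c u * ad_a v"
proof -
  interpret m: restricted_SL2 scale "inverse q" N d c b a K F E by (rule mirror)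
  show "ad_d (u * v) = ad_d u * ad_d v + ad_c u * ad_b v"
    "ad_c (u * v) = ad_d u * ad_c v + ad_c u * ad_a v"
    using m.ad_a_mult[of u v] m.ad_b_mult[of u v] by (simp_all only: mirror_ad)
qed

text \<open>The adjoint half of \<open>stable\<close>. For the converse direction the coideal half
  is established directly with the comultiplication.\<close>

definition ad_stable :: "'h set \<Rightarrow> bool" where
  "ad_stable A \<longleftrightarrow> (\<forall>u\<in>A. ad_a u \<in> A \<and> ad_b u \<in> A \<and> ad_c u \<in> A \<and> ad_d u \<in> A)"

lemma ad_stable_mirror: "restricted_SL2.ad_stable scale (inverse q) d c b a A \<longleftrightarrow> ad_stable A"
proof -
  interpret m: restricted_SL2 scale "inverse q" N d c b a K F E by (rule mirror)
  show ?thesis by (auto simp: ad_stable_def m.ad_stable_def mirror_ad)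
qed

lemma ad_linear':
  "ad_b (u + v) = ad_b u + ad_b v" "ad_b (r \<cdot> u) = r \<cdot> ad_b u"
  "ad_d (u + v) = ad_d u + ad_d v" "ad_d (r \<cdot> u) = r \<cdot> ad_d u"
  by (simp_all add: ad_b_def ad_d_def distrib_left distrib_right scale_mult_left scale_mult_right
      scale_right_distrib scale_right_diff_distrib mult.commute)

lemma ad_b_x: "ad_b (M (- 1) 1 0) = (1 - qi (- 2)) \<cdot> M (- 2) 2 0"
proof -
  have "inverse q * inverse q = qi (- 2)" "qi (- 2) * inverse q = qi (- 3)"
    using qi_mult[of "- 1" "- 1"] qi_mult[of "- 2" "- 1"] by (simp_all add: qi_neg_1)
  moreover have qq: "q * (inverse q * r) = r" for r using q_nz by simp
  ultimately show ?thesis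
    by (simp add: ad_b_def M_simps numeral_2_eq_2 qi_1 qi_neg_1 scale_left_diff_distrib qq)
qed

lemma ad_d_x: "ad_d (M (- 1) 1 0) = inverse q \<cdot> M (- 1) 1 0"
  using q_nz by (simp add: ad_d_def M_simps qi_neg_1)

text \<open>By the product rules, the elements of \<open>X\<close> that all four operators send into
  \<open>X\<close> form a subalgebra, so the generator \<open>x\<close> is the only case to
  compute.\<close>

lemma ad_stable_X: "ad_stable X"
proof -
  define S where "S = {u \<in> X. ad_a u \<in> X \<and> ad_b u \<in> X \<and> ad_c u \<in> X \<and> ad_d u \<in> X}"
  note X = subalgebra_X
  have "subalgebra S"
    unfolding subalgebra_def
  proof (intro conjI ballI)
    show "1 \<in> S"
      using subalgebra_one[OF X] subspace_0[OF subalgebra_subspace[OF X]] by (simp add: S_def ad_one)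
    show "subspace S"
    proof (rule subspaceI)
      show "0 \<in> S"
        using subspace_0[OF subalgebra_subspace[OF X]] ad_linear(2,4)[of 0 0] ad_linear'(2,4)[of 0 0]
        by (simp add: S_def)
    qed (auto simp: S_def ad_linear ad_linear' subalgebra_add[OF X] subalgebra_scale[OF X])
    show "u * v \<in> S" if "u \<in> S" "v \<in> S" for u v
      using that by (auto simp: S_def ad_a_mult ad_b_mult ad_c_mult ad_d_mult
          intro!: subalgebra_add[OF X] subalgebra_mult[OF X])
  qed
  moreover have "M (- 1) 1 0 \<in> S"
  proof -
    have M: "M (- int j) j 0 \<in> X" for j unfolding X_def by (rule span_base) blast
    hence "M (- 1) 1 0 \<in> X" "M (- 2) 2 0 \<in> X" using M[of 1] M[of 2] by auto
    thus ?thesis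
      using subspace_0[OF subalgebra_subspace[OF X]]
      unfolding S_def mem_Collect_eq ad_a_x ad_b_x ad_c_x ad_d_x by (auto intro: subalgebra_scale[OF X])
  qed
  ultimately have "X \<subseteq> S" unfolding generated_x[symmetric] by (intro generated_minimal) auto
  thus ?thesis by (auto simp: S_def ad_stable_def)
qed

text \<open>In every term \<open>s * x * t\<close> of the four operators, \<open>s\<close> and
  \<open>t\<close> have opposite left weights, so the left weight of \<open>x\<close> is
  preserved.\<close>

lemma ad_stable_B: "m dvd N \<Longrightarrow> ad_stable (B m)"
  unfolding ad_stable_def
proof
  fix u assume m: "m dvd N" and "u \<in> B m"
  from this(2) show "ad_a u \<in> B m \<and> ad_b u \<in> B m \<and> ad_c u \<in> B m \<and> ad_d u \<in> B m"
    unfolding B_def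
  proof (induction rule: span_induct_alt)
    case base
    show ?case using ad_linear(2,4)[of 0 0] ad_linear'(2,4)[of 0 0] by (simp add: span_zero)
  next
    case (step r x u)
    then obtain i j k where x: "x = M i j k" "int m dvd i + int j - int k" by blast
    define l where "l = i + int j - int k"
    have xL: "x \<in> L l" unfolding x l_def by (rule M_in_L) simp
    have sandwich: "s * x * t \<in> L l" if "s \<in> L e" "t \<in> L (- e)" for s t e
      using L_mult[OF L_mult[OF that(1) xL] that(2)] by simp
    note g = L_generators
    have "ad_a x \<in> L l" "ad_b x \<in> L l" "ad_c x \<in> L l" "ad_d x \<in> L l"
      unfolding ad_a_def ad_b_def ad_c_def ad_d_def
      using sandwich[OF g(4)] sandwich[OF g(2)] sandwich[OF g(1)] sandwich[OF g(3)] g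
      by (auto intro!: subspace_diff[OF subspace_L] subspace_scale[OF subspace_L])
    moreover have "L l \<subseteq> span {M i j k | i j k. int m dvd i + int j - int k}"
      using L_subset_B[OF m x(2)] by (simp add: l_def B_def)
    ultimately show ?case
      using step by (auto simp: ad_linear ad_linear' intro!: span_add span_scale)
  qed
qed

end

section \<open>Presentations and tensor squares\<close>

lemma poly_mapping_sum_single: "(\<Sum>k\<in>Poly_Mapping.keys p. Poly_Mapping.single k (Poly_Mapping.lookup p k)) = p"
  by (rule poly_mapping_eqI) (simp add: lookup_sum lookup_single when_def not_in_keys_iff_lookup_eq_zero)

definition lin_ext :: "('k::field \<Rightarrow> 'v::ab_group_add \<Rightarrow> 'v) \<Rightarrow> ('x \<Rightarrow> 'v) \<Rightarrow> ('x \<Rightarrow>\<^sub>0 'k) \<Rightarrow> 'v" where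
  "lin_ext sc \<phi> p = (\<Sum>k\<in>Poly_Mapping.keys p. sc (Poly_Mapping.lookup p k) (\<phi> k))"

context vector_space
begin

lemma lin_ext_superset:
  fixes p :: "'x \<Rightarrow>\<^sub>0 'a"
  assumes "finite S" "Poly_Mapping.keys p \<subseteq> S"
  shows "lin_ext scale \<phi> p = (\<Sum>k\<in>S. scale (Poly_Mapping.lookup p k) (\<phi> k))"
  unfolding lin_ext_def using assms
  by (intro sum.mono_neutral_left) (auto simp: in_keys_iff)

lemma lin_ext_add: "lin_ext scale \<phi> (p + r) = lin_ext scale \<phi> p + lin_ext scale \<phi> r" for p :: "'x \<Rightarrow>\<^sub>0 'a"
proof -
  let ?S = "Poly_Mapping.keys p \<union> Poly_Mapping.keys r"
  have "Poly_Mapping.keys (p + r) \<subseteq> ?S" by (rule keys_add)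
  thus ?thesis
    by (simp add: lin_ext_superset[of ?S] lookup_add scale_left_distrib sum.distrib)
qed

sublocale lin_ext: additive "lin_ext scale \<phi>" for \<phi> :: "'x \<Rightarrow> 'b"
  by unfold_locales (rule lin_ext_add)

lemma lin_ext_fscale: "lin_ext scale \<phi> (fscale r p) = scale r (lin_ext scale \<phi> p)" for p :: "'x \<Rightarrow>\<^sub>0 'a"
proof -
  have "Poly_Mapping.keys (fscale r p) \<subseteq> Poly_Mapping.keys p"
    by (auto simp: in_keys_iff lookup_fscale)
  thus ?thesis
    by (simp add: lin_ext_superset[of "Poly_Mapping.keys p"] lookup_fscale scale_sum_right)
qed

lemma lin_ext_single [simp]: "lin_ext scale \<phi> (Poly_Mapping.single k r) = scale r (\<phi> k)"
  by (simp add: lin_ext_def)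

lemma lin_ext_sum_list: "lin_ext scale \<phi> (\<Sum>x\<leftarrow>xs. f x) = (\<Sum>x\<leftarrow>xs. lin_ext scale \<phi> (f x))"
  by (induction xs) (simp_all add: lin_ext.zero lin_ext_add)

end

text \<open>A representation is given by operators on a vector space rather than by elements of an
  algebra. This covers both left multiplication on the Hopf algebra and the two-dimensional module
  of \<open>skew_functional\<close>.\<close>

locale free_rep = V: vector_space sv
  for sv :: "'k::field \<Rightarrow> 'v::ab_group_add \<Rightarrow> 'v" +
  fixes op :: "'g \<Rightarrow> 'v \<Rightarrow> 'v"
  assumes op_add: "op g (u + v) = op g u + op g v" and op_scale: "op g (sv r u) = sv r (op g u)"
begin

definition ev :: "('g, 'k) free_algebra \<Rightarrow> 'v \<Rightarrow> 'v" where
  "ev p v = lin_ext sv (\<lambda>w. foldr op (letters w) v) p"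

lemma foldr_op_add: "foldr op gs (u + v) = foldr op gs u + foldr op gs v"
  and foldr_op_scale: "foldr op gs (sv r u) = sv r (foldr op gs u)"
  by (induction gs) (simp_all add: op_add op_scale)

lemma ev_add: "ev (p + p') v = ev p v + ev p' v"
  and ev_diff: "ev (p - p') v = ev p v - ev p' v"
  and ev_zero: "ev 0 v = 0"
  unfolding ev_def by (rule V.lin_ext_add V.lin_ext.diff V.lin_ext.zero)+

lemma ev_vec_add: "ev p (u + v) = ev p u + ev p v"
  and ev_vec_scale: "ev p (sv r v) = sv r (ev p v)"
proof -
  show "ev p (u + v) = ev p u + ev p v"
    unfolding ev_def lin_ext_def foldr_op_add V.scale_right_distrib sum.distrib ..
  show "ev p (sv r v) = sv r (ev p v)"
    unfolding ev_def lin_ext_def foldr_op_scale V.scale_sum_right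
    by (rule sum.cong[OF refl]) (rule V.scale_left_commute)
qed

sublocale ev_vec: additive "ev p" for p by unfold_locales (rule ev_vec_add)

lemma ev_single: "ev (Poly_Mapping.single w r) v = sv r (foldr op (letters w) v)"
  unfolding ev_def by (rule V.lin_ext_single)

lemma ev_sum: "ev (\<Sum>x\<in>I. f x) v = (\<Sum>x\<in>I. ev (f x) v)"
  unfolding ev_def by (rule V.lin_ext.sum)

lemma ev_mult: "ev (p * p') v = ev p (ev p' v)"
proof -
  have single: "ev (Poly_Mapping.single w r * Poly_Mapping.single w' r') v =
      ev (Poly_Mapping.single w r) (ev (Poly_Mapping.single w' r') v)" for w w' r r'
    by (simp add: mult_single ev_single plus_word_def foldr_op_scale)
  have "ev (p * p') v = ev ((\<Sum>k\<in>Poly_Mapping.keys p. Poly_Mapping.single k (Poly_Mapping.lookup p k)) *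
      (\<Sum>k\<in>Poly_Mapping.keys p'. Poly_Mapping.single k (Poly_Mapping.lookup p' k))) v"
    by (simp only: poly_mapping_sum_single)
  also have "\<dots> = ev (\<Sum>k\<in>Poly_Mapping.keys p. Poly_Mapping.single k (Poly_Mapping.lookup p k))
      (ev (\<Sum>k\<in>Poly_Mapping.keys p'. Poly_Mapping.single k (Poly_Mapping.lookup p' k)) v)"
    by (simp only: sum_product ev_sum single ev_vec.sum) (rule sum.swap)
  finally show ?thesis by (simp only: poly_mapping_sum_single)
qed

lemma ev_one: "ev 1 v = v"
proof -
  have "ev 1 v = foldr op (letters 0) v" using ev_single[of 0 1 v] by simp
  thus ?thesis by (simp add: zero_word_def)
qed

lemma ev_gen: "ev (free_gen g) v = op g v" and ev_const: "ev (free_const r) v = sv r v"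
  by (simp_all add: free_gen_def free_const_def ev_single zero_word_def)

lemma ev_power: "ev (p ^ n) v = (ev p ^^ n) v"
  by (induction n) (simp_all add: ev_one ev_mult)

lemma ev_ideal: "two_sided_ideal {p. \<forall>v. ev p v = 0}"
  by (auto simp: two_sided_ideal_def ev_zero ev_add ev_mult ev_vec.zero)

end

text \<open>Serves in both directions: for left multiplication it extracts the relations of the
  generators, and for the two-dimensional module it reduces the relators to identities between
  operators.\<close>

lemma ev_Oq_relators:
  assumes "free_rep sv op"
  shows "(\<forall>p\<in>Oq_SL2_relators q N. free_rep.ev sv op p v = 0) \<longleftrightarrow>
    op GB (op GA v) = sv q (op GA (op GB v)) \<and> op GC (op GA v) = sv q (op GA (op GC v)) \<and>
    op GB (op GC v) = op GC (op GB v) \<and>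
    op GD (op GB v) = sv q (op GB (op GD v)) \<and> op GD (op GC v) = sv q (op GC (op GD v)) \<and>
    op GA (op GD v) = v + sv (inverse q) (op GB (op GC v)) \<and>
    op GD (op GA v) = v + sv q (op GB (op GC v)) \<and>
    (op GA ^^ N) v = v \<and> (op GD ^^ N) v = v \<and> (op GB ^^ N) v = 0 \<and> (op GC ^^ N) v = 0"
proof -
  interpret free_rep sv op by (rule assms)
  have "ev (free_gen g) = op g" for g by (rule ext) (rule ev_gen)
  thus ?thesis
    unfolding Oq_SL2_relators_def Let_def
    by (simp add: ev_diff ev_mult ev_const ev_power ev_one diff_eq_eq)
qed

context k_algebra
begin

lemma left_mult_rep: "free_rep scale (\<lambda>g u. x g * u)"
  by unfold_locales (simp_all add: distrib_left scale_mult_right)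

lemma ev_left_mult: "free_rep.ev scale (\<lambda>g u. x g * u) p v = eval_free x p * v"
proof -
  interpret free_rep scale "\<lambda>g u. x g * u" by (rule left_mult_rep)
  have "foldr (\<lambda>g u. x g * u) gs v = prod_list (map x gs) * v" for gs
    by (induction gs) (simp_all add: mult.assoc)
  thus ?thesis
    by (simp add: ev_def lin_ext_def eval_free_def sum_distrib_right scale_mult_left)
qed

lemma eval_free_eq: "eval_free x p = free_rep.ev scale (\<lambda>g u. x g * u) p 1"
  by (simp add: ev_left_mult)

lemma presented_by_generates:
  assumes "presented_by x R" "subalgebra S" "range x \<subseteq> S"
  shows "S = UNIV"
proof -
  have "prod_list (map x gs) \<in> S" for gs
    using assms(3) by (induction gs) (auto intro: subalgebra_mult[OF assms(2)] subalgebra_one[OF assms(2)])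
  hence "eval_free x p \<in> S" for p
    unfolding eval_free_def using assms(2)
    by (intro subspace_sum subalgebra_subspace subalgebra_scale)
  thus ?thesis using assms(1) unfolding presented_by_def by (metis UNIV_eq_I)
qed

text \<open>The universal property of the presentation. The elements acting by zero form a two-sided
  ideal containing \<open>R\<close>, so the kernel of evaluation acts by zero and any preimage in
  the free algebra may be used to define \<open>\<rho>\<close>.\<close>

lemma presented_by_rep:
  assumes pres: "presented_by x R" and rep: "free_rep sv op"
    and R: "\<And>p v. p \<in> R \<Longrightarrow> free_rep.ev sv op p v = 0"
  obtains \<rho> where "\<And>g v. \<rho> (x g) v = op g v" "\<And>v. \<rho> 1 v = v" "\<And>h h' v. \<rho> (h * h') v = \<rho> h (\<rho> h' v)"
    "\<And>h h' v. \<rho> (h + h') v = \<rho> h v + \<rho> h' v" "\<And>r h v. \<rho> (scale r h) v = sv r (\<rho> h v)"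
    "\<And>h u v. \<rho> h (u + v) = \<rho> h u + \<rho> h v" "\<And>h r v. \<rho> h (sv r v) = sv r (\<rho> h v)"
proof -
  interpret free_rep sv op by (rule rep)
  interpret reg: free_rep scale "\<lambda>g u. x g * u" by (rule left_mult_rep)
  have "two_sided_ideal hull R \<subseteq> {p. \<forall>v. ev p v = 0}"
    using R by (intro hull_minimal ev_ideal) auto
  hence ker: "ev p v = 0" if "eval_free x p = 0" for p v
    using that pres unfolding presented_by_def by blast
  define \<rho> where "\<rho> h = ev (SOME p. eval_free x p = h)" for h
  have \<rho>: "\<rho> (eval_free x p) v = ev p v" for p v
  proof -
    define p' where "p' = (SOME p'. eval_free x p' = eval_free x p)"
    have "eval_free x p' = eval_free x p" unfolding p'_def by (rule someI) simp
    hence "eval_free x (p' - p) = 0" by (simp add: eval_free_eq reg.ev_diff)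
    from ker[OF this, of v] show ?thesis by (simp add: ev_diff \<rho>_def p'_def)
  qed
  have ex: "\<exists>p. h = eval_free x p" for h
    using pres unfolding presented_by_def by metis
  have mult: "eval_free x (p * p') = eval_free x p * eval_free x p'"
    and add: "eval_free x (p + p') = eval_free x p + eval_free x p'" for p p'
    by (simp_all add: eval_free_eq reg.ev_mult reg.ev_add) (simp add: ev_left_mult)
  have const: "eval_free x (free_const r * p) = scale r (eval_free x p)" for r p
    by (simp add: eval_free_eq reg.ev_mult reg.ev_const)
  have gen: "eval_free x (free_gen g) = x g" and one: "eval_free x 1 = 1" for g
    by (simp_all add: eval_free_eq reg.ev_gen reg.ev_one)
  show thesis
  proof (rule that)
    fix h h' r u v g
    obtain p p' where p: "h = eval_free x p" "h' = eval_free x p'" using ex by metis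
    show "\<rho> (h * h') v = \<rho> h (\<rho> h' v)" "\<rho> (h + h') v = \<rho> h v + \<rho> h' v" "\<rho> (scale r h) v = sv r (\<rho> h v)"
      unfolding p by (simp_all only: \<rho> ev_mult ev_add ev_const mult[symmetric] add[symmetric] const[symmetric])
    show "\<rho> h (u + v) = \<rho> h u + \<rho> h v" "\<rho> h (sv r v) = sv r (\<rho> h v)"
      unfolding p \<rho> by (rule ev_vec_add ev_vec_scale)+
    show "\<rho> (x g) v = op g v" "\<rho> 1 v = v"
      using \<rho>[of "free_gen g" v] \<rho>[of 1 v] by (simp_all add: gen one ev_gen ev_one)
  qed
qed

end

section \<open>Bilinear maps and the tensor square\<close>

lemma tensor_null_zero:
  fixes sV :: "'k::field \<Rightarrow> 'v::ab_group_add \<Rightarrow> 'v" and sW :: "'k \<Rightarrow> 'w::ab_group_add \<Rightarrow> 'w"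
    and sz :: "'k \<Rightarrow> 'z::ab_group_add \<Rightarrow> 'z"
  assumes "vector_space sz"
    and \<beta>: "\<And>x x' y. \<beta> (x + x') y = \<beta> x y + \<beta> x' y" "\<And>x y y'. \<beta> x (y + y') = \<beta> x y + \<beta> x y'"
      "\<And>r x y. \<beta> (sV r x) y = sz r (\<beta> x y)" "\<And>r x y. \<beta> x (sW r y) = sz r (\<beta> x y)"
    and p: "p \<in> tensor_null sV sW"
  shows "lin_ext sz (\<lambda>(x, y). \<beta> x y) p = 0"
proof -
  interpret Z: vector_space sz by (rule assms(1))
  interpret P: vector_space "fscale :: 'k \<Rightarrow> ('v \<times> 'w \<Rightarrow>\<^sub>0 'k) \<Rightarrow> _" by (rule vector_space_fscale)
  from p show ?thesis
    unfolding tensor_null_def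
  proof (induction rule: P.span_induct_alt)
    case base
    show ?case by (rule Z.lin_ext.zero)
  next
    case (step r s p)
    have "lin_ext sz (\<lambda>(x, y). \<beta> x y) s = 0"
      using step(1) by (auto simp: bilinear_relators_def Z.lin_ext.diff \<beta>)
    thus ?case using step by (simp add: Z.lin_ext_add Z.lin_ext_fscale)
  qed
qed

context tensor_square
begin

abbreviation tlin :: "('h \<times> 'h \<Rightarrow>\<^sub>0 'k) \<Rightarrow> 't" where "tlin \<equiv> lin_ext tscale (\<lambda>(x, y). x \<otimes> y)"

lemma tlin_eq: "tlin p = (\<Sum>(x, y)\<in>Poly_Mapping.keys p. tscale (Poly_Mapping.lookup p (x, y)) (x \<otimes> y))"
  unfolding lin_ext_def by (intro sum.cong refl) auto

lemma tlin_surj: "\<exists>p. t = tlin p"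
proof -
  from tensor_surj[of t] obtain p where "tlin p = t" unfolding tlin_eq by (rule exE)
  thus ?thesis by blast
qed

lemma tlin_kernel: "tlin p = 0 \<longleftrightarrow> p \<in> tensor_null scale scale"
proof -
  have "p \<in> {p. tlin p = 0} \<longleftrightarrow> p \<in> tensor_null scale scale"
    unfolding tlin_eq tensor_kernel ..
  thus ?thesis by (simp only: mem_Collect_eq)
qed

lemma tensor_add_left: "(x + x') \<otimes> y = x \<otimes> y + x' \<otimes> y"
  and tensor_add_right: "x \<otimes> (y + y') = x \<otimes> y + x \<otimes> y'"
  and tensor_scale_left: "scale r x \<otimes> y = tscale r (x \<otimes> y)"
  and tensor_scale_right: "x \<otimes> scale r y = tscale r (x \<otimes> y)"
proof -
  interpret P: vector_space "fscale :: 'k \<Rightarrow> ('h \<times> 'h \<Rightarrow>\<^sub>0 'k) \<Rightarrow> _" by (rule vector_space_fscale)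
  have *: "tlin p = 0" if "p \<in> bilinear_relators scale scale" for p
    unfolding tlin_kernel tensor_null_def using that by (rule P.span_base)
  have "tlin (Poly_Mapping.single (x + x', y) 1 - Poly_Mapping.single (x, y) 1 - Poly_Mapping.single (x', y) 1) = 0"
    "tlin (Poly_Mapping.single (x, y + y') 1 - Poly_Mapping.single (x, y) 1 - Poly_Mapping.single (x, y') 1) = 0"
    "tlin (Poly_Mapping.single (scale r x, y) 1 - Poly_Mapping.single (x, y) r) = 0"
    "tlin (Poly_Mapping.single (x, scale r y) 1 - Poly_Mapping.single (x, y) r) = 0"
    by (rule *, unfold bilinear_relators_def, blast)+
  thus "(x + x') \<otimes> y = x \<otimes> y + x' \<otimes> y" "x \<otimes> (y + y') = x \<otimes> y + x \<otimes> y'"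
    "scale r x \<otimes> y = tscale r (x \<otimes> y)" "x \<otimes> scale r y = tscale r (x \<otimes> y)"
    by (simp_all add: T.lin_ext.diff diff_eq_eq add.commute)
qed

lemma span_tensors: "t \<in> T.span {x \<otimes> y | x y. True}"
proof -
  obtain p where p: "t = tlin p" using tlin_surj[of t] by (rule exE)
  show ?thesis
    unfolding p lin_ext_def
  proof (rule T.span_sum)
    fix k :: "'h \<times> 'h"
    obtain x y where k: "k = (x, y)" by (cases k)
    have "x \<otimes> y \<in> T.span {x \<otimes> y | x y. True}" by (rule T.span_base) blast
    thus "tscale (Poly_Mapping.lookup p k) (case k of (x, y) \<Rightarrow> x \<otimes> y) \<in> T.span {x \<otimes> y | x y. True}"
      unfolding k prod.case by (rule T.span_scale)
  qed
qed

lemma tensor_induct [case_names add scale tensor]: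
  assumes "\<And>s t. Q s \<Longrightarrow> Q t \<Longrightarrow> Q (s + t)" "\<And>r t. Q t \<Longrightarrow> Q (tscale r t)" "\<And>x y. Q (x \<otimes> y)"
  shows "Q t"
proof -
  from span_tensors[of t] show ?thesis
  proof (induction rule: T.span_induct_alt)
    case base
    show ?case using assms(2)[OF assms(3), of 0] by simp
  qed (auto intro: assms)
qed

text \<open>The universal property of the tensor square: two preimages of \<open>t\<close> under
  \<open>tlin\<close> differ by an element of \<open>tensor_null\<close>, on which the linear
  extension of a bilinear map vanishes.\<close>

lemma tensor_lift:
  assumes Z: "vector_space sz"
    and \<beta>: "\<And>x x' y. \<beta> (x + x') y = \<beta> x y + \<beta> x' y" "\<And>x y y'. \<beta> x (y + y') = \<beta> x y + \<beta> x y'"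
      "\<And>r x y. \<beta> (scale r x) y = sz r (\<beta> x y)" "\<And>r x y. \<beta> x (scale r y) = sz r (\<beta> x y)"
  obtains G where "\<And>x y. G (x \<otimes> y) = \<beta> x y" "\<And>s t. G (s + t) = G s + G t" "\<And>r t. G (tscale r t) = sz r (G t)"
proof -
  interpret Z: vector_space sz by (rule Z)
  let ?l = "lin_ext sz (\<lambda>(x, y). \<beta> x y)"
  define G where "G t = ?l (SOME p. tlin p = t)" for t
  have G: "G (tlin p) = ?l p" for p
  proof -
    define p' where "p' = (SOME p'. tlin p' = tlin p)"
    have "tlin p' = tlin p"
      unfolding p'_def by (rule someI[of "\<lambda>p'. tlin p' = tlin p", OF refl])
    hence "tlin (p' - p) = 0" unfolding T.lin_ext.diff by simp
    hence "p' - p \<in> tensor_null scale scale" by (simp only: tlin_kernel)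
    hence "?l (p' - p) = 0" 
      by (rule tensor_null_zero[where \<beta> = \<beta> and sV = scale and sW = scale and sz = sz, OF Z \<beta>])
    hence "?l p' = ?l p" unfolding Z.lin_ext.diff by simp
    thus ?thesis by (simp only: G_def p'_def)
  qed
  show thesis
  proof (rule that)
    fix x y
    show "G (x \<otimes> y) = \<beta> x y"
      using G[of "Poly_Mapping.single (x, y) 1"] by (simp only: T.lin_ext_single Z.lin_ext_single
          prod.case T.scale_one Z.scale_one)
  next
    fix s t
    obtain p where s: "s = tlin p" using tlin_surj[of s] by (rule exE)
    obtain p' where t: "t = tlin p'" using tlin_surj[of t] by (rule exE)
    show "G (s + t) = G s + G t"
      unfolding s t T.lin_ext_add[symmetric] G by (rule Z.lin_ext_add)
  next
    fix r t
    obtain p where t: "t = tlin p" using tlin_surj[of t] by (rule exE)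
    show "G (tscale r t) = sz r (G t)"
      unfolding t T.lin_ext_fscale[symmetric] G by (rule Z.lin_ext_fscale)
  qed
qed

end

context comult_algebra
begin

lemma sweedler_exists: "\<exists>us. sweedler h us"
proof -
  obtain p where p: "comult h = tlin p" using tlin_surj[of "comult h"] by (rule exE)
  obtain ks where ks: "set ks = Poly_Mapping.keys p" "distinct ks"
    using finite_distinct_list[of "Poly_Mapping.keys p"] by auto
  have "comult h = (\<Sum>k\<leftarrow>ks. tscale (Poly_Mapping.lookup p k) (case k of (x, y) \<Rightarrow> x \<otimes> y))"
    unfolding p lin_ext_def ks(1)[symmetric] using ks(2) by (rule sum.distinct_set_conv_list)
  also have "\<dots> = (\<Sum>(u, v)\<leftarrow>map (\<lambda>(x, y). (scale (Poly_Mapping.lookup p (x, y)) x, y)) ks. u \<otimes> v)"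
    unfolding map_map
  proof (intro arg_cong[of _ _ sum_list] map_cong refl)
    fix k :: "'h \<times> 'h"
    obtain x y where k: "k = (x, y)" by (cases k)
    show "tscale (Poly_Mapping.lookup p k) (case k of (x, y) \<Rightarrow> x \<otimes> y) =
        ((\<lambda>(u, v). u \<otimes> v) \<circ> (\<lambda>(x, y). (scale (Poly_Mapping.lookup p (x, y)) x, y))) k"
      unfolding k comp_def prod.case tensor_scale_left ..
  qed
  finally show ?thesis unfolding sweedler_def by (rule exI)
qed

lemma lift_comult:
  assumes "sweedler h us" "\<And>x y. G (x \<otimes> y) = \<beta> x y" "\<And>s t. G (s + t) = G s + G t" "G 0 = 0"
  shows "G (comult h) = (\<Sum>(u, v)\<leftarrow>us. \<beta> u v)"
proof -
  have "G (\<Sum>(u, v)\<leftarrow>us. u \<otimes> v) = (\<Sum>(u, v)\<leftarrow>us. \<beta> u v)"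
    by (induction us) (auto simp: assms)
  thus ?thesis using assms(1) by (simp add: sweedler_def)
qed

lemma coideal_hull_subalgebra:
  assumes "H.subalgebra A"
  shows "T.subalgebra (T.span {x \<otimes> h | x h. x \<in> A})"
  unfolding T.subalgebra_def
proof (intro conjI ballI)
  show "1 \<in> T.span {x \<otimes> h | x h. x \<in> A}"
    using H.subalgebra_one[OF assms] tensor_one by (intro T.span_base) (metis (mono_tags, lifting) mem_Collect_eq)
  fix s t assume "s \<in> T.span {x \<otimes> h | x h. x \<in> A}" "t \<in> T.span {x \<otimes> h | x h. x \<in> A}"
  thus "s * t \<in> T.span {x \<otimes> h | x h. x \<in> A}"
  proof (rule T.span_mult)
    fix s t assume "s \<in> {x \<otimes> h | x h. x \<in> A}" "t \<in> {x \<otimes> h | x h. x \<in> A}"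
    then obtain x h x' h' where "s = x \<otimes> h" "t = x' \<otimes> h'" "x \<in> A" "x' \<in> A" by blast
    thus "s * t \<in> T.span {x \<otimes> h | x h. x \<in> A}"
      using H.subalgebra_mult[OF assms]
      by (intro T.span_base) (auto simp: tensor_mult)
  qed
qed simp

end

section \<open>The coideal property\<close>

text \<open>
  Counit and antipode are left out, so that the mirror symmetry of \<open>restricted_SL2\<close> applies.
\<close>
locale restricted_SL2_comult = comult_algebra scale tscale tensor comult
  + R: restricted_SL2 scale q N a b c d K E F
  for scale :: "'k::field \<Rightarrow> 'h::ring_1 \<Rightarrow> 'h" and tscale :: "'k \<Rightarrow> 't::ring_1 \<Rightarrow> 't"
    and tensor :: "'h \<Rightarrow> 'h \<Rightarrow> 't" (infixl \<open>\<otimes>\<close> 72) and comult :: "'h \<Rightarrow> 't"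
    and q N a b c d K E F +
  assumes comult_add: "comult (u + v) = comult u + comult v"
    and comult_scale: "comult (scale r u) = tscale r (comult u)"
    and comult_mult: "comult (u * v) = comult u * comult v" and comult_one: "comult 1 = 1"
    and comult_a: "comult a = a \<otimes> a + b \<otimes> c" and comult_b: "comult b = a \<otimes> b + b \<otimes> d"
    and comult_c: "comult c = c \<otimes> a + d \<otimes> c" and comult_d: "comult d = c \<otimes> b + d \<otimes> d"
begin

lemma comult_power: "comult (u ^ n) = comult u ^ n"
  by (induction n) (simp_all add: comult_one comult_mult)

lemma mirror_comult: "restricted_SL2_comult scale tscale tensor comult (inverse q) N d c b a K F E"
proof -
  interpret m: restricted_SL2 scale "inverse q" N d c b a K F E by (rule R.mirror)
  show ?thesis
    by unfold_locales (simp_all add: comult_add comult_scale comult_mult comult_one comult_a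
        comult_b comult_c comult_d add.commute)
qed

lemma span_comult:
  assumes "u \<in> H.span Y" "\<And>x. x \<in> Y \<Longrightarrow> comult x \<in> T.span Z"
  shows "comult u \<in> T.span Z"
  using assms(1)
proof (induction rule: H.span_induct_alt)
  case base
  have "comult 0 = 0" using comult_scale[of 0 0] by simp
  thus ?case by (simp add: T.span_zero)
next
  case (step r x u)
  thus ?case using assms(2)[of x] by (simp add: comult_add comult_scale T.span_add T.span_scale)
qed

text \<open>Left weight is carried by the first tensor factor: the coproduct of a generator of left
  weight \<open>l\<close> lies in \<open>L l \<otimes> H\<close>, and products add these
  weights.\<close>

lemma coideal_B:
  assumes m: "m dvd N"
  shows "comult ` R.B m \<subseteq> T.span {x \<otimes> h | x h. x \<in> R.B m}"
proof -
  define TL where "TL l = T.span {x \<otimes> h | x h. x \<in> R.L l}" for l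
  have TL_mult: "s * t \<in> TL (l + l')" if "s \<in> TL l" "t \<in> TL l'" for s t l l'
    using that unfolding TL_def
  proof (rule T.span_mult)
    fix s t assume "s \<in> {x \<otimes> h | x h. x \<in> R.L l}" "t \<in> {x \<otimes> h | x h. x \<in> R.L l'}"
    then obtain x h x' h' where "s = x \<otimes> h" "t = x' \<otimes> h'" "x \<in> R.L l" "x' \<in> R.L l'" by blast
    thus "s * t \<in> T.span {x \<otimes> h | x h. x \<in> R.L (l + l')}"
      using R.L_mult by (intro T.span_base) (auto simp: tensor_mult)
  qed
  have TL_one: "1 \<in> TL 0"
    unfolding TL_def using R.L_generators(5) tensor_one
    by (intro T.span_base) (metis (mono_tags, lifting) mem_Collect_eq)
  have TL_power: "t ^ n \<in> TL (int n * l)" if "t \<in> TL l" for t l n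
  proof (induction n)
    case (Suc n)
    have "t * t ^ n \<in> TL (l + int n * l)" using that Suc by (rule TL_mult)
    thus ?case by (simp add: algebra_simps)
  qed (simp add: TL_one)
  have TL_base: "x \<otimes> h \<in> TL l" if "x \<in> R.L l" for x h l
    unfolding TL_def using that by (intro T.span_base) blast
  have TL_gen: "comult a \<in> TL 1" "comult b \<in> TL 1" "comult c \<in> TL (- 1)"
    unfolding comult_a comult_b comult_c using TL_base R.L_generators
    by (auto simp: TL_def intro!: T.span_add)
  have "comult u \<in> T.span {x \<otimes> h | x h. x \<in> R.B m}" if "u \<in> R.B m" for u
    using that unfolding R.B_def
  proof (rule span_comult, fold R.B_def)
    fix x assume "x \<in> {R.M i j k | i j k. int m dvd i + int j - int k}"
    then obtain i j k where x: "x = R.M i j k" "int m dvd i + int j - int k" by blast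
    define n where "n = nat (i mod int N)"
    have "comult x = comult a ^ n * comult b ^ j * comult c ^ k"
      by (simp add: x(1) R.M_def R.ap_def n_def comult_mult comult_power)
    also have "\<dots> \<in> TL (int n * 1 + int j * 1 + int k * - 1)"
      by (intro TL_mult TL_power TL_gen)
    finally have "comult x \<in> TL (int n + int j - int k)" by simp
    \<comment> \<open>Replacing \<open>i\<close> by its residue \<open>n\<close> changes the weight
      by a multiple of \<open>N\<close>, hence of \<open>m\<close>.\<close>
    moreover have "int m dvd int n + int j - int k"
    proof -
      have "int m dvd (i mod int N) - i"
        using m by (metis dvd_trans minus_mod_eq_mult_div dvd_triv_left dvd_diff_commute of_nat_dvd_iff)
      from dvd_add[OF this x(2)] show ?thesis using R.N_gt_1 by (simp add: n_def algebra_simps)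
    qed
    hence "TL (int n + int j - int k) \<subseteq> T.span {x \<otimes> h | x h. x \<in> R.B m}"
      unfolding TL_def using R.L_subset_B[OF m] by (intro T.span_mono) blast
    ultimately show "comult x \<in> T.span {x \<otimes> h | x h. x \<in> R.B m}" by blast
  qed
  thus ?thesis by blast
qed

text \<open>
  With \<open>\<alpha> = a \<otimes> 1\<close> one has \<open>\<Delta>(a) = \<alpha>\<xi>\<close> and \<open>\<Delta>(b) = \<alpha>\<eta>\<close> with \<open>\<xi>, \<eta>\<close> in \<open>X \<otimes> H\<close>, which \<open>\<alpha>\<close> normalizes; hence
  \<open>\<Delta>(a\<^sup>N\<^sup>-\<^sup>1 b)\<close> lies in \<open>\<alpha>\<^sup>N (X \<otimes> H) = X \<otimes> H\<close>.
\<close>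
lemma coideal_X: "comult ` R.X \<subseteq> T.span {x \<otimes> h | x h. x \<in> R.X}"
proof -
  define TX where "TX = T.span {x \<otimes> h | x h. x \<in> R.X}"
  have sub: "T.subalgebra TX" unfolding TX_def by (rule coideal_hull_subalgebra[OF R.subalgebra_X])
  define x where "x = R.M (- 1) 1 0"
  have TX_base: "u \<otimes> h \<in> TX" if "u \<in> R.X" for u h
    unfolding TX_def using that by (intro T.span_base) blast
  have x: "x \<in> R.X" using H.generated_superset[of "{x}"] unfolding x_def R.generated_x by blast
  have one: "1 \<in> R.X" by (rule H.subalgebra_one[OF R.subalgebra_X])
  have ax: "a * x = b" by (simp add: x_def R.a_mult_M) (simp add: R.M_def)
  define \<alpha> where "\<alpha> = a \<otimes> 1"
  have conj: "\<exists>u'\<in>R.X. u * a = a * u'" if "u \<in> R.X" for u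
    using that unfolding R.X_def
  proof (induction rule: H.span_induct_alt)
    case base
    show ?case by (intro bexI[of _ 0]) (simp_all add: H.span_zero)
  next
    case (step r m u)
    then obtain j u' where j: "m = R.M (- int j) j 0"
        and u': "u' \<in> H.span {R.M (- int j) j 0 | j. True}" "u * a = a * u'" by blast
    have "R.M (- int j) j 0 \<in> H.span {R.M (- int j) j 0 | j. True}" by (rule H.span_base) blast
    moreover have "m * a = a * scale (R.qi (int j)) (R.M (- int j) j 0)"
      by (simp add: j R.M_simps)
    ultimately show ?case
      using u' by (intro bexI[of _ "scale r (scale (R.qi (int j)) (R.M (- int j) j 0)) + u'"]
          H.span_add H.span_scale)
        (simp_all only: distrib_left distrib_right H.scale_mult_left H.scale_mult_right)
  qed
  have shift: "\<exists>s\<in>TX. t * \<alpha> = \<alpha> * s" if "t \<in> TX" for t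
    using that unfolding TX_def
  proof (induction rule: T.span_induct_alt)
    case base
    show ?case by (intro bexI[of _ 0]) (simp_all add: T.span_zero)
  next
    case (step r m t)
    then obtain u h s where m: "m = u \<otimes> h" "u \<in> R.X" and s: "s \<in> TX" "t * \<alpha> = \<alpha> * s"
      unfolding TX_def by blast
    obtain u' where u': "u' \<in> R.X" "u * a = a * u'" using conj[OF m(2)] by blast
    have "m * \<alpha> = \<alpha> * (u' \<otimes> h)" by (simp add: m(1) \<alpha>_def tensor_mult u')
    hence "(tscale r m + t) * \<alpha> = \<alpha> * (tscale r (u' \<otimes> h) + s)"
      by (simp add: distrib_left distrib_right T.scale_mult_left T.scale_mult_right s)
    moreover have "tscale r (u' \<otimes> h) + s \<in> TX"
      using sub TX_base[OF u'(1)] s(1) by (intro T.subalgebra_add T.subalgebra_scale)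
    ultimately show ?case unfolding TX_def by blast
  qed
  define \<xi> where "\<xi> = 1 \<otimes> a + x \<otimes> c"
  define \<eta> where "\<eta> = 1 \<otimes> b + x \<otimes> d"
  have mem: "\<xi> \<in> TX" "\<eta> \<in> TX"
    unfolding \<xi>_def \<eta>_def using sub TX_base x one by (auto intro!: T.subalgebra_add)
  have ca: "comult a = \<alpha> * \<xi>" and cb: "comult b = \<alpha> * \<eta>"
    by (simp_all add: comult_a comult_b \<alpha>_def \<xi>_def \<eta>_def distrib_left tensor_mult ax)
  have pow: "\<exists>s\<in>TX. comult a ^ n = \<alpha> ^ n * s" for n
  proof (induction n)
    case 0
    show ?case using T.subalgebra_one[OF sub] by (intro bexI[of _ 1]) simp_all
  next
    case (Suc n)
    then obtain s where s: "s \<in> TX" "comult a ^ n = \<alpha> ^ n * s" by blast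
    obtain s' where s': "s' \<in> TX" "s * \<alpha> = \<alpha> * s'" using shift[OF s(1)] by blast
    have "comult a ^ Suc n = \<alpha> ^ n * (s * \<alpha>) * \<xi>"
      unfolding power_Suc2 s(2) by (simp only: ca mult.assoc)
    also have "\<dots> = \<alpha> ^ Suc n * (s' * \<xi>)"
      by (simp only: power_Suc2 s'(2) mult.assoc)
    finally show ?case using T.subalgebra_mult[OF sub s'(1) mem(1)] by blast
  qed
  obtain s where s: "s \<in> TX" "comult a ^ (N - 1) = \<alpha> ^ (N - 1) * s" using pow by blast
  obtain s' where s': "s' \<in> TX" "s * \<alpha> = \<alpha> * s'" using shift[OF s(1)] by blast
  have \<alpha>N: "\<alpha> ^ N = 1"
  proof -
    have "\<alpha> ^ n = a ^ n \<otimes> 1" for n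
      by (induction n) (simp_all add: \<alpha>_def tensor_one tensor_mult)
    thus ?thesis by (simp add: R.aN tensor_one)
  qed
  have "comult x = comult a ^ (N - 1) * comult b"
    unfolding x_def R.x_eq[symmetric] comult_mult comult_power ..
  also have "\<dots> = \<alpha> ^ (N - 1) * (s * \<alpha>) * \<eta>" by (simp only: s(2) cb mult.assoc)
  also have "\<dots> = \<alpha> ^ (N - 1) * \<alpha> * (s' * \<eta>)" by (simp only: s'(2) mult.assoc)
  also have "\<alpha> ^ (N - 1) * \<alpha> = 1"
    using power_minus_mult[of N \<alpha>] R.N_gt_1 by (simp add: \<alpha>N)
  finally have cx: "comult x \<in> TX" using T.subalgebra_mult[OF sub s'(1) mem(2)] by simp
  have "H.subalgebra {u. comult u \<in> TX}"
    unfolding H.subalgebra_def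
  proof (intro conjI ballI)
    show "H.subspace {u. comult u \<in> TX}"
    proof (rule H.subspaceI)
      have "comult 0 = 0" using comult_scale[of 0 0] by simp
      thus "0 \<in> {u. comult u \<in> TX}" by (simp add: TX_def T.span_zero)
    qed (auto simp: comult_add comult_scale T.subalgebra_add[OF sub] T.subalgebra_scale[OF sub])
  qed (auto simp: comult_one comult_mult T.subalgebra_one[OF sub] T.subalgebra_mult[OF sub])
  hence "R.X \<subseteq> {u. comult u \<in> TX}"
    unfolding R.generated_x[symmetric] using cx by (intro H.generated_minimal) (auto simp: x_def)
  thus ?thesis by (auto simp: TX_def)
qed

end

section \<open>The Hopf algebra\<close>

locale Oq_SL2_root = Oq_SL2 scale tscale tensor comult counit antipode q N a b c d
  for scale :: "'k::field \<Rightarrow> 'h::ring_1 \<Rightarrow> 'h" (infixr \<open>\<cdot>\<close> 75)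
    and tscale :: "'k \<Rightarrow> 't::ring_1 \<Rightarrow> 't"
    and tensor :: "'h \<Rightarrow> 'h \<Rightarrow> 't" (infixl \<open>\<otimes>\<close> 72)
    and comult counit antipode q N a b c d +
  assumes N_gt_1: "N > 1" and odd_N: "odd N" and prim: "primitive_root_of_unity N q"
begin

lemma q_nz: "q \<noteq> 0" and q_neq_1: "q \<noteq> 1" and q_pow_N: "q ^ N = 1"
proof -
  show "q ^ N = 1" using prim by (simp add: primitive_root_of_unity_def)
  thus "q \<noteq> 0" using N_gt_1 by (auto simp: power_0_left)
  have "q ^ 1 \<noteq> 1" using prim N_gt_1 unfolding primitive_root_of_unity_def by blast
  thus "q \<noteq> 1" by simp
qed

lemma relations:
  "b * a = q \<cdot> (a * b)" "c * a = q \<cdot> (a * c)" "b * c = c * b"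
  "d * b = q \<cdot> (b * d)" "d * c = q \<cdot> (c * d)"
  "a * d = 1 + inverse q \<cdot> (b * c)" "d * a = 1 + q \<cdot> (b * c)"
  "a ^ N = 1" "d ^ N = 1" "b ^ N = 0" "c ^ N = 0"
proof -
  let ?x = "case_generator a b c d"
  have "p \<in> two_sided_ideal hull Oq_SL2_relators q N" if "p \<in> Oq_SL2_relators q N" for p
    using that by (rule hull_inc)
  hence "\<forall>p\<in>Oq_SL2_relators q N. free_rep.ev scale (\<lambda>g u. ?x g * u) p 1 = 0"
    using presentation unfolding H.presented_by_def by (auto simp: H.ev_left_mult)
  moreover have pow: "((\<lambda>u. h * u) ^^ n) 1 = h ^ n" for h :: 'h and n
    by (induction n) simp_all
  ultimately show "b * a = q \<cdot> (a * b)" "c * a = q \<cdot> (a * c)" "b * c = c * b"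
    "d * b = q \<cdot> (b * d)" "d * c = q \<cdot> (c * d)"
    "a * d = 1 + inverse q \<cdot> (b * c)" "d * a = 1 + q \<cdot> (b * c)"
    "a ^ N = 1" "d ^ N = 1" "b ^ N = 0" "c ^ N = 0"
    unfolding ev_Oq_relators[OF H.left_mult_rep] by simp_all
qed

lemma generates:
  assumes "H.subalgebra S" "{a, b, c, d} \<subseteq> S"
  shows "S = UNIV"
proof (rule H.presented_by_generates[OF presentation assms(1)])
  show "range (case_generator a b c d) \<subseteq> S"
    using assms(2) by (auto split: generator.split)
qed

lemma comult_hom: "comult (u + v) = comult u + comult v" "comult (r \<cdot> u) = tscale r (comult u)"
  and counit_hom: "counit (u + v) = counit u + counit v" "counit (r \<cdot> u) = r * counit u"
  and antipode_hom: "antipode (u + v) = antipode u + antipode v" "antipode (r \<cdot> u) = r \<cdot> antipode u"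
proof -
  interpret c: Vector_Spaces.linear scale tscale comult by (rule comult_linear)
  interpret e: Vector_Spaces.linear scale "(*)" counit by (rule counit_linear)
  interpret s: Vector_Spaces.linear scale scale antipode by (rule antipode_linear)
  show "comult (u + v) = comult u + comult v" "comult (r \<cdot> u) = tscale r (comult u)"
    "counit (u + v) = counit u + counit v" "counit (r \<cdot> u) = r * counit u"
    "antipode (u + v) = antipode u + antipode v" "antipode (r \<cdot> u) = r \<cdot> antipode u"
    by (rule c.add c.scale e.add e.scale s.add s.scale)+
qed

lemma sweedler_gens: "sweedler a [(a, a), (b, c)]" "sweedler b [(a, b), (b, d)]"
    "sweedler c [(c, a), (d, c)]" "sweedler d [(c, b), (d, d)]" "sweedler 1 [(1, 1)]"
  by (simp_all add: sweedler_def comult_a comult_b comult_c comult_d comult_one tensor_one)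

text \<open>The counit takes values in a field, so \<open>b a = q a b\<close> forces
  \<open>counit b = 0\<close>, since \<open>q \<noteq> 1\<close> and \<open>counit a\<close> is a
  root of unity; likewise for \<open>c\<close>. The counit axiom for \<open>a\<close> then reads
  \<open>counit a \<cdot> a = a\<close>, and similarly for \<open>d\<close>.\<close>

lemma counit_gens: "counit a = 1" "counit b = 0" "counit c = 0" "counit d = 1"
proof -
  have pow: "counit (h ^ n) = counit h ^ n" for h n
    by (induction n) (simp_all add: counit_one counit_mult)
  have "counit a ^ N = 1" "counit d ^ N = 1"
    using relations(8,9) by (simp_all add: counit_one flip: pow)
  hence nz: "counit a \<noteq> 0" "counit d \<noteq> 0" using N_gt_1 by (auto simp: power_0_left)
  have "counit b * counit a = q * (counit a * counit b)" "counit c * counit a = q * (counit a * counit c)"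
    using relations(1,2) counit_mult counit_hom(2) by metis+
  hence "(1 - q) * (counit a * counit b) = 0" "(1 - q) * (counit a * counit c) = 0"
    by (simp_all add: algebra_simps)
  thus bc: "counit b = 0" "counit c = 0" using nz q_neq_1 by auto
  have ad_nz: "a \<noteq> 0" "d \<noteq> 0" using relations(8,9) N_gt_1 by (auto simp: power_0_left)
  have "counit a \<cdot> a = 1 \<cdot> a" "counit d \<cdot> d = 1 \<cdot> d"
    using counit_left[OF sweedler_gens(1)] counit_left[OF sweedler_gens(4)] by (simp_all add: bc)
  thus "counit a = 1" "counit d = 1" using ad_nz by (metis H.scale_right_imp_eq)+
qed

text \<open>
  \<open>f\<close> is the off-diagonal entry of the representation \<open>a \<mapsto> diag(1, q)\<close>, \<open>d \<mapsto> diag(1, q\<^sup>-\<^sup>1)\<close>,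
  \<open>b \<mapsto> \<beta>E\<^sub>1\<^sub>2\<close>, \<open>c \<mapsto> \<gamma>E\<^sub>1\<^sub>2\<close>.
\<close>
lemma skew_functional:
  fixes \<beta> \<gamma> :: 'k
  obtains f \<chi> where
    "\<And>u v. f (u + v) = f u + f v" "\<And>r u. f (r \<cdot> u) = r * f u"
    "\<And>u v. \<chi> (u + v) = \<chi> u + \<chi> v" "\<And>r u. \<chi> (r \<cdot> u) = r * \<chi> u"
    "\<And>u v. f (u * v) = counit u * f v + f u * \<chi> v" "\<And>u v. \<chi> (u * v) = \<chi> u * \<chi> v" "\<chi> 1 = 1"
    "f a = 0" "f b = \<beta>" "f c = \<gamma>" "f d = 0" "\<chi> a = q" "\<chi> b = 0" "\<chi> c = 0" "\<chi> d = inverse q"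
proof -
  let ?x = "case_generator a b c d"
  define sv :: "'k \<Rightarrow> 'k \<times> 'k \<Rightarrow> 'k \<times> 'k" where "sv r v = (r * fst v, r * snd v)" for r v
  define op :: "generator \<Rightarrow> 'k \<times> 'k \<Rightarrow> 'k \<times> 'k" where
    "op g v = (case g of GA \<Rightarrow> (fst v, q * snd v) | GB \<Rightarrow> (\<beta> * snd v, 0)
       | GC \<Rightarrow> (\<gamma> * snd v, 0) | GD \<Rightarrow> (fst v, inverse q * snd v))" for g v
  interpret V: vector_space sv
    by unfold_locales (auto simp: sv_def algebra_simps)
  have rep: "free_rep sv op"
    by unfold_locales (auto simp: sv_def op_def algebra_simps split: generator.split)
  have pow: "(op GA ^^ n) v = (fst v, q ^ n * snd v)" "(op GD ^^ n) v = (fst v, inverse q ^ n * snd v)" for n v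
    by (induction n) (simp_all add: op_def)
  have "N = Suc (Suc (N - 2))" using N_gt_1 by simp
  then obtain n where n: "N = Suc (Suc n)" by blast
  have nil: "(op GB ^^ N) v = 0" "(op GC ^^ N) v = 0" for v
    by (simp_all add: n op_def zero_prod_def)
  have R: "\<forall>p\<in>Oq_SL2_relators q N. free_rep.ev sv op p v = 0" for v
    unfolding ev_Oq_relators[OF rep] nil pow using q_nz q_pow_N
    by (cases v) (simp add: op_def sv_def power_inverse flip: mult.assoc)
  have R': "free_rep.ev sv op p v = 0" if "p \<in> Oq_SL2_relators q N" for p v
    by (rule bspec[OF R that])
  obtain \<rho> where \<rho>: "\<And>g v. \<rho> (?x g) v = op g v" "\<And>v. \<rho> 1 v = v"
      "\<And>h h' v. \<rho> (h * h') v = \<rho> h (\<rho> h' v)" "\<And>h h' v. \<rho> (h + h') v = \<rho> h v + \<rho> h' v"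
      "\<And>r h v. \<rho> (r \<cdot> h) v = sv r (\<rho> h v)"
      "\<And>h u v. \<rho> h (u + v) = \<rho> h u + \<rho> h v" "\<And>h r v. \<rho> h (sv r v) = sv r (\<rho> h v)"
    by (rule H.presented_by_rep[OF presentation rep R'], assumption, rule that)
  have \<rho>_gen: "\<rho> a v = op GA v" "\<rho> b v = op GB v" "\<rho> c v = op GC v" "\<rho> d v = op GD v" for v
    using \<rho>(1)[of GA] \<rho>(1)[of GB] \<rho>(1)[of GC] \<rho>(1)[of GD] by simp_all
  define S where "S = {h. \<rho> h (1, 0) = (counit h, 0)}"
  have "H.subalgebra S"
    unfolding H.subalgebra_def
  proof (intro conjI ballI)
    show "H.subspace S"
    proof (rule H.subspaceI)
      show "0 \<in> S"
        using \<rho>(5)[of 0 0 "(1, 0)"] counit_hom(2)[of 0 0] by (simp add: S_def sv_def)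
    qed (auto simp: S_def \<rho> counit_hom sv_def)
    fix h h' assume h: "h \<in> S" "h' \<in> S"
    have "\<rho> h (\<rho> h' (1, 0)) = \<rho> h (sv (counit h') (1, 0))" using h by (simp add: S_def sv_def)
    also have "\<dots> = sv (counit h') (counit h, 0)" using h by (simp only: \<rho>(7)) (simp add: S_def)
    finally show "h * h' \<in> S" by (simp add: S_def \<rho>(3) counit_mult sv_def)
  qed (simp add: S_def \<rho> counit_one)
  moreover have "{a, b, c, d} \<subseteq> S"
    by (simp add: S_def \<rho>_gen op_def counit_gens)
  ultimately have S: "\<rho> h (1, 0) = (counit h, 0)" for h
    using generates[of S] by (auto simp: S_def)
  define f where "f h = fst (\<rho> h (0, 1))" for h
  define \<chi> where "\<chi> h = snd (\<rho> h (0, 1))" for h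
  have f\<chi>: "\<rho> h (0, 1) = (f h, \<chi> h)" for h by (simp add: f_def \<chi>_def)
  have mult: "\<rho> (h * h') (0, 1) = (counit h * f h' + f h * \<chi> h', \<chi> h * \<chi> h')" for h h'
  proof -
    have "(f h', \<chi> h') = sv (f h') (1, 0) + sv (\<chi> h') (0, 1)" by (simp add: sv_def)
    hence "\<rho> (h * h') (0, 1) = \<rho> h (sv (f h') (1, 0) + sv (\<chi> h') (0, 1))"
      by (simp only: \<rho>(3) f\<chi>[of h'])
    also have "\<dots> = sv (f h') (\<rho> h (1, 0)) + sv (\<chi> h') (\<rho> h (0, 1))"
      by (simp only: \<rho>(6,7))
    finally show ?thesis by (simp add: S f\<chi> sv_def mult.commute)
  qed
  show thesis
  proof (rule that)
    show "f (u + v) = f u + f v" "\<chi> (u + v) = \<chi> u + \<chi> v" "f (r \<cdot> u) = r * f u" "\<chi> (r \<cdot> u) = r * \<chi> u" for u v r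
      by (simp_all add: f_def \<chi>_def \<rho> sv_def)
    show "f (u * v) = counit u * f v + f u * \<chi> v" "\<chi> (u * v) = \<chi> u * \<chi> v" for u v
      using mult[of u v] by (simp_all add: f\<chi>)
  qed (simp_all add: f_def \<chi>_def \<rho>(2) \<rho>_gen op_def)
qed

text \<open>The map \<open>id \<otimes> f\<close> followed by the identification of
  \<open>H \<otimes> k\<close> with \<open>H\<close>, so that \<open>hit f (comult h)\<close> is the
  left hit action of \<open>f\<close> on \<open>h\<close>.\<close>

definition hit :: "('h \<Rightarrow> 'k) \<Rightarrow> 't \<Rightarrow> 'h" where
  "hit f = (SOME G. (\<forall>x y. G (x \<otimes> y) = f y \<cdot> x) \<and> (\<forall>s t. G (s + t) = G s + G t) \<and>
     (\<forall>r t. G (tscale r t) = r \<cdot> G t))"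

definition functional :: "('h \<Rightarrow> 'k) \<Rightarrow> bool" where
  "functional f \<longleftrightarrow> (\<forall>u v. f (u + v) = f u + f v) \<and> (\<forall>r u. f (r \<cdot> u) = r * f u)"

lemma hit:
  assumes "functional f"
  shows hit_tensor: "hit f (x \<otimes> y) = f y \<cdot> x" and hit_add: "hit f (s + t) = hit f s + hit f t"
    and hit_scale: "hit f (tscale r t) = r \<cdot> hit f t"
proof -
  let ?P = "\<lambda>G. (\<forall>x y. G (x \<otimes> y) = f y \<cdot> x) \<and> (\<forall>s t. G (s + t) = G s + G t) \<and>
     (\<forall>r t. G (tscale r t) = r \<cdot> G t)"
  have "\<exists>G. ?P G"
  proof (rule tensor_lift[where \<beta> = "\<lambda>x y. f y \<cdot> x" and sz = scale])
    show "vector_space scale" by unfold_locales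
    fix G assume "\<And>x y. G (x \<otimes> y) = f y \<cdot> x" "\<And>s t. G (s + t) = G s + G t"
      "\<And>r t. G (tscale r t) = r \<cdot> G t"
    thus "\<exists>G. ?P G" by (intro exI[of _ G] conjI allI)
  qed (use assms in \<open>simp_all add: functional_def H.scale_right_distrib H.scale_left_distrib mult.commute\<close>)
  hence "?P (hit f)" unfolding hit_def by (rule someI_ex)
  thus "hit f (x \<otimes> y) = f y \<cdot> x" "hit f (s + t) = hit f s + hit f t" "hit f (tscale r t) = r \<cdot> hit f t"
    by blast+
qed

lemma hit_zero: "functional f \<Longrightarrow> hit f 0 = 0"
  using hit_scale[of f 0 0] by simp

lemma functional_counit: "functional counit"
  by (simp add: functional_def counit_hom)

lemma hit_counit: "hit counit (comult h) = h"
proof -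
  obtain us where us: "sweedler h us" using sweedler_exists by blast
  have "hit counit (comult h) = (\<Sum>(u, v)\<leftarrow>us. counit v \<cdot> u)"
    by (rule lift_comult[OF us]) (simp_all add: hit[OF functional_counit] hit_zero[OF functional_counit])
  thus ?thesis using counit_right[OF us] by simp
qed

text \<open>With \<open>e = counit\<close> and coproducts inserted,
  \<open>hit counit (comult u)\<close> is \<open>u\<close> itself, which gives the skew derivation
  rules of \<open>E\<close> and \<open>F\<close>.\<close>

lemma hit_skew:
  assumes f: "functional f" and e: "functional e" and \<chi>: "functional \<chi>"
    and skew: "\<And>u v. f (u * v) = e u * f v + f u * \<chi> v"
  shows "hit f (s * t) = hit e s * hit f t + hit f s * hit \<chi> t"
proof (induction s rule: tensor_induct)
  case (tensor x y)
  show ?case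
  proof (induction t rule: tensor_induct)
    case (tensor x' y')
    show ?case
      by (simp add: tensor_mult hit[OF f] hit[OF e] hit[OF \<chi>] skew H.scale_left_distrib
          H.scale_mult_left H.scale_mult_right mult.commute)
  qed (simp_all add: distrib_left hit[OF f] hit[OF \<chi>] T.scale_mult_right H.scale_mult_right
      H.scale_right_distrib)
qed (simp_all add: distrib_right hit[OF f] hit[OF e] T.scale_mult_left H.scale_mult_left
      H.scale_right_distrib)

lemma hit_mult:
  assumes \<chi>: "functional \<chi>" and mult: "\<And>u v. \<chi> (u * v) = \<chi> u * \<chi> v"
  shows "hit \<chi> (s * t) = hit \<chi> s * hit \<chi> t"
proof -
  have z: "functional (\<lambda>_. 0)" by (simp add: functional_def)
  have "hit (\<lambda>_. 0) u = 0" for u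
    by (induction u rule: tensor_induct) (simp_all add: hit[OF z])
  thus ?thesis using hit_skew[of \<chi> "\<lambda>_. 0" \<chi> s t] \<chi> z mult by simp
qed

lemma hit_mem:
  assumes "H.subspace A" "t \<in> T.span {x \<otimes> h | x h. x \<in> A}" "functional f"
  shows "hit f t \<in> A"
  using assms(2)
proof (induction rule: T.span_induct_alt)
  case base
  show ?case using assms by (simp add: hit_zero H.subspace_0)
next
  case (step r m t)
  thus ?case using assms(1) by (auto simp: hit[OF assms(3)] intro!: H.subspace_add H.subspace_scale)
qed

lemma operators:
  obtains \<chi> e f where "functional \<chi>" "functional e" "functional f"
    "restricted_SL2 scale q N a b c d (\<lambda>h. hit \<chi> (comult h)) (\<lambda>h. hit e (comult h)) (\<lambda>h. hit f (comult h))"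
proof -
  obtain f \<chi> where f: "\<And>u v. f (u + v) = f u + f v" "\<And>r u. f (r \<cdot> u) = r * f u"
    "\<And>u v. \<chi> (u + v) = \<chi> u + \<chi> v" "\<And>r u. \<chi> (r \<cdot> u) = r * \<chi> u"
    "\<And>u v. f (u * v) = counit u * f v + f u * \<chi> v" "\<And>u v. \<chi> (u * v) = \<chi> u * \<chi> v" "\<chi> 1 = 1"
    "f a = 0" "f b = 1" "f c = 0" "f d = 0" "\<chi> a = q" "\<chi> b = 0" "\<chi> c = 0" "\<chi> d = inverse q"
    by (rule skew_functional[of 1 0]) (rule that)
  obtain e \<chi>' where e: "\<And>u v. e (u + v) = e u + e v" "\<And>r u. e (r \<cdot> u) = r * e u"
    "\<And>u v. \<chi>' (u + v) = \<chi>' u + \<chi>' v" "\<And>r u. \<chi>' (r \<cdot> u) = r * \<chi>' u"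
    "\<And>u v. e (u * v) = counit u * e v + e u * \<chi>' v" "\<And>u v. \<chi>' (u * v) = \<chi>' u * \<chi>' v" "\<chi>' 1 = 1"
    "e a = 0" "e b = 0" "e c = 1" "e d = 0" "\<chi>' a = q" "\<chi>' b = 0" "\<chi>' c = 0" "\<chi>' d = inverse q"
    by (rule skew_functional[of 0 1]) (rule that)
  \<comment> \<open>The representations for \<open>e\<close> and \<open>f\<close> come with separate
    diagonal characters. Both are multiplicative and agree on the generators, so one operator
    \<open>K\<close> serves \<open>E\<close> and \<open>F\<close>.\<close>
  have "H.subalgebra {h. \<chi>' h = \<chi> h}"
    unfolding H.subalgebra_def
  proof (intro conjI ballI)
    show "H.subspace {h. \<chi>' h = \<chi> h}"
    proof (rule H.subspaceI)
      show "0 \<in> {h. \<chi>' h = \<chi> h}" using f(4)[of 0 0] e(4)[of 0 0] by simp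
    qed (simp_all add: e f)
  qed (simp_all add: e f)
  hence "{h. \<chi>' h = \<chi> h} = UNIV" by (rule generates) (simp add: e f)
  hence \<chi>': "\<chi>' = \<chi>" by auto
  have fn: "functional f" "functional e" "functional \<chi>"
    by (simp_all add: functional_def f e)
  note hits = hit[OF fn(1)] hit[OF fn(2)] hit[OF fn(3)]
  have "restricted_SL2 scale q N a b c d (\<lambda>h. hit \<chi> (comult h)) (\<lambda>h. hit e (comult h)) (\<lambda>h. hit f (comult h))"
  proof unfold_locales
    show "S = UNIV" if "H.subalgebra S" "{a, b, c, d} \<subseteq> S" for S using that by (rule generates)
    show "hit \<chi> (comult 1) = 1" using hits(7)[of 1 1] by (simp add: comult_one tensor_one f)
    show "hit \<chi> (comult (u * v)) = hit \<chi> (comult u) * hit \<chi> (comult v)" for u v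
      unfolding comult_mult by (rule hit_mult[OF fn(3) f(6)])
    show "hit e (comult (u * v)) = u * hit e (comult v) + hit e (comult u) * hit \<chi> (comult v)" for u v
      unfolding comult_mult using hit_skew[OF fn(2) functional_counit fn(3) e(5)[unfolded \<chi>']]
      by (simp add: hit_counit)
    show "hit f (comult (u * v)) = u * hit f (comult v) + hit f (comult u) * hit \<chi> (comult v)" for u v
      unfolding comult_mult using hit_skew[OF fn(1) functional_counit fn(3) f(5)]
      by (simp add: hit_counit)
  qed (use N_gt_1 odd_N prim relations in
      \<open>simp_all add: comult_hom comult_a comult_b comult_c comult_d hits e f\<close>)
  thus thesis using that fn by blast
qed

section \<open>The antipode and the adjoint action\<close>

lemma antipode_one: "antipode 1 = 1"
  using antipode_left[OF sweedler_gens(5)] by (simp add: counit_one)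

text \<open>The row \<open>(u, v)\<close> times the matrix of generators is \<open>(r, 0)\<close>;
  it is multiplied from the right by the inverse matrix with rows \<open>(d, - q b)\<close> and
  \<open>(- q^-1 c, a)\<close>.\<close>

lemma matrix_inverse:
  assumes "u * a + v * c = r \<cdot> 1" "u * b + v * d = 0"
  shows "u = r \<cdot> d" "v = - (r * q) \<cdot> b"
proof -
  note rel = relations
  have "u = u * (a * d - inverse q \<cdot> (b * c)) + v * (c * d - inverse q \<cdot> (d * c))"
    using q_nz by (simp add: rel)
  also have "\<dots> = (u * a + v * c) * d - inverse q \<cdot> ((u * b + v * d) * c)"
    by (simp add: algebra_simps H.scale_mult_right H.scale_mult_left H.scale_right_distrib)
  finally show "u = r \<cdot> d" unfolding assms by (simp add: H.scale_mult_left)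
  have "v = u * (b * a - q \<cdot> (a * b)) + v * (d * a - q \<cdot> (c * b))"
    by (simp add: rel)
  also have "\<dots> = (u * b + v * d) * a - q \<cdot> ((u * a + v * c) * b)"
    by (simp add: algebra_simps H.scale_mult_right H.scale_mult_left H.scale_right_distrib)
  finally show "v = - (r * q) \<cdot> b" unfolding assms by (simp add: H.scale_mult_left mult.commute)
qed

lemma matrix_inverse':
  assumes "u * a + v * c = 0" "u * b + v * d = r \<cdot> 1"
  shows "u = - (r * inverse q) \<cdot> c" "v = r \<cdot> a"
proof -
  note rel = relations
  have "u = u * (a * d - inverse q \<cdot> (b * c)) + v * (c * d - inverse q \<cdot> (d * c))"
    using q_nz by (simp add: rel)
  also have "\<dots> = (u * a + v * c) * d - inverse q \<cdot> ((u * b + v * d) * c)"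
    by (simp add: algebra_simps H.scale_mult_right H.scale_mult_left H.scale_right_distrib)
  finally show "u = - (r * inverse q) \<cdot> c" unfolding assms by (simp add: H.scale_mult_left mult.commute)
  have "v = u * (b * a - q \<cdot> (a * b)) + v * (d * a - q \<cdot> (c * b))"
    by (simp add: rel)
  also have "\<dots> = (u * b + v * d) * a - q \<cdot> ((u * a + v * c) * b)"
    by (simp add: algebra_simps H.scale_mult_right H.scale_mult_left H.scale_right_distrib)
  finally show "v = r \<cdot> a" unfolding assms by (simp add: H.scale_mult_left)
qed

lemma antipode_gens: "antipode a = d" "antipode b = - q \<cdot> b" "antipode c = - inverse q \<cdot> c" "antipode d = a"
  using matrix_inverse[of "antipode a" "antipode b" 1] matrix_inverse'[of "antipode c" "antipode d" 1]
    antipode_left[OF sweedler_gens(1)] antipode_left[OF sweedler_gens(2)]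
    antipode_left[OF sweedler_gens(3)] antipode_left[OF sweedler_gens(4)]
  by (simp_all add: counit_gens)

text \<open>
  The antipode equations for \<open>h t\<^sub>i\<^sub>j\<close>, solved as a linear system, give \<open>S(h\<^sub>(\<^sub>1\<^sub>) g) h\<^sub>(\<^sub>2\<^sub>) = \<epsilon>(h) S(g)\<close>; multiplying
  by \<open>S(h\<^sub>(\<^sub>3\<^sub>))\<close> and using coassociativity yields the claim.
\<close>
lemma antipode_mult_gen:
  assumes g: "g \<in> {a, b, c, d}"
  shows "antipode (h * g) = antipode g * antipode h"
proof -
  have vs: "vector_space scale" by unfold_locales
  have "\<exists>Q. (\<forall>x y. Q (x \<otimes> y) = antipode (x * g) * y) \<and> (\<forall>s t. Q (s + t) = Q s + Q t) \<and>
      (\<forall>r t. Q (tscale r t) = r \<cdot> Q t)" for g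
  proof (rule tensor_lift[where \<beta> = "\<lambda>x y. antipode (x * g) * y" and sz = scale, OF vs])
    fix G assume "\<And>x y. G (x \<otimes> y) = antipode (x * g) * y" "\<And>s t. G (s + t) = G s + G t"
      "\<And>r t. G (tscale r t) = r \<cdot> G t"
    thus "\<exists>Q. (\<forall>x y. Q (x \<otimes> y) = antipode (x * g) * y) \<and> (\<forall>s t. Q (s + t) = Q s + Q t) \<and>
      (\<forall>r t. Q (tscale r t) = r \<cdot> Q t)" by (intro exI[of _ G] conjI allI)
  qed (simp_all add: distrib_left distrib_right antipode_hom H.scale_mult_left H.scale_mult_right)
  then obtain Q where Q: "\<And>g x y. Q g (x \<otimes> y) = antipode (x * g) * y"
      "\<And>g s t. Q g (s + t) = Q g s + Q g t" "\<And>g r t. Q g (tscale r t) = r \<cdot> Q g t"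
    by metis
  have Q0: "Q g 0 = 0" for g using Q(3)[of g 0 0] by simp
  have unit: "Q 1 (comult h) = counit h \<cdot> 1" for h
  proof -
    obtain us where us: "sweedler h us" using sweedler_exists by blast
    have "Q 1 (comult h) = (\<Sum>(u, v)\<leftarrow>us. antipode u * v)"
      by (rule lift_comult[OF us]) (simp_all add: Q Q0)
    thus ?thesis using antipode_left[OF us] by simp
  qed
  have Q_mult: "Q 1 (t * (x \<otimes> y + x' \<otimes> y')) = Q x t * y + Q x' t * y'" for t x y x' y'
  proof (induction t rule: tensor_induct)
    case (tensor u v)
    show ?case by (simp add: distrib_left tensor_mult Q mult.assoc)
  next
    case (add s t)
    thus ?case by (simp add: distrib_right Q algebra_simps)
  next
    case (scale r t)
    thus ?case by (simp add: T.scale_mult_left Q H.scale_mult_left flip: H.scale_right_distrib)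
  qed
  have Qg: "Q g (comult h) = counit h \<cdot> antipode g" for h
  proof -
    have "Q a (comult h) * a + Q b (comult h) * c = counit h \<cdot> 1"
      "Q a (comult h) * b + Q b (comult h) * d = 0"
      "Q c (comult h) * a + Q d (comult h) * c = 0"
      "Q c (comult h) * b + Q d (comult h) * d = counit h \<cdot> 1"
      using unit[of "h * a"] unit[of "h * b"] unit[of "h * c"] unit[of "h * d"]
      by (simp_all add: comult_mult comult_a comult_b comult_c comult_d Q_mult counit_mult counit_gens)
    from matrix_inverse[OF this(1,2)] matrix_inverse'[OF this(3,4)] show ?thesis
      using g by (auto simp: antipode_gens)
  qed
  obtain r where r: "\<And>x. sweedler x (r x)" using sweedler_exists by metis
  let ?l = "lin_ext scale (\<lambda>(t, w). Q g t * antipode w)"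
  have "?l ((\<Sum>(u, v)\<leftarrow>r h. Poly_Mapping.single (comult u, v) 1)
         - (\<Sum>(u, v)\<leftarrow>r h. \<Sum>(v', v'')\<leftarrow>r v. Poly_Mapping.single (u \<otimes> v', v'') 1)) = 0"
    by (rule tensor_null_zero[where \<beta> = "\<lambda>t w. Q g t * antipode w" and sV = tscale and sW = scale
          and sz = scale, OF vs _ _ _ _ coassoc[OF r]])
      (simp_all add: Q antipode_hom distrib_left distrib_right H.scale_mult_left H.scale_mult_right)
  hence eq: "(\<Sum>(u, v)\<leftarrow>r h. Q g (comult u) * antipode v) =
      (\<Sum>(u, v)\<leftarrow>r h. \<Sum>(v', v'')\<leftarrow>r v. Q g (u \<otimes> v') * antipode v'')"
    by (simp add: H.lin_ext.diff H.lin_ext_sum_list split_def)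
  have lhs: "(\<Sum>(u, v)\<leftarrow>us. Q g (comult u) * antipode v) =
      antipode g * antipode (\<Sum>(u, v)\<leftarrow>us. counit u \<cdot> v)" for us
  proof (induction us)
    case Nil
    show ?case using antipode_hom(2)[of 0 0] by simp
  qed (auto simp: Qg antipode_hom distrib_left H.scale_mult_left H.scale_mult_right)
  have inner: "(\<Sum>(v', v'')\<leftarrow>vs. Q g (u \<otimes> v') * antipode v'') =
      antipode (u * g) * (\<Sum>(v', v'')\<leftarrow>vs. v' * antipode v'')" for u vs
    by (induction vs) (auto simp: Q distrib_left mult.assoc)
  have rhs: "(\<Sum>(u, v)\<leftarrow>us. \<Sum>(v', v'')\<leftarrow>r v. Q g (u \<otimes> v') * antipode v'') =
      antipode ((\<Sum>(u, v)\<leftarrow>us. counit v \<cdot> u) * g)" for us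
  proof (induction us)
    case Nil
    show ?case using antipode_hom(2)[of 0 0] by simp
  next
    case (Cons p us)
    obtain u v where p: "p = (u, v)" by (cases p)
    show ?case
      using Cons by (simp add: p inner antipode_right[OF r] antipode_hom distrib_right
          H.scale_mult_left H.scale_mult_right)
  qed
  show ?thesis
    using eq unfolding lhs rhs counit_left[OF r] counit_right[OF r] by simp
qed

text \<open>Because the antipode reverses products with generators, the adjoint action of
  \<open>h * g\<close> is that of \<open>h\<close> followed by that of \<open>g\<close>. Stability
  under the generators therefore passes to all of the Hopf algebra.\<close>

lemma normal_of_ad_stable:
  assumes R: "restricted_SL2 scale q N a b c d K E F" and A: "H.subalgebra A"
    and ad: "restricted_SL2.ad_stable scale q a b c d A"
    and x: "x \<in> A" and us: "sweedler h us"
  shows "(\<Sum>(u, v)\<leftarrow>us. antipode u * x * v) \<in> A"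
proof -
  interpret R: restricted_SL2 scale q N a b c d K E F by (rule R)
  have vs: "vector_space scale" by unfold_locales
  have "\<exists>G. (\<forall>u v. G (u \<otimes> v) = antipode u * x * v) \<and> (\<forall>s t. G (s + t) = G s + G t) \<and>
      (\<forall>r t. G (tscale r t) = r \<cdot> G t)" for x
  proof (rule tensor_lift[where \<beta> = "\<lambda>u v. antipode u * x * v" and sz = scale, OF vs])
    fix G assume "\<And>u v. G (u \<otimes> v) = antipode u * x * v" "\<And>s t. G (s + t) = G s + G t"
      "\<And>r t. G (tscale r t) = r \<cdot> G t"
    thus "\<exists>G. (\<forall>u v. G (u \<otimes> v) = antipode u * x * v) \<and> (\<forall>s t. G (s + t) = G s + G t) \<and>
      (\<forall>r t. G (tscale r t) = r \<cdot> G t)" by (intro exI[of _ G] conjI allI)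
  qed (simp_all add: distrib_left distrib_right antipode_hom H.scale_mult_left H.scale_mult_right)
  then obtain G where G: "\<And>x u v. G x (u \<otimes> v) = antipode u * x * v"
      "\<And>x s t. G x (s + t) = G x s + G x t" "\<And>x r t. G x (tscale r t) = r \<cdot> G x t"
    by metis
  have G0: "G x 0 = 0" for x using G(3)[of x 0 0] by simp
  have G_mult: "G x (t * (u \<otimes> v + u' \<otimes> v')) = antipode u * G x t * v + antipode u' * G x t * v'"
    if "u \<in> {a, b, c, d}" "u' \<in> {a, b, c, d}" for x t u v u' v'
  proof (induction t rule: tensor_induct)
    case (tensor y z)
    show ?case
      by (simp add: distrib_left tensor_mult G antipode_mult_gen[OF that(1)] antipode_mult_gen[OF that(2)] mult.assoc)
  next
    case (add s t)
    thus ?case by (simp add: distrib_left distrib_right G algebra_simps)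
  next
    case (scale r t)
    thus ?case
      by (simp add: T.scale_mult_left G H.scale_mult_left H.scale_mult_right flip: H.scale_right_distrib)
  qed
  have G_gen: "G x (t * comult a) = R.ad_a (G x t)" "G x (t * comult b) = R.ad_b (G x t)"
    "G x (t * comult c) = R.ad_c (G x t)" "G x (t * comult d) = R.ad_d (G x t)" for x t
    unfolding comult_a comult_b comult_c comult_d
    by (simp_all add: G_mult antipode_gens R.ad_a_def R.ad_b_def R.ad_c_def R.ad_d_def
        H.scale_mult_left)
  \<comment> \<open>Quantifying over all tensors \<open>t\<close>, not just \<open>t = 1\<close>,
    makes \<open>S\<close> closed under products: \<open>t * comult g\<close> takes the place of
    \<open>t\<close> for the second factor.\<close>
  define S where "S = {g. \<forall>t. (\<forall>x\<in>A. G x t \<in> A) \<longrightarrow> (\<forall>x\<in>A. G x (t * comult g) \<in> A)}"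
  have "H.subalgebra S"
    unfolding H.subalgebra_def
  proof (intro conjI ballI)
    show "H.subspace S"
    proof (rule H.subspaceI)
      have "comult 0 = 0" using comult_hom(2)[of 0 0] by simp
      thus "0 \<in> S" using H.subspace_0[OF H.subalgebra_subspace[OF A]] by (simp add: S_def G0)
    qed (auto simp: S_def comult_hom distrib_left T.scale_mult_right G
        intro: H.subalgebra_add[OF A] H.subalgebra_scale[OF A])
  qed (auto simp: S_def comult_one comult_mult mult.assoc[symmetric])
  moreover have "{a, b, c, d} \<subseteq> S"
    using ad unfolding R.ad_stable_def S_def by (auto simp: G_gen)
  ultimately have "S = UNIV" by (rule generates)
  hence "h \<in> S" by simp
  moreover have "\<forall>x\<in>A. G x 1 \<in> A"
    using G(1)[of _ 1 1] by (simp add: tensor_one antipode_one)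
  ultimately have "G x (1 * comult h) \<in> A" using x unfolding S_def by blast
  moreover have "G x (comult h) = (\<Sum>(u, v)\<leftarrow>us. antipode u * x * v)"
    by (rule lift_comult[OF us]) (simp_all add: G G0)
  ultimately show ?thesis by simp
qed

lemma stable_of_normal:
  assumes fn: "functional \<chi>" "functional e" "functional f"
    and R: "restricted_SL2 scale q N a b c d (\<lambda>h. hit \<chi> (comult h)) (\<lambda>h. hit e (comult h)) (\<lambda>h. hit f (comult h))"
    and A: "normal_right_coideal_subalgebra A"
  shows "restricted_SL2.stable scale q a b c d (\<lambda>h. hit \<chi> (comult h)) (\<lambda>h. hit e (comult h))
    (\<lambda>h. hit f (comult h)) A"
proof -
  interpret R: restricted_SL2 scale q N a b c d "\<lambda>h. hit \<chi> (comult h)" "\<lambda>h. hit e (comult h)"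
    "\<lambda>h. hit f (comult h)" by (rule R)
  have sub: "H.subalgebra A" and co: "comult ` A \<subseteq> T.span {x \<otimes> h | x h. x \<in> A}"
    and norm: "\<And>x h us. x \<in> A \<Longrightarrow> sweedler h us \<Longrightarrow> (\<Sum>(u, v)\<leftarrow>us. antipode u * x * v) \<in> A"
    using A unfolding normal_right_coideal_subalgebra_def right_coideal_subalgebra_def by blast+
  have "hit g (comult u) \<in> A" if "u \<in> A" "functional g" for u g
    using co that by (intro hit_mem[OF H.subalgebra_subspace[OF sub]]) auto
  moreover have "R.ad_a u \<in> A" "R.ad_b u \<in> A" "R.ad_c u \<in> A" "R.ad_d u \<in> A" if "u \<in> A" for u
    using norm[OF that sweedler_gens(1)] norm[OF that sweedler_gens(2)]
      norm[OF that sweedler_gens(3)] norm[OF that sweedler_gens(4)]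
    by (simp_all add: antipode_gens R.ad_a_def R.ad_b_def R.ad_c_def R.ad_d_def H.scale_mult_left)
  ultimately show ?thesis using fn sub by (simp add: R.stable_def)
qed

theorem nontrivial_normal_iff:
  "nontrivial_normal_right_coideal_subalgebra A \<longleftrightarrow>
     A = H.generated {a ^ (N - 1) * b} \<or> A = H.generated {c * d ^ (N - 1)} \<or>
     (\<exists>r. A = H.generated {a ^ (N div r), a ^ (N - 1) * b, a * c} \<and> 0 < r \<and> r dvd N \<and> r < N)"
  and generated_eq: "r dvd N \<Longrightarrow> H.generated {a ^ (N div r), a ^ (N - 1) * b, a * c} =
     H.generated {d ^ (N div r), b * d, c * d ^ (N - 1)}"
proof -
  obtain \<chi> e f where fn: "functional \<chi>" "functional e" "functional f"
    and R: "restricted_SL2 scale q N a b c d (\<lambda>h. hit \<chi> (comult h)) (\<lambda>h. hit e (comult h)) (\<lambda>h. hit f (comult h))"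
    by (rule operators)
  interpret C: restricted_SL2_comult scale tscale tensor comult q N a b c d
    "\<lambda>h. hit \<chi> (comult h)" "\<lambda>h. hit e (comult h)" "\<lambda>h. hit f (comult h)"
    using R by (intro restricted_SL2_comult.intro restricted_SL2_comult_axioms.intro comult_algebra_axioms)
      (simp_all add: comult_hom comult_mult comult_one comult_a comult_b comult_c comult_d)
  interpret m: restricted_SL2_comult scale tscale tensor comult "inverse q" N d c b a
    "\<lambda>h. hit \<chi> (comult h)" "\<lambda>h. hit f (comult h)" "\<lambda>h. hit e (comult h)"
    by (rule C.mirror_comult)
  have dvd: "N div r dvd N" if "r dvd N" for r using that by auto
  show "r dvd N \<Longrightarrow> H.generated {a ^ (N div r), a ^ (N - 1) * b, a * c} =
      H.generated {d ^ (N div r), b * d, c * d ^ (N - 1)}"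
    by (simp only: C.R.generated_eq_B[OF dvd] C.R.generated_eq_B'[OF dvd])
  have X: "H.generated {a ^ (N - 1) * b} = C.R.X"
    by (simp only: C.R.x_eq C.R.generated_x)
  have mX: "H.generated {c * d ^ (N - 1)} = m.R.X"
    by (simp only: C.R.generated_y m.R.x_eq m.R.generated_x)
  have nontrivial: "nontrivial_normal_right_coideal_subalgebra A"
    if "H.subalgebra A" "comult ` A \<subseteq> T.span {x \<otimes> h | x h. x \<in> A}" "C.R.ad_stable A"
      "A \<noteq> H.scalars" "A \<noteq> UNIV" for A
    using that normal_of_ad_stable[OF R that(1,3)]
    unfolding nontrivial_normal_right_coideal_subalgebra_def normal_right_coideal_subalgebra_def
      right_coideal_subalgebra_def by blast
  show "nontrivial_normal_right_coideal_subalgebra A \<longleftrightarrow>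
     A = H.generated {a ^ (N - 1) * b} \<or> A = H.generated {c * d ^ (N - 1)} \<or>
     (\<exists>r. A = H.generated {a ^ (N div r), a ^ (N - 1) * b, a * c} \<and> 0 < r \<and> r dvd N \<and> r < N)"
  proof
    assume A: "nontrivial_normal_right_coideal_subalgebra A"
    hence "C.R.stable A"
      using stable_of_normal[OF fn R] unfolding nontrivial_normal_right_coideal_subalgebra_def by blast
    from C.R.stable_classification[OF this] A
    consider "A = H.generated {a ^ (N - 1) * b}" | "A = H.generated {c * d ^ (N - 1)}"
      | m where "0 < m" "m dvd N" "A = C.R.B m"
      unfolding nontrivial_normal_right_coideal_subalgebra_def by blast
    thus "A = H.generated {a ^ (N - 1) * b} \<or> A = H.generated {c * d ^ (N - 1)} \<or>
      (\<exists>r. A = H.generated {a ^ (N div r), a ^ (N - 1) * b, a * c} \<and> 0 < r \<and> r dvd N \<and> r < N)"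
    proof cases
      case (3 m)
      \<comment> \<open>The case \<open>m = 1\<close> is the whole algebra and corresponds to the
        excluded \<open>r = N\<close>; \<open>m = N\<close> gives \<open>r = 1\<close>, the smallest
        member of the family.\<close>
      define r where "r = N div m"
      have N: "N = r * m" using 3 by (simp add: r_def)
      have "m \<noteq> 1"
        using A 3(3) C.R.B_1 unfolding nontrivial_normal_right_coideal_subalgebra_def by auto
      hence "1 < m" using 3(1) by simp
      moreover have "0 < r" using N N_gt_1 by (cases r) auto
      ultimately have "r < N" "N div r = m" using N by auto
      moreover from this have "A = H.generated {a ^ (N div r), a ^ (N - 1) * b, a * c}"
        using C.R.generated_eq_B[OF 3(2)] 3(3) by simp
      moreover have "r dvd N" using N by simp
      ultimately show ?thesis using \<open>0 < r\<close> by (intro disjI2 exI[of _ r] conjI)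
    qed simp_all
  next
    assume "A = H.generated {a ^ (N - 1) * b} \<or> A = H.generated {c * d ^ (N - 1)} \<or>
      (\<exists>r. A = H.generated {a ^ (N div r), a ^ (N - 1) * b, a * c} \<and> 0 < r \<and> r dvd N \<and> r < N)"
    then consider "A = C.R.X" | "A = m.R.X"
      | r where "A = H.generated {a ^ (N div r), a ^ (N - 1) * b, a * c}" "0 < r" "r dvd N" "r < N"
      unfolding X mX by blast
    thus "nontrivial_normal_right_coideal_subalgebra A"
    proof cases
      case 1
      show ?thesis
        unfolding 1 using C.R.subalgebra_X C.coideal_X C.R.ad_stable_X C.R.X_not_scalars C.R.X_not_UNIV
        by (rule nontrivial)
    next
      case 2
      have "C.R.ad_stable m.R.X" using m.R.ad_stable_X by (simp only: C.R.ad_stable_mirror)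
      with m.R.subalgebra_X m.coideal_X show ?thesis
        unfolding 2 using m.R.X_not_scalars m.R.X_not_UNIV by (rule nontrivial)
    next
      case (3 r)
      have "N div r \<noteq> 1" using 3 by auto
      hence "C.R.B (N div r) \<noteq> UNIV" using C.R.B_eq_UNIV[OF dvd[OF 3(3)]] by blast
      with C.R.subalgebra_B C.coideal_B[OF dvd[OF 3(3)]] C.R.ad_stable_B[OF dvd[OF 3(3)]]
        C.R.B_not_scalars show ?thesis
        unfolding 3(1) C.R.generated_eq_B[OF dvd[OF 3(3)]] by (rule nontrivial)
    qed
  qed
qed

end

theorem proposition6p3:
  fixes scale :: "'k::{alg_closed_field, field_char_0} \<Rightarrow> 'h::ring_1 \<Rightarrow> 'h"
    and tscale :: "'k \<Rightarrow> 't::ring_1 \<Rightarrow> 't"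
    and tensor :: "'h \<Rightarrow> 'h \<Rightarrow> 't"
    and comult :: "'h \<Rightarrow> 't"
    and counit :: "'h \<Rightarrow> 'k"
    and antipode :: "'h \<Rightarrow> 'h"
    and q :: 'k
    and N :: nat
    and a b c d :: 'h
  assumes "N > 1" and "odd N" and "primitive_root_of_unity N q"
    and "Oq_SL2 scale tscale tensor comult counit antipode q N a b c d"
  shows "{A. hopf_algebra.nontrivial_normal_right_coideal_subalgebra
               scale tscale tensor comult antipode A} =
           {k_algebra.generated scale {a ^ (N - 1) * b},
            k_algebra.generated scale {c * d ^ (N - 1)}} \<union>
           {k_algebra.generated scale {a ^ (N div r), a ^ (N - 1) * b, a * c} | r.
              0 < r \<and> r dvd N \<and> r < N} \<and>
         (\<forall>r. 0 < r \<and> r dvd N \<and> r < N \<longrightarrow>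
            k_algebra.generated scale {a ^ (N div r), a ^ (N - 1) * b, a * c} =
            k_algebra.generated scale {d ^ (N div r), b * d, c * d ^ (N - 1)})"
proof -
  interpret Oq_SL2_root scale tscale tensor comult counit antipode q N a b c d
    using assms by (intro Oq_SL2_root.intro Oq_SL2_root_axioms.intro)
  show ?thesis
    using generated_eq by (auto simp only: nontrivial_normal_iff)
qed

end
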